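(* Let $(M,g,\Pi)$ be an $n$-dimensional compact Riemannian Poisson manifold with contravariant Levi-Civita connection $\mathcal{D}$, and let $\eta$ be a Killing 1-form on $M$ with $\mathcal{D}_\eta\eta=0$. If $Ric(\eta,\eta)\leq 0$, then $\eta$ is parallel.
   Context: Let $M$ be a smooth manifold with a Poisson tensor $\Pi$ (bivector field with $[\Pi,\Pi]_S=0$), and let $g$ be the cometric (induced metric on $T^*M$) of a Riemannian metric on $M$. The sharp map is defined by $\eta(\sharp_\Pi(\omega))=\Pi(\omega,\eta)$ and the Koszul bracket on 1-forms is $[\omega,\eta]_\Pi=\mathcal{L}_{\sharp_\Pi(\omega)}\eta-\mathcal{L}_{\sharp_\Pi(\eta)}\omega-d(\Pi(\omega,\eta))$. The contravariant Levi-Civita connection of $(\Pi,g)$ is the unique map $\mathcal{D}:\Omega^1(M)\times\Omega^1(M)\to\Omega^1(M)$, $\mathbb{R}$-bilinear with $\mathcal{D}_{\phi\omega}\eta=\phi\mathcal{D}_\omega\eta$ and $\mathcal{D}_\omega(\phi\eta)=\phi\mathcal{D}_\omega\eta+\sharp_\Pi(\omega)(\phi)\eta$ for $\phi\in\mathcal{C}^\infty(M)$, satisfying $\mathcal{D}_\omega\eta-\mathcal{D}_\eta\omega=[\omega,\eta]_\Pi$ and $\sharp_\Pi(\omega)g(\eta,\gamma)=g(\mathcal{D}_\omega\eta,\gamma)+g(\eta,\mathcal{D}_\omega\gamma)$. $(M,g,\Pi)$ is a Riemannian Poisson manifold if $\mathcal{D}\Pi=0$, i.e. $\sharp_\Pi(\omega)\Pi(\eta,\gamma)=\Pi(\mathcal{D}_\omega\eta,\gamma)+\Pi(\eta,\mathcal{D}_\omega\gamma)$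 for all 1-forms. Curvature: $\mathcal{R}(\omega,\eta)\gamma=\mathcal{D}_\omega\mathcal{D}_\eta\gamma-\mathcal{D}_\eta\mathcal{D}_\omega\gamma-\mathcal{D}_{[\omega,\eta]_\Pi}\gamma$. Ricci curvature: $Ric(\omega,\eta)=\sum_{i=1}^n g(\mathcal{R}(\omega,\theta_i)\theta_i,\eta)$ for any local orthonormal coframe $\{\theta_1,\dots,\theta_n\}$; $Ric(\eta,\eta)\le 0$ means at every point of $M$. Killing: $\eta$ is a Killing 1-form if $\mathcal{L}_\eta g=0$, where $(\mathcal{L}_\eta g)(\alpha,\beta)=\sharp_\Pi(\eta)(g(\alpha,\beta))-g([\eta,\alpha]_\Pi,\beta)-g(\alpha,[\eta,\beta]_\Pi)$. Parallel: $\mathcal{D}\eta=0$, i.e. $\mathcal{D}_\alpha\eta=0$ for all $\alpha\in\Omega^1(M)$. *)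

theory Defs
  imports "HOL-Analysis.Analysis"
begin

section \<open>Smooth manifolds\<close>

text \<open>
  \<open>Ck k S f\<close>: the map \<open>f\<close> is of class \<open>C\<^sup>k\<close> on the open set \<open>S\<close>.  In finite dimension this is the same
  as existence and continuity of the iterated Frechet derivatives up to order \<open>k\<close>.
\<close>

primrec Ck :: "nat \<Rightarrow> 'a::euclidean_space set \<Rightarrow> ('a \<Rightarrow> 'b::real_normed_vector) \<Rightarrow> bool" where
  "Ck 0 S f \<longleftrightarrow> continuous_on S f"
| "Ck (Suc k) S f \<longleftrightarrow>
     (\<forall>x\<in>S. f differentiable (at x)) \<and> (\<forall>v. Ck k S (\<lambda>x. frechet_derivative f (at x) v))"

definition smooth_on :: "'a::euclidean_space set \<Rightarrow> ('a \<Rightarrow> 'b::real_normed_vector) \<Rightarrow> bool" where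
  "smooth_on S f \<longleftrightarrow> (\<forall>k. Ck k S f)"

text \<open>
  The underlying space of the manifold is the whole type \<open>'m\<close> (Hausdorff and second countable); the
  model space is \<open>'e\<close>, so the dimension of the manifold is \<open>DIM('e)\<close>.  A chart is a pair of its domain
  and its coordinate map.  A smooth structure is given by a smooth atlas, which need not be maximal.
\<close>

type_synonym ('m, 'e) chart = "'m set \<times> ('m \<Rightarrow> 'e)"

definition chart_image :: "('m, 'e) chart \<Rightarrow> 'e set" where
  "chart_image c = snd c ` fst c"

definition chart_inv :: "('m, 'e) chart \<Rightarrow> 'e \<Rightarrow> 'm" where
  "chart_inv c = inv_into (fst c) (snd c)"

definition smooth_atlas ::
  "('m::{t2_space,second_countable_topology}, 'e::euclidean_space) chart set \<Rightarrow> bool" where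
  "smooth_atlas A \<longleftrightarrow>
     (\<Union>c\<in>A. fst c) = UNIV \<and>
     (\<forall>c\<in>A. open (fst c) \<and> open (chart_image c) \<and>
        homeomorphism (fst c) (chart_image c) (snd c) (chart_inv c)) \<and>
     (\<forall>c\<in>A. \<forall>c'\<in>A. smooth_on (snd c ` (fst c \<inter> fst c')) (snd c' \<circ> chart_inv c))"

definition smooth_fun :: "('m, 'e::euclidean_space) chart set \<Rightarrow> ('m \<Rightarrow> real) set" where
  "smooth_fun A = {f. \<forall>c\<in>A. smooth_on (chart_image c) (f \<circ> chart_inv c)}"

section \<open>Tangent vectors, vector fields and 1-forms\<close>

text \<open>
  Tangent vectors are derivations of the algebra of smooth functions.  To make them (and covectors)
  determined by their values where these are meaningful, they are extended by 0: a tangent vector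
  vanishes on functions that are not smooth, a covector vanishes on functionals that are not tangent
  vectors at the given point.
\<close>

type_synonym 'm tvec = "('m \<Rightarrow> real) \<Rightarrow> real"
type_synonym 'm covec = "'m tvec \<Rightarrow> real"
type_synonym 'm vfield = "'m \<Rightarrow> 'm tvec"
type_synonym 'm form = "'m \<Rightarrow> 'm covec"

definition tangent_space :: "('m, 'e::euclidean_space) chart set \<Rightarrow> 'm \<Rightarrow> 'm tvec set" where
  "tangent_space A p = {v.
     (\<forall>f. f \<notin> smooth_fun A \<longrightarrow> v f = 0) \<and>
     (\<forall>f\<in>smooth_fun A. \<forall>g\<in>smooth_fun A. \<forall>a b. v (\<lambda>q. a * f q + b * g q) = a * v f + b * v g) \<and>
     (\<forall>f\<in>smooth_fun A. \<forall>g\<in>smooth_fun A. v (\<lambda>q. f q * g q) = f p * v g + g p * v f)}"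

definition cotangent_space :: "('m, 'e::euclidean_space) chart set \<Rightarrow> 'm \<Rightarrow> 'm covec set" where
  "cotangent_space A p = {\<alpha>.
     (\<forall>v. v \<notin> tangent_space A p \<longrightarrow> \<alpha> v = 0) \<and>
     (\<forall>v\<in>tangent_space A p. \<forall>w\<in>tangent_space A p. \<forall>a b.
        \<alpha> (\<lambda>f. a * v f + b * w f) = a * \<alpha> v + b * \<alpha> w)}"

definition vector_fields :: "('m, 'e::euclidean_space) chart set \<Rightarrow> 'm vfield set" where
  "vector_fields A = {X. (\<forall>p. X p \<in> tangent_space A p) \<and>
     (\<forall>f\<in>smooth_fun A. (\<lambda>p. X p f) \<in> smooth_fun A)}"

definition one_forms :: "('m, 'e::euclidean_space) chart set \<Rightarrow> 'm form set" where
  "one_forms A = {\<omega>. (\<forall>p. \<omega> p \<in> cotangent_space A p) \<and>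
     (\<forall>X\<in>vector_fields A. (\<lambda>p. \<omega> p (X p)) \<in> smooth_fun A)}"

definition form_zero :: "'m form" where
  "form_zero = (\<lambda>p v. 0)"

definition form_add :: "'m form \<Rightarrow> 'm form \<Rightarrow> 'm form"  (infixl "+\<^sub>F" 65) where
  "\<omega> +\<^sub>F \<eta> = (\<lambda>p v. \<omega> p v + \<eta> p v)"

definition form_diff :: "'m form \<Rightarrow> 'm form \<Rightarrow> 'm form"  (infixl "-\<^sub>F" 65) where
  "\<omega> -\<^sub>F \<eta> = (\<lambda>p v. \<omega> p v - \<eta> p v)"

definition form_scale :: "('m \<Rightarrow> real) \<Rightarrow> 'm form \<Rightarrow> 'm form"  (infixr "*\<^sub>F" 75) where
  "\<phi> *\<^sub>F \<omega> = (\<lambda>p v. \<phi> p * \<omega> p v)"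

definition ext_deriv :: "('m, 'e::euclidean_space) chart set \<Rightarrow> ('m \<Rightarrow> real) \<Rightarrow> 'm form" where
  "ext_deriv A f = (\<lambda>p v. if v \<in> tangent_space A p then v f else 0)"

definition lie_bracket :: "'m vfield \<Rightarrow> 'm vfield \<Rightarrow> 'm vfield" where
  "lie_bracket X Y = (\<lambda>p f. X p (\<lambda>q. Y q f) - Y p (\<lambda>q. X q f))"

text \<open>The Lie derivative of a 1-form, determined by \<open>(L\<^sub>X \<eta>)(Y) = X(\<eta>(Y)) - \<eta>([X,Y])\<close>.\<close>

definition lie_deriv ::
  "('m, 'e::euclidean_space) chart set \<Rightarrow> 'm vfield \<Rightarrow> 'm form \<Rightarrow> 'm form" where
  "lie_deriv A X \<eta> = (THE \<zeta>. \<zeta> \<in> one_forms A \<and>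
     (\<forall>Y\<in>vector_fields A. \<forall>p. \<zeta> p (Y p) = X p (\<lambda>q. \<eta> q (Y q)) - \<eta> p (lie_bracket X Y p)))"

section \<open>Riemannian metrics and cometrics\<close>

type_synonym 'm metric = "'m \<Rightarrow> 'm tvec \<Rightarrow> 'm tvec \<Rightarrow> real"
type_synonym 'm cobilinear = "'m \<Rightarrow> 'm covec \<Rightarrow> 'm covec \<Rightarrow> real"

definition riemannian_metric :: "('m, 'e::euclidean_space) chart set \<Rightarrow> 'm metric \<Rightarrow> bool" where
  "riemannian_metric A h \<longleftrightarrow>
     (\<forall>p. \<forall>u\<in>tangent_space A p. \<forall>v\<in>tangent_space A p. \<forall>w\<in>tangent_space A p. \<forall>a b.
        h p (\<lambda>f. a * u f + b * v f) w = a * h p u w + b * h p v w) \<and>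
     (\<forall>p. \<forall>v\<in>tangent_space A p. \<forall>w\<in>tangent_space A p. h p v w = h p w v) \<and>
     (\<forall>p. \<forall>v\<in>tangent_space A p. v \<noteq> (\<lambda>f. 0) \<longrightarrow> h p v v > 0) \<and>
     (\<forall>X\<in>vector_fields A. \<forall>Y\<in>vector_fields A. (\<lambda>p. h p (X p) (Y p)) \<in> smooth_fun A)"

definition metric_sharp ::
  "('m, 'e::euclidean_space) chart set \<Rightarrow> 'm metric \<Rightarrow> 'm \<Rightarrow> 'm covec \<Rightarrow> 'm tvec" where
  "metric_sharp A h p \<alpha> =
     (THE v. v \<in> tangent_space A p \<and> (\<forall>w\<in>tangent_space A p. h p v w = \<alpha> w))"

definition cometric :: "('m, 'e::euclidean_space) chart set \<Rightarrow> 'm metric \<Rightarrow> 'm cobilinear" where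
  "cometric A h = (\<lambda>p \<alpha> \<beta>. h p (metric_sharp A h p \<alpha>) (metric_sharp A h p \<beta>))"

section \<open>Poisson tensors\<close>

definition bivector_field :: "('m, 'e::euclidean_space) chart set \<Rightarrow> 'm cobilinear \<Rightarrow> bool" where
  "bivector_field A P \<longleftrightarrow>
     (\<forall>p. \<forall>\<alpha>\<in>cotangent_space A p. \<forall>\<beta>\<in>cotangent_space A p. \<forall>\<gamma>\<in>cotangent_space A p. \<forall>a b.
        P p (\<lambda>v. a * \<alpha> v + b * \<beta> v) \<gamma> = a * P p \<alpha> \<gamma> + b * P p \<beta> \<gamma>) \<and>
     (\<forall>p. \<forall>\<alpha>\<in>cotangent_space A p. \<forall>\<beta>\<in>cotangent_space A p. P p \<alpha> \<beta> = - P p \<beta> \<alpha>) \<and>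
     (\<forall>\<omega>\<in>one_forms A. \<forall>\<eta>\<in>one_forms A. (\<lambda>p. P p (\<omega> p) (\<eta> p)) \<in> smooth_fun A)"

text \<open>
  The coordinate tangent vector in direction \<open>a\<close> and, for \<open>a \<in> Basis\<close>, the dual coordinate covector
  \<open>dx\<^sup>a\<close>, at a point of the domain of the chart \<open>c\<close>.
\<close>

definition coord_vec ::
  "('m, 'e::euclidean_space) chart set \<Rightarrow> ('m, 'e) chart \<Rightarrow> 'e \<Rightarrow> 'm \<Rightarrow> 'm tvec" where
  "coord_vec A c a p = (\<lambda>f. if f \<in> smooth_fun A
     then frechet_derivative (f \<circ> chart_inv c) (at (snd c p)) a else 0)"

definition coord_covec ::
  "('m, 'e::euclidean_space) chart set \<Rightarrow> ('m, 'e) chart \<Rightarrow> 'e \<Rightarrow> 'm \<Rightarrow> 'm covec" where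
  "coord_covec A c a p = (THE \<alpha>. \<alpha> \<in> cotangent_space A p \<and>
     (\<forall>b\<in>Basis. \<alpha> (coord_vec A c b p) = (if b = a then 1 else 0)))"

definition bivector_comp ::
  "('m, 'e::euclidean_space) chart set \<Rightarrow> ('m, 'e) chart \<Rightarrow> 'm cobilinear \<Rightarrow> 'e \<Rightarrow> 'e \<Rightarrow> 'e \<Rightarrow> real" where
  "bivector_comp A c P a b = (\<lambda>x. P (chart_inv c x)
     (coord_covec A c a (chart_inv c x)) (coord_covec A c b (chart_inv c x)))"

text \<open>
  The components of the Schouten bracket of two bivector fields \<open>P\<close>, \<open>Q\<close> in a chart, as functions of
  the coordinates:
  \<open>[P,Q]\<^sup>a\<^sup>b\<^sup>d = \<Sum>\<^sub>l (P\<^sup>a\<^sup>l \<partial>\<^sub>l Q\<^sup>b\<^sup>d + Q\<^sup>a\<^sup>l \<partial>\<^sub>l P\<^sup>b\<^sup>d)\<close> summed over the cyclic permutations of \<open>(a, b, d)\<close>.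
  This is what \<open>[X\<^sub>1 \<and> X\<^sub>2, Y\<^sub>1 \<and> Y\<^sub>2] = \<Sum>\<^sub>i\<^sub>j (-1)\<^sup>i\<^sup>+\<^sup>j [X\<^sub>i,Y\<^sub>j] \<and> X\<^sub>3\<^sub>-\<^sub>i \<and> Y\<^sub>3\<^sub>-\<^sub>j\<close> yields for bivector fields
  \<open>f \<partial>\<^sub>i \<and> \<partial>\<^sub>j\<close>; other sign conventions differ by an overall sign.
\<close>

definition schouten_term ::
  "('m, 'e::euclidean_space) chart set \<Rightarrow> ('m, 'e) chart \<Rightarrow> 'm cobilinear \<Rightarrow> 'm cobilinear
     \<Rightarrow> 'e \<Rightarrow> 'e \<Rightarrow> 'e \<Rightarrow> 'e \<Rightarrow> real" where
  "schouten_term A c P Q a b d x =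
     (\<Sum>l\<in>Basis. bivector_comp A c P a l x * frechet_derivative (bivector_comp A c Q b d) (at x) l
              + bivector_comp A c Q a l x * frechet_derivative (bivector_comp A c P b d) (at x) l)"

definition schouten_comp ::
  "('m, 'e::euclidean_space) chart set \<Rightarrow> ('m, 'e) chart \<Rightarrow> 'm cobilinear \<Rightarrow> 'm cobilinear
     \<Rightarrow> 'e \<Rightarrow> 'e \<Rightarrow> 'e \<Rightarrow> 'e \<Rightarrow> real" where
  "schouten_comp A c P Q a b d x =
     schouten_term A c P Q a b d x + schouten_term A c P Q b d a x + schouten_term A c P Q d a b x"

definition poisson_tensor :: "('m, 'e::euclidean_space) chart set \<Rightarrow> 'm cobilinear \<Rightarrow> bool" where
  "poisson_tensor A P \<longleftrightarrow> bivector_field A P \<and>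
     (\<forall>c\<in>A. \<forall>a\<in>Basis. \<forall>b\<in>Basis. \<forall>d\<in>Basis. \<forall>x\<in>chart_image c. schouten_comp A c P P a b d x = 0)"

definition sharp ::
  "('m, 'e::euclidean_space) chart set \<Rightarrow> 'm cobilinear \<Rightarrow> 'm form \<Rightarrow> 'm vfield" where
  "sharp A P \<omega> = (\<lambda>p. THE v. v \<in> tangent_space A p \<and>
     (\<forall>\<beta>\<in>cotangent_space A p. \<beta> v = P p (\<omega> p) \<beta>))"

definition koszul ::
  "('m, 'e::euclidean_space) chart set \<Rightarrow> 'm cobilinear \<Rightarrow> 'm form \<Rightarrow> 'm form \<Rightarrow> 'm form" where
  "koszul A P \<omega> \<eta> = lie_deriv A (sharp A P \<omega>) \<eta> -\<^sub>F lie_deriv A (sharp A P \<eta>) \<omega>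
     -\<^sub>F ext_deriv A (\<lambda>p. P p (\<omega> p) (\<eta> p))"

section \<open>The contravariant Levi-Civita connection and its curvature\<close>

definition contravariant_connection ::
  "('m, 'e::euclidean_space) chart set \<Rightarrow> 'm cobilinear \<Rightarrow> ('m form \<Rightarrow> 'm form \<Rightarrow> 'm form) \<Rightarrow> bool"
where
  "contravariant_connection A P D \<longleftrightarrow>
     (\<forall>\<omega>\<in>one_forms A. \<forall>\<eta>\<in>one_forms A. D \<omega> \<eta> \<in> one_forms A) \<and>
     (\<forall>\<omega>\<in>one_forms A. \<forall>\<omega>'\<in>one_forms A. \<forall>\<eta>\<in>one_forms A.
        D (\<omega> +\<^sub>F \<omega>') \<eta> = D \<omega> \<eta> +\<^sub>F D \<omega>' \<eta>) \<and>
     (\<forall>\<omega>\<in>one_forms A. \<forall>\<eta>\<in>one_forms A. \<forall>\<eta>'\<in>one_forms A.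
        D \<omega> (\<eta> +\<^sub>F \<eta>') = D \<omega> \<eta> +\<^sub>F D \<omega> \<eta>') \<and>
     (\<forall>\<omega>\<in>one_forms A. \<forall>\<eta>\<in>one_forms A. \<forall>r::real.
        D ((\<lambda>p. r) *\<^sub>F \<omega>) \<eta> = (\<lambda>p. r) *\<^sub>F D \<omega> \<eta> \<and>
        D \<omega> ((\<lambda>p. r) *\<^sub>F \<eta>) = (\<lambda>p. r) *\<^sub>F D \<omega> \<eta>) \<and>
     (\<forall>\<omega>\<in>one_forms A. \<forall>\<eta>\<in>one_forms A. \<forall>\<phi>\<in>smooth_fun A.
        D (\<phi> *\<^sub>F \<omega>) \<eta> = \<phi> *\<^sub>F D \<omega> \<eta>) \<and>
     (\<forall>\<omega>\<in>one_forms A. \<forall>\<eta>\<in>one_forms A. \<forall>\<phi>\<in>smooth_fun A.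
        D \<omega> (\<phi> *\<^sub>F \<eta>) = \<phi> *\<^sub>F D \<omega> \<eta> +\<^sub>F (\<lambda>p. sharp A P \<omega> p \<phi>) *\<^sub>F \<eta>)"

definition contravariant_levi_civita ::
  "('m, 'e::euclidean_space) chart set \<Rightarrow> 'm cobilinear \<Rightarrow> 'm cobilinear
     \<Rightarrow> ('m form \<Rightarrow> 'm form \<Rightarrow> 'm form) \<Rightarrow> bool"
where
  "contravariant_levi_civita A P g D \<longleftrightarrow> contravariant_connection A P D \<and>
     (\<forall>\<omega>\<in>one_forms A. \<forall>\<eta>\<in>one_forms A. D \<omega> \<eta> -\<^sub>F D \<eta> \<omega> = koszul A P \<omega> \<eta>) \<and>
     (\<forall>\<omega>\<in>one_forms A. \<forall>\<eta>\<in>one_forms A. \<forall>\<gamma>\<in>one_forms A. \<forall>p.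
        sharp A P \<omega> p (\<lambda>q. g q (\<eta> q) (\<gamma> q)) = g p (D \<omega> \<eta> p) (\<gamma> p) + g p (\<eta> p) (D \<omega> \<gamma> p))"

definition parallel_bivector ::
  "('m, 'e::euclidean_space) chart set \<Rightarrow> 'm cobilinear \<Rightarrow> ('m form \<Rightarrow> 'm form \<Rightarrow> 'm form) \<Rightarrow> bool"
where
  "parallel_bivector A P D \<longleftrightarrow>
     (\<forall>\<omega>\<in>one_forms A. \<forall>\<eta>\<in>one_forms A. \<forall>\<gamma>\<in>one_forms A. \<forall>p.
        sharp A P \<omega> p (\<lambda>q. P q (\<eta> q) (\<gamma> q)) = P p (D \<omega> \<eta> p) (\<gamma> p) + P p (\<eta> p) (D \<omega> \<gamma> p))"

text \<open>
  The contravariant Levi-Civita connection is unique, so it is carried along as an argument \<open>D\<close>.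
\<close>

definition riemannian_poisson_manifold ::
  "('m::{t2_space,second_countable_topology}, 'e::euclidean_space) chart set
     \<Rightarrow> 'm metric \<Rightarrow> 'm cobilinear \<Rightarrow> ('m form \<Rightarrow> 'm form \<Rightarrow> 'm form) \<Rightarrow> bool"
where
  "riemannian_poisson_manifold A h P D \<longleftrightarrow>
     smooth_atlas A \<and> riemannian_metric A h \<and> poisson_tensor A P \<and>
     contravariant_levi_civita A P (cometric A h) D \<and> parallel_bivector A P D"

definition curvature ::
  "('m, 'e::euclidean_space) chart set \<Rightarrow> 'm cobilinear \<Rightarrow> ('m form \<Rightarrow> 'm form \<Rightarrow> 'm form)
     \<Rightarrow> 'm form \<Rightarrow> 'm form \<Rightarrow> 'm form \<Rightarrow> 'm form"
where
  "curvature A P D \<omega> \<eta> \<gamma> = D \<omega> (D \<eta> \<gamma>) -\<^sub>F D \<eta> (D \<omega> \<gamma>) -\<^sub>F D (koszul A P \<omega> \<eta>) \<gamma>"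

text \<open>
  A local orthonormal coframe around \<open>p\<close> is given by 1-forms on the whole manifold that are
  orthonormal near \<open>p\<close>.  Every coframe defined only near \<open>p\<close> agrees with such 1-forms on a smaller
  neighbourhood of \<open>p\<close>, and the connection, being a local operator, depends on nothing else there.
\<close>

definition local_orthonormal_coframe ::
  "('m::topological_space, 'e::euclidean_space) chart set \<Rightarrow> 'm cobilinear \<Rightarrow> 'm
     \<Rightarrow> (nat \<Rightarrow> 'm form) \<Rightarrow> bool"
where
  "local_orthonormal_coframe A g p \<theta> \<longleftrightarrow>
     (\<forall>i<DIM('e). \<theta> i \<in> one_forms A) \<and>
     (\<exists>U. open U \<and> p \<in> U \<and> (\<forall>q\<in>U. \<forall>i<DIM('e). \<forall>j<DIM('e).
        g q (\<theta> i q) (\<theta> j q) = (if i = j then 1 else 0)))"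

text \<open>The value does not depend on the choice of the coframe.\<close>

definition ricci ::
  "('m::topological_space, 'e::euclidean_space) chart set \<Rightarrow> 'm cobilinear \<Rightarrow> 'm cobilinear
     \<Rightarrow> ('m form \<Rightarrow> 'm form \<Rightarrow> 'm form) \<Rightarrow> 'm form \<Rightarrow> 'm form \<Rightarrow> 'm \<Rightarrow> real"
where
  "ricci A P g D \<omega> \<eta> p =
     (let \<theta> = (SOME \<theta>. local_orthonormal_coframe A g p \<theta>)
      in \<Sum>i<DIM('e). g p (curvature A P D \<omega> (\<theta> i) (\<theta> i) p) (\<eta> p))"

definition lie_deriv_cometric ::
  "('m, 'e::euclidean_space) chart set \<Rightarrow> 'm cobilinear \<Rightarrow> 'm cobilinear
     \<Rightarrow> 'm form \<Rightarrow> 'm form \<Rightarrow> 'm form \<Rightarrow> 'm \<Rightarrow> real"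
where
  "lie_deriv_cometric A P g \<eta> \<alpha> \<beta> p =
     sharp A P \<eta> p (\<lambda>q. g q (\<alpha> q) (\<beta> q))
     - g p (koszul A P \<eta> \<alpha> p) (\<beta> p) - g p (\<alpha> p) (koszul A P \<eta> \<beta> p)"

definition killing_form ::
  "('m, 'e::euclidean_space) chart set \<Rightarrow> 'm cobilinear \<Rightarrow> 'm cobilinear \<Rightarrow> 'm form \<Rightarrow> bool" where
  "killing_form A P g \<eta> \<longleftrightarrow> \<eta> \<in> one_forms A \<and>
     (\<forall>\<alpha>\<in>one_forms A. \<forall>\<beta>\<in>one_forms A. \<forall>p. lie_deriv_cometric A P g \<eta> \<alpha> \<beta> p = 0)"

definition parallel_form ::
  "('m, 'e::euclidean_space) chart set \<Rightarrow> ('m form \<Rightarrow> 'm form \<Rightarrow> 'm form) \<Rightarrow> 'm form \<Rightarrow> bool" where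
  "parallel_form A D \<eta> \<longleftrightarrow> (\<forall>\<alpha>\<in>one_forms A. D \<alpha> \<eta> = form_zero)"

end

theory Submission
  imports Defs
begin

text \<open>
  The proof is pointwise.  Let \<open>\<eta>\<close> be a Killing 1-form with \<open>D\<^sub>\<eta> \<eta> = 0\<close>.  Rewritten with the metric
  compatibility and the vanishing torsion of \<open>D\<close>, the Killing equation says that \<open>\<alpha> \<mapsto> D\<^sub>\<alpha> \<eta>\<close> is
  skew-adjoint for \<open>g\<close> (\<open>killing_skew\<close>).  Expanding \<open>g(R(\<eta>,\<theta>)\<theta>, \<eta>)\<close> with the metric compatibility
  therefore moves all derivatives onto the single function \<open>f = g(\<theta>,\<eta>)\<close>, with the result
  \<open>(\<sharp>\<eta>(\<sharp>\<theta> f) - \<sharp>\<theta>(\<sharp>\<eta> f) - \<sharp>[\<eta>,\<theta>] f) + g(D\<^sub>\<theta> \<eta>, D\<^sub>\<theta> \<eta>)\<close>.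
  The sharp map sends the Koszul bracket to the commutator of vector fields (\<open>anchor_bracket\<close>), so
  the parenthesis vanishes and \<open>g(R(\<eta>,\<theta>)\<theta>, \<eta>)\<close> is the squared norm of \<open>D\<^sub>\<theta> \<eta>\<close>
  (\<open>curvature_killing\<close>).  Hence \<open>Ric(\<eta>,\<eta>)\<close> is the sum of the squared norms of the \<open>D\<^bsub>\<theta>\<^sub>i\<^esub> \<eta>\<close> over an
  orthonormal coframe \<open>\<theta>\<^sub>i\<close>.  If it is nonpositive, all \<open>D\<^bsub>\<theta>\<^sub>i\<^esub> \<eta>\<close> vanish at the point, and so does
  \<open>D\<^sub>\<alpha> \<eta>\<close> for every \<open>\<alpha>\<close>, because \<open>\<alpha>\<close> is a combination of the \<open>\<theta>\<^sub>i\<close> with smooth coefficients near the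
  point.

  The anchor identity is obtained from \<open>D\<Pi> = 0\<close>.  For \<open>\<gamma> = df\<close> consider the cyclic sum of
  \<open>\<sharp>\<alpha> \<Pi>(\<beta>,\<gamma>) - \<Pi>([\<alpha>,\<beta>],\<gamma>)\<close> over \<open>(\<alpha>,\<beta>,\<gamma>)\<close>.  It vanishes because \<open>\<Pi>\<close> is parallel and \<open>D\<close> is torsion-free.
  Expanding the three Koszul brackets by their definition instead shows that the sum is twice
  \<open>\<sharp>\<alpha>(\<sharp>\<beta> f) - \<sharp>\<beta>(\<sharp>\<alpha> f) - \<sharp>[\<alpha>,\<beta>] f\<close>.

  The larger part of the text gives these objects their meaning on a manifold whose tangent vectors
  are derivations.  By Hadamard's lemma the coordinate vector fields span the derivations at each
  point of a chart, and cutoff functions make the coordinates and these fields global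
  (\<open>coordinate_frame\<close>).  This yields the existence of Lie derivatives (\<open>lie_deriv_apply\<close>) and of the
  sharp map (\<open>sharp_props\<close>), and, by the Gram-Schmidt process, orthonormal frames, in which
  the cometric becomes the standard inner product of components (\<open>cometric_frame\<close>).
\<close>

section \<open>Calculus of \<open>C\<^sup>k\<close> maps\<close>

lemma Ck_SucD:
  assumes "Ck (Suc k) S f"
  shows "x \<in> S \<Longrightarrow> (f has_derivative frechet_derivative f (at x)) (at x)"
    and "Ck k S (\<lambda>x. frechet_derivative f (at x) v)"
  using assms by (auto simp: frechet_derivative_works)

lemma Ck_Suc_imp_Ck: "Ck (Suc k) S f \<Longrightarrow> Ck k S f"
proof (induction k arbitrary: f)
  case 0
  then show ?case
    by (auto intro!: continuous_at_imp_continuous_on differentiable_imp_continuous_within)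
next
  case (Suc k)
  then show ?case by (metis Ck.simps(2))
qed

lemma Ck_imp_continuous_on: "Ck k S f \<Longrightarrow> continuous_on S f"
  by (induction k) (simp, metis Ck_Suc_imp_Ck)

lemma Ck_subset: "Ck k S f \<Longrightarrow> T \<subseteq> S \<Longrightarrow> Ck k T f"
  by (induction k arbitrary: f) (auto intro: continuous_on_subset)

lemma Ck_cong:
  assumes "open S" "\<And>x. x \<in> S \<Longrightarrow> f x = g x" "Ck k S f"
  shows "Ck k S g"
  using assms
proof (induction k arbitrary: f g)
  case 0
  then show ?case using continuous_on_eq by fastforce
next
  case (Suc k)
  have d: "(g has_derivative frechet_derivative f (at x)) (at x)" if "x \<in> S" for x
    using has_derivative_transform_within_open[OF Ck_SucD(1)[OF Suc.prems(3) that] Suc.prems(1) that]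
      Suc.prems(2) by blast
  have eq: "frechet_derivative f (at x) = frechet_derivative g (at x)" if "x \<in> S" for x
    using frechet_derivative_at[OF d[OF that]] .
  have "Ck k S (\<lambda>x. frechet_derivative g (at x) v)" for v
    by (rule Suc.IH[OF Suc.prems(1) _ Ck_SucD(2)[OF Suc.prems(3), of v]]) (simp add: eq)
  then show ?case using d by (auto simp: differentiable_def)
qed

lemma Ck_local:
  assumes "\<And>x. x \<in> S \<Longrightarrow> \<exists>U. open U \<and> x \<in> U \<and> Ck k U f"
  shows "Ck k S f"
  using assms
proof (induction k arbitrary: f)
  case 0
  then show ?case
    by (auto intro!: continuous_at_imp_continuous_on simp: continuous_on_eq_continuous_at)
      (metis continuous_on_eq_continuous_at)
next
  case (Suc k)
  have "Ck k S (\<lambda>x. frechet_derivative f (at x) v)" for v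
    by (rule Suc.IH) (metis Suc.prems Ck_SucD(2))
  moreover have "f differentiable at x" if "x \<in> S" for x
    using Suc.prems[OF that] by auto
  ultimately show ?case by simp
qed

text \<open>
  Any explicit formula for the derivative may be used: the constant \<open>frechet_derivative\<close> never has to
  be computed.
\<close>

lemma Ck_SucI:
  assumes "open S" "\<And>x. x \<in> S \<Longrightarrow> (f has_derivative f' x) (at x)"
    and "\<And>v. Ck k S (\<lambda>x. f' x v)"
  shows "Ck (Suc k) S f"
proof -
  have "Ck k S (\<lambda>x. frechet_derivative f (at x) v)" for v
    by (rule Ck_cong[OF assms(1) _ assms(3)[of v]]) (metis assms(2) frechet_derivative_at)
  then show ?thesis using assms(2) by (auto simp: differentiable_def)
qed

lemma Ck_const: "open S \<Longrightarrow> Ck k S (\<lambda>x. c)"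
proof (induction k arbitrary: c)
  case (Suc k)
  show ?case by (rule Ck_SucI[OF Suc.prems, where f'="\<lambda>x v. 0"]) (use Suc in auto)
qed auto

lemma Ck_add:
  assumes "open S" "Ck k S f" "Ck k S g"
  shows "Ck k S (\<lambda>x. f x + g x)"
  using assms
proof (induction k arbitrary: f g)
  case (Suc k)
  show ?case
    by (rule Ck_SucI[OF Suc.prems(1) has_derivative_add[OF Ck_SucD(1)[OF Suc.prems(2)] Ck_SucD(1)[OF Suc.prems(3)]]])
      (use Suc.IH[OF Suc.prems(1) Ck_SucD(2)[OF Suc.prems(2)] Ck_SucD(2)[OF Suc.prems(3)]] in auto)
qed (auto intro: continuous_on_add)

text \<open>
  The product rule expresses the derivative through the same bilinear map, so one induction covers
  products, scalar multiples and inner products.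
\<close>

lemma Ck_bilinear:
  assumes pr: "bounded_bilinear pr"
  shows "open S \<Longrightarrow> Ck k S f \<Longrightarrow> Ck k S g \<Longrightarrow> Ck k S (\<lambda>x. pr (f x) (g x))"
proof (induction k arbitrary: f g)
  case 0
  then show ?case using bounded_bilinear.continuous_on[OF pr] by auto
next
  case (Suc k)
  show ?case
  proof (rule Ck_SucI[OF Suc.prems(1) bounded_bilinear.FDERIV[OF pr Ck_SucD(1)[OF Suc.prems(2)] Ck_SucD(1)[OF Suc.prems(3)]]])
    fix v
    show "Ck k S (\<lambda>x. pr (f x) (frechet_derivative g (at x) v) + pr (frechet_derivative f (at x) v) (g x))"
      by (intro Ck_add Suc.prems Suc.IH Ck_Suc_imp_Ck[OF Suc.prems(2)] Ck_Suc_imp_Ck[OF Suc.prems(3)]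
        Ck_SucD(2)[OF Suc.prems(2)] Ck_SucD(2)[OF Suc.prems(3)])
  qed
qed

lemma Ck_bounded_linear:
  assumes "open S" "bounded_linear L"
  shows "Ck k S L"
proof (cases k)
  case 0
  then show ?thesis using assms by (simp add: linear_continuous_on)
next
  case (Suc j)
  show ?thesis unfolding Suc
    by (rule Ck_SucI[OF assms(1) bounded_linear_imp_has_derivative[OF assms(2)] Ck_const[OF assms(1)]])
qed

lemma Ck_sum:
  assumes "open S" "finite I" "\<And>i. i \<in> I \<Longrightarrow> Ck k S (f i)"
  shows "Ck k S (\<lambda>x. \<Sum>i\<in>I. f i x)"
  using assms(2,3) by (induction I rule: finite_induct) (auto intro: Ck_const Ck_add assms(1))

text \<open>
  In coordinates the chain rule makes the derivative of \<open>F \<circ> f\<close> along \<open>v\<close> the sum over the basis of the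
  products of \<open>(f' v) \<bullet> b\<close> with \<open>(\<partial>\<^sub>b F) \<circ> f\<close>; the induction hypothesis applies to the latter because \<open>F\<close>
  is arbitrary.
\<close>

lemma Ck_compose:
  fixes f :: "'a::euclidean_space \<Rightarrow> 'b::euclidean_space"
  assumes "open S" "open T" "\<And>x. x \<in> S \<Longrightarrow> f x \<in> T" "Ck k S f" "Ck k T F"
  shows "Ck k S (\<lambda>x. F (f x))"
  using assms
proof (induction k arbitrary: F)
  case 0
  then show ?case
    using continuous_on_compose2[of T F S f] by auto
next
  case (Suc k)
  note F = Ck_SucD[OF Suc.prems(5)] and f = Ck_SucD[OF Suc.prems(4)]
  show ?case
  proof (rule Ck_SucI[OF Suc.prems(1)])
    fix x assume x: "x \<in> S"
    have l: "linear (frechet_derivative F (at (f x)))"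
      using F(1)[OF Suc.prems(3)[OF x]] has_derivative_linear by blast
    have d: "((\<lambda>x. F (f x)) has_derivative (\<lambda>v. frechet_derivative F (at (f x)) (frechet_derivative f (at x) v))) (at x)"
      by (rule has_derivative_compose[OF f(1)[OF x] F(1)[OF Suc.prems(3)[OF x]]])
    have r: "frechet_derivative F (at (f x)) w
        = (\<Sum>b\<in>Basis. (w \<bullet> b) *\<^sub>R frechet_derivative F (at (f x)) b)" for w
    proof -
      have "frechet_derivative F (at (f x)) (\<Sum>b\<in>Basis. (w \<bullet> b) *\<^sub>R b)
          = (\<Sum>b\<in>Basis. (w \<bullet> b) *\<^sub>R frechet_derivative F (at (f x)) b)"
        by (simp only: linear_sum[OF l] linear_cmul[OF l])
      then show ?thesis by (simp only: euclidean_representation)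
    qed
    show "((\<lambda>x. F (f x)) has_derivative
       (\<lambda>v. \<Sum>b\<in>Basis. (frechet_derivative f (at x) v \<bullet> b) *\<^sub>R frechet_derivative F (at (f x)) b)) (at x)"
      by (rule has_derivative_eq_rhs[OF d]) (rule ext, rule r)
  next
    fix v
    show "Ck k S (\<lambda>x. \<Sum>b\<in>Basis. (frechet_derivative f (at x) v \<bullet> b) *\<^sub>R frechet_derivative F (at (f x)) b)"
    proof (rule Ck_sum[OF Suc.prems(1) finite_Basis])
      fix b :: 'b
      show "Ck k S (\<lambda>x. (frechet_derivative f (at x) v \<bullet> b) *\<^sub>R frechet_derivative F (at (f x)) b)"
        by (rule Ck_bilinear[OF bounded_bilinear_scaleR Suc.prems(1)
              Ck_bilinear[OF bounded_bilinear_inner Suc.prems(1) f(2) Ck_const[OF Suc.prems(1)]]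
              Suc.IH[OF Suc.prems(1,2,3) Ck_Suc_imp_Ck[OF Suc.prems(4)] F(2)]])
    qed
  qed
qed

lemma smooth_on_subset: "smooth_on S f \<Longrightarrow> T \<subseteq> S \<Longrightarrow> smooth_on T f"
  by (auto simp: smooth_on_def intro: Ck_subset)

lemma smooth_on_cong: "smooth_on S f \<Longrightarrow> open S \<Longrightarrow> (\<And>x. x \<in> S \<Longrightarrow> f x = g x) \<Longrightarrow> smooth_on S g"
  by (auto simp: smooth_on_def intro: Ck_cong)

lemma smooth_on_local:
  assumes "\<And>x. x \<in> S \<Longrightarrow> \<exists>U. open U \<and> x \<in> U \<and> smooth_on U f"
  shows "smooth_on S f"
  unfolding smooth_on_def by (intro allI Ck_local) (use assms in \<open>auto simp: smooth_on_def\<close>)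

lemma smooth_on_const: "open S \<Longrightarrow> smooth_on S (\<lambda>x. c)"
  by (auto simp: smooth_on_def intro: Ck_const)

lemma smooth_on_linear: "open S \<Longrightarrow> bounded_linear L \<Longrightarrow> smooth_on S L"
  by (auto simp: smooth_on_def intro: Ck_bounded_linear)

lemma smooth_on_add: "open S \<Longrightarrow> smooth_on S f \<Longrightarrow> smooth_on S g \<Longrightarrow> smooth_on S (\<lambda>x. f x + g x)"
  by (auto simp: smooth_on_def intro: Ck_add)

lemma smooth_on_bilinear:
  "bounded_bilinear pr \<Longrightarrow> open S \<Longrightarrow> smooth_on S f \<Longrightarrow> smooth_on S g \<Longrightarrow> smooth_on S (\<lambda>x. pr (f x) (g x))"
  by (auto simp: smooth_on_def intro: Ck_bilinear)

lemmas smooth_on_mult = smooth_on_bilinear[OF bounded_bilinear_mult]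

lemma smooth_on_compose:
  fixes f :: "'a::euclidean_space \<Rightarrow> 'b::euclidean_space"
  shows "smooth_on S f \<Longrightarrow> smooth_on T F \<Longrightarrow> open S \<Longrightarrow> open T \<Longrightarrow> (\<And>x. x \<in> S \<Longrightarrow> f x \<in> T)
    \<Longrightarrow> smooth_on S (\<lambda>x. F (f x))"
  by (auto simp: smooth_on_def intro: Ck_compose)

lemma smooth_on_frechet_derivative:
  "smooth_on S f \<Longrightarrow> smooth_on S (\<lambda>x. frechet_derivative f (at x) v)"
  unfolding smooth_on_def by (metis Ck_SucD(2))

lemma smooth_on_has_derivative:
  "smooth_on S f \<Longrightarrow> x \<in> S \<Longrightarrow> (f has_derivative frechet_derivative f (at x)) (at x)"
  unfolding smooth_on_def by (metis Ck_SucD(1))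

section \<open>Smooth functions of one real variable\<close>

text \<open>
  The derivative of a power is a multiple of a power with another exponent; hence the induction is
  over all exponents simultaneously.
\<close>

lemma smooth_on_powr: "smooth_on {0<..} (\<lambda>t::real. t powr a)"
proof -
  have "Ck k {0<..} (\<lambda>t::real. t powr a)" for k
  proof (induction k arbitrary: a)
    case 0
    then show ?case by (auto intro!: continuous_intros)
  next
    case (Suc k)
    show ?case
    proof (rule Ck_SucI)
      fix x :: real assume "x \<in> {0<..}"
      then show "((\<lambda>t. t powr a) has_derivative (\<lambda>v. v * a * (x powr (a - 1)))) (at x)"
        by (auto intro!: derivative_eq_intros simp: powr_diff field_simps)
    next
      fix v show "Ck k {0<..} (\<lambda>x::real. v * a * x powr (a - 1))"
        by (intro Ck_bilinear[OF bounded_bilinear_mult] Ck_const Suc.IH) auto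
    qed auto
  qed
  then show ?thesis by (auto simp: smooth_on_def)
qed

text \<open>
  The function \<open>exp(-1/t) / t\<^sup>n\<close>, extended by 0.  The case \<open>n = 0\<close> is the usual flat function; the
  other exponents make the family stable under differentiation up to linear combinations.
\<close>

definition flat_exp :: "nat \<Rightarrow> real \<Rightarrow> real" where
  "flat_exp n t = (if t > 0 then exp (- (1 / t)) * (1 / t) ^ n else 0)"

lemma power_le_fact_exp: "s ^ n \<le> fact n * exp s" if "s \<ge> 0" for s :: real
proof -
  have "s ^ n /\<^sub>R fact n \<le> exp s"
    using sum_le_suminf[OF summable_exp_generic[of s], of "{n}"] that by (simp add: exp_def)
  then show ?thesis by (simp add: field_simps)
qed

text \<open>
  This is \<open>s\<^sup>n\<^sup>+\<^sup>2 \<le> (n+2)! exp(s)\<close> at \<open>s = 1/t\<close>.  Being quadratic, the bound gives derivative 0 at the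
  origin.
\<close>

lemma flat_exp_bound: "\<bar>flat_exp n t\<bar> \<le> fact (n + 2) * \<bar>t\<bar>\<^sup>2"
proof (cases "t > 0")
  case True
  have "(1 / t) ^ (n + 2) \<le> fact (n + 2) * exp (1 / t)"
    by (rule power_le_fact_exp) (use True in auto)
  then have "(1/t) ^ n \<le> fact (n + 2) * exp (1 / t) * t\<^sup>2"
    using True by (simp add: power_add power2_eq_square field_simps)
  then show ?thesis using True
    by (simp add: flat_exp_def exp_minus field_simps abs_mult)
qed (auto simp: flat_exp_def)

lemma flat_exp_deriv:
  "(flat_exp n has_field_derivative (flat_exp (n + 2) t - real n * flat_exp (n + 1) t)) (at t)"
proof -
  consider "t > 0" | "t < 0" | "t = 0" by linarith
  then show ?thesis
  proof cases
    case 1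
    have "((\<lambda>t. exp (- (1 / t)) * (1 / t) ^ n) has_field_derivative
        (flat_exp (n + 2) t - real n * flat_exp (n + 1) t)) (at t)"
      using 1 by (cases n)
        (auto intro!: derivative_eq_intros simp: flat_exp_def field_simps power2_eq_square,
         metis Suc_pred not_gr0 power_Suc)
    then show ?thesis
      by (rule has_field_derivative_transform_within_open[where S="{0<..}"]) (use 1 in \<open>auto simp: flat_exp_def\<close>)
  next
    case 2
    have "((\<lambda>t. 0) has_field_derivative (flat_exp (n + 2) t - real n * flat_exp (n + 1) t)) (at t)"
      using 2 by (auto simp: flat_exp_def)
    then show ?thesis
      by (rule has_field_derivative_transform_within_open[where S="{..<0}"]) (use 2 in \<open>auto simp: flat_exp_def\<close>)
  next
    case 3
    have "((\<lambda>h. (flat_exp n (0 + h) - flat_exp n 0) / h) \<longlongrightarrow> 0) (at 0)"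
    proof (rule Lim_null_comparison[where g="\<lambda>h. fact (n + 2) * \<bar>h\<bar>"])
      show "\<forall>\<^sub>F x in at 0. norm ((flat_exp n (0 + x) - flat_exp n 0) / x) \<le> fact (n + 2) * \<bar>x\<bar>"
        using flat_exp_bound[of n]
        by (intro eventually_at_topological[THEN iffD2] exI[of _ UNIV])
          (auto simp: flat_exp_def[of n 0] divide_simps power2_eq_square mult.assoc)
      show "((\<lambda>h. fact (n + 2) * \<bar>h\<bar>) \<longlongrightarrow> (0::real)) (at 0)"
        by (auto intro!: tendsto_eq_intros)
    qed
    then show ?thesis using 3 by (simp add: DERIV_def flat_exp_def)
  qed
qed

lemma smooth_on_flat_exp: "smooth_on UNIV (flat_exp n)"
proof -
  have "Ck k UNIV (flat_exp n)" for k
  proof (induction k arbitrary: n)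
    case 0
    then show ?case
      by (auto intro!: continuous_at_imp_continuous_on DERIV_isCont[OF flat_exp_deriv])
  next
    case (Suc k)
    show ?case
    proof (rule Ck_SucI)
      fix x
      show "(flat_exp n has_derivative (\<lambda>v. (flat_exp (n + 2) x + - real n * flat_exp (n + 1) x) * v)) (at x)"
        using flat_exp_deriv[of n x] by (simp add: has_field_derivative_def)
    next
      fix v show "Ck k UNIV (\<lambda>x. (flat_exp (n + 2) x + - real n * flat_exp (n + 1) x) * v)"
        by (intro Ck_bilinear[OF bounded_bilinear_mult] Ck_const Suc.IH Ck_add) auto
    qed auto
  qed
  then show ?thesis by (auto simp: smooth_on_def)
qed

text \<open>
  With \<open>G = flat_exp 0\<close>, the witness is \<open>G(t) / (G(t) + G(1 - t))\<close>; the denominator is positive because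
  \<open>t\<close> or \<open>1 - t\<close> is.
\<close>

lemma smooth_step:
  obtains s :: "real \<Rightarrow> real" where "smooth_on UNIV s" "\<And>t. t \<le> 0 \<Longrightarrow> s t = 0" "\<And>t. t \<ge> 1 \<Longrightarrow> s t = 1"
proof -
  define d where "d t = flat_exp 0 t + flat_exp 0 (1 + - t)" for t
  have pos: "d t > 0" for t by (auto simp: d_def flat_exp_def add_pos_nonneg)
  have r: "smooth_on UNIV (\<lambda>t. 1 + - t :: real)"
    by (intro smooth_on_add smooth_on_const
        smooth_on_linear[OF _ bounded_linear_minus[OF bounded_linear_ident]]) auto
  have d: "smooth_on UNIV d" unfolding d_def
    by (rule smooth_on_add[OF _ smooth_on_flat_exp smooth_on_compose[OF r smooth_on_flat_exp]]) auto
  have "smooth_on UNIV (\<lambda>t. flat_exp 0 t * d t powr - 1)"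
    by (intro smooth_on_mult smooth_on_flat_exp smooth_on_compose[OF d smooth_on_powr]) (use pos in auto)
  moreover have "flat_exp 0 t * d t powr -1 = 0" if "t \<le> 0" for t
    using that by (auto simp: flat_exp_def)
  moreover have "flat_exp 0 t * d t powr -1 = 1" if "t \<ge> 1" for t
    using that pos[of t] by (auto simp: powr_minus d_def) (auto simp: flat_exp_def)
  ultimately show ?thesis using that[of "\<lambda>t. flat_exp 0 t * d t powr - 1"] by blast
qed

section \<open>Hadamard's lemma\<close>

lemma ray_in_ball:
  fixes x0 :: "'a::real_normed_vector"
  assumes "x \<in> ball x0 r" "t \<in> {0..1}"
  shows "x0 + t *\<^sub>R (x - x0) \<in> ball x0 r"
proof -
  have "norm (t *\<^sub>R (x - x0)) \<le> norm (x - x0)"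
    using assms(2) by (auto simp: mult_left_le_one_le)
  then show ?thesis using assms(1) by (simp add: dist_norm norm_minus_commute)
qed

text \<open>
  Differentiation under the integral sign replaces \<open>F\<close> by a partial derivative and produces a factor
  \<open>t\<close>, which is why the weight \<open>t\<^sup>m\<close> with arbitrary \<open>m\<close> is carried along.
\<close>

lemma Ck_ray_integral:
  fixes F :: "'a::euclidean_space \<Rightarrow> real"
  assumes "Ck k (ball x0 r) F"
  shows "Ck k (ball x0 r) (\<lambda>x. integral {0..1} (\<lambda>t. t ^ m * F (x0 + t *\<^sub>R (x - x0))))"
  using assms
proof (induction k arbitrary: F m)
  case 0
  have "continuous_on (ball x0 r \<times> cbox 0 1) (\<lambda>(x, t). t ^ m * F (x0 + t *\<^sub>R (x - x0)))"
    unfolding case_prod_beta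
    by (intro continuous_intros continuous_on_compose2[OF 0[simplified]]) (use ray_in_ball in fastforce)
  from integral_continuous_on_param[OF this] show ?case by (simp add: cbox_interval)
next
  case (Suc k)
  let ?B = "ball x0 r" and ?D = "\<lambda>y. Blinfun (frechet_derivative F (at y))"
    and ?y = "\<lambda>x t. x0 + t *\<^sub>R (x - x0)"
  note F = Ck_SucD[OF Suc.prems]
  have cF: "continuous_on ?B F" using Ck_imp_continuous_on[OF Suc.prems] .
  have app: "blinfun_apply (?D y) = frechet_derivative F (at y)" if "y \<in> ?B" for y
    using F(1)[OF that] bounded_linear_Blinfun_apply has_derivative_bounded_linear by blast
  have cD: "continuous_on ?B ?D"
  proof (rule continuous_on_blinfun_componentwise)
    fix i :: 'a
    show "continuous_on ?B (\<lambda>x. blinfun_apply (?D x) i)"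
      by (rule continuous_on_eq[OF Ck_imp_continuous_on[OF F(2)[of i]]]) (simp add: app del: mem_ball)
  qed
  have cDy: "continuous_on (?B \<times> cbox 0 1) (\<lambda>(x, t). t ^ (m + 1) *\<^sub>R ?D (?y x t))"
    unfolding case_prod_beta
    by (intro continuous_intros continuous_on_compose2[OF cD]) (use ray_in_ball in fastforce)
  have cDx: "continuous_on (cbox 0 1) (\<lambda>t. t ^ (m + 1) *\<^sub>R ?D (?y x t))" if "x \<in> ?B" for x
    by (intro continuous_intros continuous_on_compose2[OF cD]) (use ray_in_ball that in fastforce)
  have d: "((\<lambda>x. integral (cbox 0 1) (\<lambda>t. t ^ m * F (?y x t))) has_derivative
       blinfun_apply (integral (cbox 0 1) (\<lambda>t. t ^ (m + 1) *\<^sub>R ?D (?y x t)))) (at x)"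
    if x: "x \<in> ?B" for x
  proof -
    have "((\<lambda>x. integral (cbox 0 1) (\<lambda>t. t ^ m * F (?y x t))) has_derivative
       blinfun_apply (integral (cbox 0 1) (\<lambda>t. t ^ (m + 1) *\<^sub>R ?D (?y x t)))) (at x within ?B)"
    proof (rule leibniz_rule[OF _ _ cDy x convex_ball])
      fix z t assume z: "z \<in> ?B" and t: "t \<in> cbox 0 (1::real)"
      then have y: "?y z t \<in> ?B" by (intro ray_in_ball) (auto simp: cbox_interval)
      have l: "linear (frechet_derivative F (at (?y z t)))" using F(1)[OF y] has_derivative_linear by blast
      have "((\<lambda>x. ?y x t) has_derivative (\<lambda>v. t *\<^sub>R v)) (at z)"
        by (auto intro!: derivative_eq_intros)
      from has_derivative_compose[OF this F(1)[OF y]]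
      have "((\<lambda>x. t ^ m * F (?y x t)) has_derivative (\<lambda>v. t ^ m * frechet_derivative F (at (?y z t)) (t *\<^sub>R v))) (at z)"
        by (rule has_derivative_mult_right)
      moreover have "(\<lambda>v. t ^ m * frechet_derivative F (at (?y z t)) (t *\<^sub>R v)) = blinfun_apply (t ^ (m + 1) *\<^sub>R ?D (?y z t))"
        using app[OF y] by (auto simp: linear_cmul[OF l] blinfun.scaleR_left)
      ultimately show "((\<lambda>x. t ^ m * F (?y x t)) has_derivative blinfun_apply (t ^ (m + 1) *\<^sub>R ?D (?y z t))) (at z within ?B)"
        by (simp add: has_derivative_at_withinI)
    next
      fix z assume "z \<in> ?B"
      then show "(\<lambda>t. t ^ m * F (?y z t)) integrable_on cbox 0 1"
        by (intro integrable_continuous continuous_intros continuous_on_compose2[OF cF])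
          (use ray_in_ball in fastforce)
    qed
    then show ?thesis using x at_within_open[OF x open_ball] by simp
  qed
  have "Ck (Suc k) ?B (\<lambda>x. integral (cbox 0 1) (\<lambda>t. t ^ m * F (?y x t)))"
  proof (rule Ck_SucI[OF open_ball d])
    fix v
    show "Ck k ?B (\<lambda>x. blinfun_apply (integral (cbox 0 1) (\<lambda>t. t ^ (m + 1) *\<^sub>R ?D (?y x t))) v)"
    proof (rule Ck_cong[OF open_ball _ Suc.IH[OF F(2)[of v], of "m + 1"]])
      fix x assume x: "x \<in> ?B"
      have "blinfun_apply (integral (cbox 0 1) (\<lambda>t. t ^ (m + 1) *\<^sub>R ?D (?y x t))) v
         = integral (cbox 0 1) (\<lambda>t. blinfun_apply (t ^ (m + 1) *\<^sub>R ?D (?y x t)) v)"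
        by (rule blinfun_apply_integral[OF integrable_continuous[OF cDx[OF x]]])
      also have "\<dots> = integral (cbox 0 1) (\<lambda>t. t ^ (m + 1) * frechet_derivative F (at (?y x t)) v)"
        by (rule integral_cong) (use app ray_in_ball[OF x] in \<open>auto simp: blinfun.scaleR_left cbox_interval simp del: mem_ball\<close>)
      finally show "integral {0..1} (\<lambda>t. t ^ (m + 1) * frechet_derivative F (at (?y x t)) v) =
         blinfun_apply (integral (cbox 0 1) (\<lambda>t. t ^ (m + 1) *\<^sub>R ?D (?y x t))) v"
        by (simp add: cbox_interval)
    qed
  qed
  then show ?case by (simp only: cbox_interval)
qed

text \<open>
  The function \<open>g b\<close> is the mean of \<open>\<partial>\<^sub>b F\<close> over the segment from \<open>x0\<close> to \<open>x\<close>, and the expansion is the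
  fundamental theorem of calculus on that segment.  It reduces derivations at \<open>x0\<close> to first partial
  derivatives.
\<close>

lemma hadamard:
  fixes F :: "'a::euclidean_space \<Rightarrow> real"
  assumes F: "smooth_on (ball x0 r) F" and r: "r > 0"
  obtains g where "\<And>b. smooth_on (ball x0 r) (g b)" "\<And>b. g b x0 = frechet_derivative F (at x0) b"
    "\<And>x. x \<in> ball x0 r \<Longrightarrow> F x = F x0 + (\<Sum>b\<in>Basis. ((x - x0) \<bullet> b) * g b x)"
proof -
  let ?y = "\<lambda>x t. x0 + t *\<^sub>R (x - x0)"
  define g where "g b x = integral {0..1} (\<lambda>t. t ^ 0 * frechet_derivative F (at (?y x t)) b)" for b x
  have 1: "smooth_on (ball x0 r) (g b)" for b
    using smooth_on_frechet_derivative[OF F] Ck_ray_integral unfolding smooth_on_def g_def by blast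
  have 2: "g b x0 = frechet_derivative F (at x0) b" for b
    by (simp add: g_def)
  have 3: "F x = F x0 + (\<Sum>b\<in>Basis. ((x - x0) \<bullet> b) * g b x)" if x: "x \<in> ball x0 r" for x
  proof -
    have cont: "continuous_on (ball x0 r) (\<lambda>y. frechet_derivative F (at y) b)" for b
      using smooth_on_frechet_derivative[OF F] Ck_imp_continuous_on unfolding smooth_on_def by blast
    have int: "(\<lambda>t. frechet_derivative F (at (?y x t)) b) integrable_on {0..1}" for b
      by (intro integrable_continuous_interval continuous_on_compose2[OF cont] continuous_intros)
        (use ray_in_ball x in fastforce)
    have "((\<lambda>t. F (?y x t)) has_vector_derivative
       (\<Sum>b\<in>Basis. ((x - x0) \<bullet> b) * frechet_derivative F (at (?y x t)) b)) (at t within {0..1})"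
      if t: "t \<in> {0..1}" for t
    proof -
      have dF: "(F has_derivative frechet_derivative F (at (?y x t))) (at (?y x t))"
        by (rule smooth_on_has_derivative[OF F ray_in_ball[OF x t]])
      have l: "linear (frechet_derivative F (at (?y x t)))" using dF has_derivative_linear by blast
      have "frechet_derivative F (at (?y x t)) (\<Sum>b\<in>Basis. ((x - x0) \<bullet> b) *\<^sub>R b)
         = (\<Sum>b\<in>Basis. ((x - x0) \<bullet> b) * frechet_derivative F (at (?y x t)) b)"
        by (simp only: linear_sum[OF l] linear_cmul[OF l] real_scaleR_def)
      then have e: "frechet_derivative F (at (?y x t)) (x - x0)
         = (\<Sum>b\<in>Basis. ((x - x0) \<bullet> b) * frechet_derivative F (at (?y x t)) b)"
        by (simp only: euclidean_representation)
      have "((\<lambda>t. ?y x t) has_derivative (\<lambda>s. s *\<^sub>R (x - x0))) (at t within {0..1})"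
        by (auto intro!: derivative_eq_intros)
      from has_derivative_compose[OF this dF] show ?thesis
        unfolding has_vector_derivative_def linear_cmul[OF l] e by simp
    qed
    from fundamental_theorem_of_calculus[OF _ this]
    have "((\<lambda>t. \<Sum>b\<in>Basis. ((x - x0) \<bullet> b) * frechet_derivative F (at (?y x t)) b) has_integral F x - F x0) {0..1}"
      by force
    then have "F x - F x0 = integral {0..1} (\<lambda>t. \<Sum>b\<in>Basis. ((x - x0) \<bullet> b) * frechet_derivative F (at (?y x t)) b)"
      by (rule integral_unique[symmetric])
    also have "\<dots> = (\<Sum>b\<in>Basis. integral {0..1} (\<lambda>t. ((x - x0) \<bullet> b) * frechet_derivative F (at (?y x t)) b))"
      by (rule integral_sum[OF finite_Basis integrable_on_mult_right[OF int]])
    also have "\<dots> = (\<Sum>b\<in>Basis. ((x - x0) \<bullet> b) * g b x)"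
      by (simp add: g_def)
    finally show ?thesis by simp
  qed
  show ?thesis by (rule that[OF 1 2 3])
qed

section \<open>Smooth functions on a manifold\<close>

locale smooth_manifold =
  fixes A :: "('m::{t2_space,second_countable_topology}, 'e::euclidean_space) chart set"
  assumes atlas: "smooth_atlas A"
begin

lemma obtain_chart:
  obtains c where "c \<in> A" "p \<in> fst c"
  using atlas unfolding smooth_atlas_def by (metis UN_E UNIV_I)

lemma chart:
  assumes "c \<in> A"
  shows "open (fst c)" "open (chart_image c)"
    and chart_homeomorphism: "homeomorphism (fst c) (chart_image c) (snd c) (chart_inv c)"
  using assms atlas unfolding smooth_atlas_def by auto

lemma chart_inv_left [simp]: "c \<in> A \<Longrightarrow> q \<in> fst c \<Longrightarrow> chart_inv c (snd c q) = q"
  and chart_inv_right [simp]: "c \<in> A \<Longrightarrow> x \<in> chart_image c \<Longrightarrow> snd c (chart_inv c x) = x"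
  and chart_inv_in: "c \<in> A \<Longrightarrow> x \<in> chart_image c \<Longrightarrow> chart_inv c x \<in> fst c"
  and chart_in_image: "q \<in> fst c \<Longrightarrow> snd c q \<in> chart_image c"
  by (auto simp: homeomorphism_def chart_image_def dest!: chart_homeomorphism)

lemma chart_transition:
  "c \<in> A \<Longrightarrow> c' \<in> A \<Longrightarrow> smooth_on (snd c ` (fst c \<inter> fst c')) (snd c' \<circ> chart_inv c)"
  using atlas unfolding smooth_atlas_def by auto

lemma chart_continuous:
  assumes "c \<in> A"
  shows "continuous_on (fst c) (snd c)" "continuous_on (chart_image c) (chart_inv c)"
  using chart_homeomorphism[OF assms] unfolding homeomorphism_def by auto

lemma open_chart_map:
  assumes "c \<in> A" "open U"
  shows "open (snd c ` (fst c \<inter> U))"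
proof -
  have "snd c ` (fst c \<inter> U) = chart_image c \<inter> chart_inv c -` U"
    using assms(1) chart_inv_in by (auto simp: chart_image_def image_iff)
  then show ?thesis
    using continuous_open_preimage[OF chart_continuous(2)[OF assms(1)] chart(2)[OF assms(1)] assms(2)] by simp
qed

lemma open_chart_inv:
  assumes "c \<in> A" "open W" "W \<subseteq> chart_image c"
  shows "open (chart_inv c ` W)"
proof -
  have "chart_inv c ` W = fst c \<inter> snd c -` W"
  proof (intro equalityI subsetI)
    fix q assume "q \<in> chart_inv c ` W"
    then obtain x where "x \<in> W" "q = chart_inv c x" by blast
    then show "q \<in> fst c \<inter> snd c -` W" using assms(1,3) chart_inv_in[OF assms(1), of x] by auto
  next
    fix q assume "q \<in> fst c \<inter> snd c -` W"
    then show "q \<in> chart_inv c ` W"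
      using assms(1) by (intro image_eqI[of _ _ "snd c q"]) auto
  qed
  then show ?thesis
    using continuous_open_preimage[OF chart_continuous(1)[OF assms(1)] chart(1)[OF assms(1)] assms(2)] by simp
qed

lemma smooth_funD: "f \<in> smooth_fun A \<Longrightarrow> c \<in> A \<Longrightarrow> smooth_on (chart_image c) (\<lambda>x. f (chart_inv c x))"
  by (auto simp: smooth_fun_def comp_def)

lemma smooth_funI: "(\<And>c. c \<in> A \<Longrightarrow> smooth_on (chart_image c) (\<lambda>x. f (chart_inv c x))) \<Longrightarrow> f \<in> smooth_fun A"
  by (auto simp: smooth_fun_def comp_def)

text \<open>
  One chart around each point suffices, since the other charts differ from it by smooth transition
  maps.
\<close>

lemma smooth_fun_localI:
  assumes "\<And>p. \<exists>c\<in>A. p \<in> fst c \<and> (\<exists>W. open W \<and> W \<subseteq> chart_image c \<and> snd c p \<in> W \<and>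
     smooth_on W (\<lambda>x. f (chart_inv c x)))"
  shows "f \<in> smooth_fun A"
proof (rule smooth_funI, rule smooth_on_local)
  fix c' x assume c': "c' \<in> A" and x: "x \<in> chart_image c'"
  define q where "q = chart_inv c' x"
  have q: "q \<in> fst c'" "snd c' q = x" using c' x chart_inv_in by (auto simp: q_def)
  from assms[of q] obtain c W where c: "c \<in> A" "q \<in> fst c" and W: "open W" "W \<subseteq> chart_image c" "snd c q \<in> W"
    and sm: "smooth_on W (\<lambda>x. f (chart_inv c x))" by blast
  define U where "U = snd c' ` (fst c' \<inter> (fst c \<inter> chart_inv c ` W))"
  have oU: "open U" unfolding U_def
    by (intro open_chart_map c' open_Int chart(1) c open_chart_inv W)
  have xU: "x \<in> U" unfolding U_def using q c W(3)
    by (intro image_eqI[of _ _ q]) (auto intro!: image_eqI[of _ _ "snd c q"])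
  have *: "snd c (chart_inv c' y) \<in> W" "chart_inv c (snd c (chart_inv c' y)) = chart_inv c' y" if "y \<in> U" for y
    using that c' c W(2) by (auto simp: U_def subset_iff)
  have "smooth_on U (snd c \<circ> chart_inv c')"
    by (rule smooth_on_subset[OF chart_transition[OF c' c(1)]]) (auto simp: U_def)
  from smooth_on_compose[OF this sm oU W(1)]
  have "smooth_on U (\<lambda>y. f (chart_inv c ((snd c \<circ> chart_inv c') y)))"
    using *(1) by simp
  then have "smooth_on U (\<lambda>y. f (chart_inv c' y))"
    by (rule smooth_on_cong[OF _ oU]) (simp add: *(2))
  then show "\<exists>U. open U \<and> x \<in> U \<and> smooth_on U (\<lambda>y. f (chart_inv c' y))"
    using oU xU by blast
qed

lemma smooth_fun_const [intro, simp]: "(\<lambda>q. a) \<in> smooth_fun A"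
  by (rule smooth_funI) (simp add: smooth_on_const chart)

lemma smooth_fun_add [intro]:
  "f \<in> smooth_fun A \<Longrightarrow> g \<in> smooth_fun A \<Longrightarrow> (\<lambda>q. f q + g q) \<in> smooth_fun A"
  by (rule smooth_funI, rule smooth_on_add[OF chart(2)]) (assumption | erule smooth_funD)+

lemma smooth_fun_mult [intro]:
  "f \<in> smooth_fun A \<Longrightarrow> g \<in> smooth_fun A \<Longrightarrow> (\<lambda>q. f q * g q) \<in> smooth_fun A"
  by (rule smooth_funI, rule smooth_on_mult[OF chart(2)]) (assumption | erule smooth_funD)+

lemma smooth_fun_minus [intro]: "f \<in> smooth_fun A \<Longrightarrow> (\<lambda>q. - f q) \<in> smooth_fun A"
  using smooth_fun_mult[of "\<lambda>q. -1" f] by simp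

lemma smooth_fun_diff [intro]:
  "f \<in> smooth_fun A \<Longrightarrow> g \<in> smooth_fun A \<Longrightarrow> (\<lambda>q. f q - g q) \<in> smooth_fun A"
  using smooth_fun_add[of f "\<lambda>q. - g q"] by auto

lemma smooth_fun_sum [intro]:
  "(\<And>i. i \<in> I \<Longrightarrow> f i \<in> smooth_fun A) \<Longrightarrow> (\<lambda>q. \<Sum>i\<in>I. f i q) \<in> smooth_fun A"
  by (induction I rule: infinite_finite_induct) auto

lemma smooth_fun_glue:
  assumes "\<And>p. \<exists>V g. open V \<and> p \<in> V \<and> g \<in> smooth_fun A \<and> (\<forall>q\<in>V. f q = g q)"
  shows "f \<in> smooth_fun A"
proof (rule smooth_fun_localI)
  fix p
  obtain V g where V: "open V" "p \<in> V" and g: "g \<in> smooth_fun A" and eq: "\<And>q. q \<in> V \<Longrightarrow> f q = g q"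
    using assms[of p] by blast
  obtain c where c: "c \<in> A" "p \<in> fst c" by (rule obtain_chart)
  let ?W = "snd c ` (fst c \<inter> V)"
  have oW: "open ?W" by (rule open_chart_map[OF c(1) V(1)])
  have sub: "?W \<subseteq> chart_image c" by (auto simp: chart_image_def)
  have "smooth_on ?W (\<lambda>x. f (chart_inv c x))"
    by (rule smooth_on_cong[OF smooth_on_subset[OF smooth_funD[OF g c(1)] sub] oW]) (use c in \<open>auto simp: eq\<close>)
  then show "\<exists>c\<in>A. p \<in> fst c \<and> (\<exists>W. open W \<and> W \<subseteq> chart_image c \<and> snd c p \<in> W \<and>
      smooth_on W (\<lambda>x. f (chart_inv c x)))"
    using c oW sub V by blast
qed

lemma smooth_fun_continuous:
  assumes "f \<in> smooth_fun A"
  shows "continuous_on UNIV f"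
proof (rule continuous_at_imp_continuous_on, rule ballI)
  fix p :: 'm
  obtain c where c: "c \<in> A" "p \<in> fst c" by (rule obtain_chart)
  have "continuous_on (chart_image c) (\<lambda>x. f (chart_inv c x))"
    using smooth_funD[OF assms c(1)] Ck_imp_continuous_on unfolding smooth_on_def by blast
  then have "continuous_on (fst c) (\<lambda>q. f (chart_inv c (snd c q)))"
    by (rule continuous_on_compose2[OF _ chart_continuous(1)[OF c(1)]]) (auto simp: chart_image_def)
  then have "continuous_on (fst c) f"
    by (rule continuous_on_eq) (use c in auto)
  then show "isCont f p" using c chart(1) continuous_on_eq_continuous_at by blast
qed

text \<open>
  The same cutoff function turns every smooth function of the coordinates on \<open>W\<close> into a global smooth
  function.  The extension by 0 is smooth because the cutoff vanishes off the image of a closed ball,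
  which is compact and hence closed in the Hausdorff space \<open>M\<close>.
\<close>

lemma chart_cutoff:
  assumes c: "c \<in> A" "p \<in> fst c" and W: "open W" "W \<subseteq> chart_image c" "snd c p \<in> W"
  obtains \<rho> V where "open V" "p \<in> V" "V \<subseteq> chart_inv c ` W" "\<And>q. q \<in> V \<Longrightarrow> \<rho> q = 1"
    "\<And>q. q \<notin> chart_inv c ` W \<Longrightarrow> \<rho> q = 0"
    "\<And>F. smooth_on W F \<Longrightarrow> (\<lambda>q. \<rho> q * F (snd c q)) \<in> smooth_fun A"
proof -
  let ?x0 = "snd c p"
  obtain R where R: "R > 0" "cball ?x0 R \<subseteq> W"
    using W open_contains_cball by blast
  obtain s :: "real \<Rightarrow> real" where s: "smooth_on UNIV s" "\<And>t. t \<le> 0 \<Longrightarrow> s t = 0" "\<And>t. t \<ge> 1 \<Longrightarrow> s t = 1"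
    using smooth_step by metis
  \<comment> \<open>As a function of the distance from \<open>?x0\<close>, \<open>k\<close> is at least 1 up to \<open>R / 2\<close> and at most 0 from \<open>R\<close> on.\<close>
  define k where "k x = 2 + (- 2 / R\<^sup>2) * ((x + - ?x0) \<bullet> (x + - ?x0))" for x
  define \<psi> where "\<psi> x = s (k x)" for x
  define \<rho> where "\<rho> q = (if q \<in> fst c then \<psi> (snd c q) else 0)" for q
  define V where "V = chart_inv c ` ball ?x0 (R / 2)"
  define K where "K = chart_inv c ` cball ?x0 R"
  have kx: "k x = 2 - 2 * (dist ?x0 x)\<^sup>2 / R\<^sup>2" for x
    by (simp add: k_def dist_norm norm_minus_commute[of ?x0] power2_norm_eq_inner)
  have "smooth_on UNIV (\<lambda>x. x + - ?x0)"
    by (rule smooth_on_add[OF _ smooth_on_linear[OF _ bounded_linear_ident] smooth_on_const]) auto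
  then have "smooth_on UNIV (\<lambda>x. (x + - ?x0) \<bullet> (x + - ?x0))"
    by (intro smooth_on_bilinear[OF bounded_bilinear_inner]) auto
  then have "smooth_on UNIV k" unfolding k_def
    by (intro smooth_on_add[OF _ smooth_on_const smooth_on_mult[OF _ smooth_on_const]]) auto
  then have s\<psi>: "smooth_on UNIV \<psi>" unfolding \<psi>_def
    by (rule smooth_on_compose[OF _ s(1)]) auto
  have \<psi>0: "\<psi> x = 0" if "x \<notin> ball ?x0 R" for x
  proof -
    have "R\<^sup>2 \<le> (dist ?x0 x)\<^sup>2" using that R by (intro power_mono) auto
    then have "k x \<le> 0" using R by (simp add: kx field_simps)
    then show ?thesis by (simp add: \<psi>_def s)
  qed
  have \<psi>1: "\<psi> x = 1" if "x \<in> ball ?x0 (R / 2)" for x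
  proof -
    have "(dist ?x0 x)\<^sup>2 \<le> (R / 2)\<^sup>2" using that R by (intro power_mono) auto
    then have "(dist ?x0 x)\<^sup>2 \<le> R\<^sup>2 / 4" by (simp add: power_divide)
    with zero_le_power2[of "dist ?x0 x"] have "2 * (dist ?x0 x)\<^sup>2 \<le> R\<^sup>2" by linarith
    then have "k x \<ge> 1" using R by (simp add: kx field_simps)
    then show ?thesis by (simp add: \<psi>_def s)
  qed
  have sub: "cball ?x0 R \<subseteq> chart_image c" using R(2) W(2) by blast
  have sub2: "ball ?x0 (R / 2) \<subseteq> cball ?x0 R" using R(1) by auto
  have "compact K" unfolding K_def
    by (rule compact_continuous_image[OF continuous_on_subset[OF chart_continuous(2)[OF c(1)] sub] compact_cball])
  then have cK: "closed K" by (rule compact_imp_closed)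
  have 1: "open V" unfolding V_def by (rule open_chart_inv[OF c(1)]) (use sub sub2 in auto)
  have 2: "p \<in> V" unfolding V_def using c R by (intro image_eqI[of _ _ ?x0]) auto
  have 3: "V \<subseteq> chart_inv c ` W" unfolding V_def using sub2 R(2) by (intro image_mono) blast
  have 4: "\<rho> q = 1" if "q \<in> V" for q
  proof -
    from that obtain x where x: "x \<in> ball ?x0 (R / 2)" "q = chart_inv c x" by (auto simp: V_def)
    then have "x \<in> chart_image c" using sub sub2 by blast
    then show ?thesis using x \<psi>1[OF x(1)] c chart_inv_in[OF c(1)] by (simp add: \<rho>_def)
  qed
  have 5: "\<rho> q = 0" if "q \<notin> K" for q
  proof (cases "q \<in> fst c")
    case True
    then have "snd c q \<notin> cball ?x0 R"
      using that c(1) by (metis K_def chart_inv_left image_eqI)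
    then show ?thesis using \<psi>0 by (simp add: \<rho>_def)
  qed (simp add: \<rho>_def)
  have 6: "(\<lambda>q. \<rho> q * F (snd c q)) \<in> smooth_fun A" if F: "smooth_on W F" for F
  proof (rule smooth_fun_localI)
    fix p'
    show "\<exists>c'\<in>A. p' \<in> fst c' \<and> (\<exists>W. open W \<and> W \<subseteq> chart_image c' \<and> snd c' p' \<in> W \<and>
      smooth_on W (\<lambda>x. \<rho> (chart_inv c' x) * F (snd c (chart_inv c' x))))"
    proof (cases "p' \<in> chart_inv c ` W")
      case True
      then have p': "p' \<in> fst c" "snd c p' \<in> W" using W(2) c(1) chart_inv_in[OF c(1)] by auto
      have "smooth_on W (\<lambda>x. \<psi> x * F x)"
        by (rule smooth_on_mult[OF W(1) smooth_on_subset[OF s\<psi>] F]) auto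
      then have "smooth_on W (\<lambda>x. \<rho> (chart_inv c x) * F (snd c (chart_inv c x)))"
        by (rule smooth_on_cong[OF _ W(1)]) (use W(2) c(1) chart_inv_in[OF c(1)] in \<open>auto simp: \<rho>_def subset_iff\<close>)
      then show ?thesis using p' c W by blast
    next
      case False
      then have p': "p' \<notin> K" using R(2) by (auto simp: K_def)
      obtain c' where c': "c' \<in> A" "p' \<in> fst c'" by (rule obtain_chart)
      let ?W = "snd c' ` (fst c' \<inter> - K)"
      have oW: "open ?W" by (rule open_chart_map[OF c'(1)]) (use cK in auto)
      have "smooth_on ?W (\<lambda>x. \<rho> (chart_inv c' x) * F (snd c (chart_inv c' x)))"
        by (rule smooth_on_cong[OF smooth_on_const[OF oW, of 0] oW]) (use c' 5 in auto)
      moreover have "?W \<subseteq> chart_image c'" by (auto simp: chart_image_def)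
      moreover have "snd c' p' \<in> ?W" using c'(2) p' by simp
      ultimately show ?thesis by (intro bexI[OF _ c'(1)] conjI exI[of _ ?W] c'(2) oW)
    qed
  qed
  have 7: "\<rho> q = 0" if "q \<notin> chart_inv c ` W" for q
    using that 5[of q] R(2) by (auto simp: K_def)
  show ?thesis by (rule that[OF 1 2 3 4 7 6])
qed

lemma bump_function:
  assumes "open U" "p \<in> U"
  obtains \<rho> V where "\<rho> \<in> smooth_fun A" "open V" "p \<in> V" "V \<subseteq> U" "\<And>q. q \<in> V \<Longrightarrow> \<rho> q = 1"
    "\<And>q. q \<notin> U \<Longrightarrow> \<rho> q = 0"
proof -
  obtain c where c: "c \<in> A" "p \<in> fst c" by (rule obtain_chart)
  let ?W = "snd c ` (fst c \<inter> U)"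
  have W: "open ?W" "?W \<subseteq> chart_image c" "snd c p \<in> ?W"
    using open_chart_map[OF c(1) assms(1)] c assms(2) by (auto simp: chart_image_def)
  have sub: "chart_inv c ` ?W \<subseteq> U" using c by auto
  obtain \<rho> V where V: "open V" "p \<in> V" "V \<subseteq> chart_inv c ` ?W" and 1: "\<And>q. q \<in> V \<Longrightarrow> \<rho> q = 1"
    and 0: "\<And>q. q \<notin> chart_inv c ` ?W \<Longrightarrow> \<rho> q = 0"
    and sm: "\<And>F. smooth_on ?W F \<Longrightarrow> (\<lambda>q. \<rho> q * F (snd c q)) \<in> smooth_fun A"
    by (rule chart_cutoff[OF c W]) blast
  have "\<rho> \<in> smooth_fun A" using sm[OF smooth_on_const[OF W(1), of 1]] by simp
  moreover have "\<rho> q = 0" if "q \<notin> U" for q using 0 sub that by auto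
  ultimately show ?thesis using that[of \<rho> V] V(1,2) order_trans[OF V(3) sub] 1 by simp
qed

text \<open>
  A power of \<open>f\<close> is smooth only where \<open>f\<close> is positive, so it is represented by a global function that
  agrees with it near \<open>p\<close>.  The exponent \<open>-1/2\<close> serves to normalise vector fields.
\<close>

lemma smooth_fun_powr:
  assumes f: "f \<in> smooth_fun A" and "f p > 0"
  obtains s V where "s \<in> smooth_fun A" "open V" "p \<in> V" "\<And>q. q \<in> V \<Longrightarrow> f q > 0 \<and> s q = f q powr a"
proof -
  obtain c where c: "c \<in> A" "p \<in> fst c" by (rule obtain_chart)
  have "open {q. f q > 0}"
    using open_Collect_less[OF continuous_on_const smooth_fun_continuous[OF f]] by simp
  then have oW: "open (snd c ` (fst c \<inter> {q. f q > 0}))" by (rule open_chart_map[OF c(1)])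
  let ?W = "snd c ` (fst c \<inter> {q. f q > 0})"
  have W: "?W \<subseteq> chart_image c" "snd c p \<in> ?W"
    using c assms(2) by (auto simp: chart_image_def)
  have sm: "smooth_on ?W (\<lambda>x. (f (chart_inv c x)) powr a)"
    by (rule smooth_on_compose[OF smooth_on_subset[OF smooth_funD[OF f c(1)] W(1)] smooth_on_powr oW])
      (use c in auto)
  obtain \<rho> V where V: "open V" "p \<in> V" "V \<subseteq> chart_inv c ` ?W" "\<And>q. q \<in> V \<Longrightarrow> \<rho> q = 1"
    and \<rho>: "\<And>F. smooth_on ?W F \<Longrightarrow> (\<lambda>q. \<rho> q * F (snd c q)) \<in> smooth_fun A"
    by (rule chart_cutoff[OF c oW W]) blast
  have "f q > 0 \<and> \<rho> q * f (chart_inv c (snd c q)) powr a = f q powr a" if "q \<in> V" for q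
    using V(3,4) that c by force
  then show ?thesis by (rule that[OF \<rho>[OF sm] V(1,2)])
qed

section \<open>Tangent vectors and vector fields\<close>

abbreviation "Fun \<equiv> smooth_fun A"
abbreviation "Tan \<equiv> tangent_space A"
abbreviation "Cot \<equiv> cotangent_space A"
abbreviation "Fields \<equiv> vector_fields A"
abbreviation "Forms \<equiv> one_forms A"

lemma tanI:
  assumes "\<And>f. f \<notin> Fun \<Longrightarrow> v f = 0"
    and "\<And>f g a b. f \<in> Fun \<Longrightarrow> g \<in> Fun \<Longrightarrow> v (\<lambda>q. a * f q + b * g q) = a * v f + b * v g"
    and "\<And>f g. f \<in> Fun \<Longrightarrow> g \<in> Fun \<Longrightarrow> v (\<lambda>q. f q * g q) = f p * v g + g p * v f"
  shows "v \<in> Tan p"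
  using assms by (simp add: tangent_space_def)

lemma tan_outside: "v \<in> Tan p \<Longrightarrow> f \<notin> Fun \<Longrightarrow> v f = 0"
  and tan_lin: "v \<in> Tan p \<Longrightarrow> f \<in> Fun \<Longrightarrow> g \<in> Fun \<Longrightarrow> v (\<lambda>q. a * f q + b * g q) = a * v f + b * v g"
  and tan_mult: "v \<in> Tan p \<Longrightarrow> f \<in> Fun \<Longrightarrow> g \<in> Fun \<Longrightarrow> v (\<lambda>q. f q * g q) = f p * v g + g p * v f"
  by (simp_all add: tangent_space_def)

lemma tan_add: "v \<in> Tan p \<Longrightarrow> f \<in> Fun \<Longrightarrow> g \<in> Fun \<Longrightarrow> v (\<lambda>q. f q + g q) = v f + v g"
  using tan_lin[of v p f g 1 1] by simp

lemma tan_minus: "v \<in> Tan p \<Longrightarrow> f \<in> Fun \<Longrightarrow> v (\<lambda>q. - f q) = - v f"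
  using tan_lin[of v p f f "-1" 0] by simp

lemma tan_diff: "v \<in> Tan p \<Longrightarrow> f \<in> Fun \<Longrightarrow> g \<in> Fun \<Longrightarrow> v (\<lambda>q. f q - g q) = v f - v g"
  using tan_lin[of v p f g 1 "-1"] by simp

lemma tan_const: "v \<in> Tan p \<Longrightarrow> v (\<lambda>q. a) = 0"
proof -
  assume v: "v \<in> Tan p"
  have "v (\<lambda>q. 1) = 0" using tan_mult[OF v smooth_fun_const smooth_fun_const, of 1 1] by simp
  then show ?thesis using tan_lin[OF v smooth_fun_const smooth_fun_const, of a 1 0 1] by simp
qed

lemma tan_sum:
  assumes "v \<in> Tan p" "\<And>i. i \<in> I \<Longrightarrow> f i \<in> Fun"
  shows "v (\<lambda>q. \<Sum>i\<in>I. f i q) = (\<Sum>i\<in>I. v (f i))"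
  using assms(2)
proof (induction I rule: infinite_finite_induct)
  case (insert i I)
  then show ?case using tan_add[OF assms(1), of "f i" "\<lambda>q. \<Sum>i\<in>I. f i q"] by (simp add: smooth_fun_sum)
qed (simp_all add: tan_const[OF assms(1)])

text \<open>
  Multiplied by a bump function at \<open>p\<close> with support in \<open>V\<close>, the difference of \<open>f\<close> and \<open>g\<close> is zero; the
  Leibniz rule turns this into the claim.
\<close>

lemma tan_local:
  assumes v: "v \<in> Tan p" and V: "open V" "p \<in> V" and f: "f \<in> Fun" "g \<in> Fun"
    and eq: "\<And>q. q \<in> V \<Longrightarrow> f q = g q"
  shows "v f = v g"
proof -
  obtain \<rho> W where \<rho>: "\<rho> \<in> Fun" "p \<in> W" "\<And>q. q \<in> W \<Longrightarrow> \<rho> q = 1" "\<And>q. q \<notin> V \<Longrightarrow> \<rho> q = 0"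
    by (rule bump_function[OF V]) blast
  have d: "(\<lambda>q. f q - g q) \<in> Fun" using f by (rule smooth_fun_diff)
  have "(\<lambda>q. \<rho> q * (f q - g q)) = (\<lambda>q. 0)"
    using \<rho>(4) eq by (intro ext) (metis eq_iff_diff_eq_0 mult_eq_0_iff)
  then have "0 = \<rho> p * v (\<lambda>q. f q - g q) + (f p - g p) * v \<rho>"
    using tan_mult[OF v \<rho>(1) d] tan_const[OF v, of 0] by simp
  then show ?thesis using \<rho>(2,3) eq V(2) tan_diff[OF v f] by simp
qed

lemma tan_combo:
  assumes "\<And>i. i \<in> I \<Longrightarrow> v i \<in> Tan p"
  shows "(\<lambda>f. \<Sum>i\<in>I. a i * v i f) \<in> Tan p"
proof (rule tanI)
  fix f g s t assume fg: "f \<in> Fun" "g \<in> Fun"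
  have "(\<Sum>i\<in>I. a i * v i (\<lambda>q. s * f q + t * g q)) = (\<Sum>i\<in>I. s * (a i * v i f) + t * (a i * v i g))"
    by (intro sum.cong refl) (simp add: tan_lin[OF assms fg] algebra_simps)
  then show "(\<Sum>i\<in>I. a i * v i (\<lambda>q. s * f q + t * g q)) = s * (\<Sum>i\<in>I. a i * v i f) + t * (\<Sum>i\<in>I. a i * v i g)"
    by (simp add: sum.distrib sum_distrib_left)
  have "(\<Sum>i\<in>I. a i * v i (\<lambda>q. f q * g q)) = (\<Sum>i\<in>I. f p * (a i * v i g) + g p * (a i * v i f))"
    by (intro sum.cong refl) (simp add: tan_mult[OF assms fg] algebra_simps)
  then show "(\<Sum>i\<in>I. a i * v i (\<lambda>q. f q * g q)) = f p * (\<Sum>i\<in>I. a i * v i g) + g p * (\<Sum>i\<in>I. a i * v i f)"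
    by (simp add: sum.distrib sum_distrib_left)
qed (simp add: tan_outside[OF assms])

lemma tan_lincomb: "v \<in> Tan p \<Longrightarrow> w \<in> Tan p \<Longrightarrow> (\<lambda>f. a * v f + b * w f) \<in> Tan p"
  using tan_combo[of "{True, False}" "\<lambda>i. if i then v else w" p "\<lambda>i. if i then a else b"] by simp

lemma fieldsI:
  "(\<And>p. X p \<in> Tan p) \<Longrightarrow> (\<And>f. f \<in> Fun \<Longrightarrow> (\<lambda>p. X p f) \<in> Fun) \<Longrightarrow> X \<in> Fields"
  by (simp add: vector_fields_def)

lemma fields_tan: "X \<in> Fields \<Longrightarrow> X p \<in> Tan p"
  and fields_smooth: "X \<in> Fields \<Longrightarrow> f \<in> Fun \<Longrightarrow> (\<lambda>p. X p f) \<in> Fun"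
  by (simp_all add: vector_fields_def)

lemma fields_combo:
  assumes "\<And>i. i \<in> I \<Longrightarrow> X i \<in> Fields" "\<And>i. i \<in> I \<Longrightarrow> a i \<in> Fun"
  shows "(\<lambda>q f. \<Sum>i\<in>I. a i q * X i q f) \<in> Fields"
  by (rule fieldsI, rule tan_combo[OF fields_tan[OF assms(1)]], assumption,
      rule smooth_fun_sum, rule smooth_fun_mult[OF assms(2) fields_smooth[OF assms(1)]])

lemma chart_function_has_derivative:
  assumes "c \<in> A" "q \<in> fst c" "f \<in> Fun"
  shows "((\<lambda>x. f (chart_inv c x)) has_derivative frechet_derivative (f \<circ> chart_inv c) (at (snd c q))) (at (snd c q))"
  using smooth_on_has_derivative[OF smooth_funD[OF assms(3,1)] chart_in_image[OF assms(2)]]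
  by (simp add: comp_def)

lemma coord_vec_tan:
  assumes "c \<in> A" "q \<in> fst c"
  shows "coord_vec A c b q \<in> Tan q"
proof (rule tanI)
  fix f g s t assume f: "f \<in> Fun" and g: "g \<in> Fun"
  note d = chart_function_has_derivative[OF assms f] chart_function_has_derivative[OF assms g]
  have sm: "(\<lambda>q. s * f q + t * g q) \<in> Fun" "(\<lambda>q. f q * g q) \<in> Fun"
    using f g by (auto intro!: smooth_fun_add smooth_fun_mult)
  have "((\<lambda>x. s * f (chart_inv c x) + t * g (chart_inv c x)) has_derivative
      (\<lambda>h. s * frechet_derivative (f \<circ> chart_inv c) (at (snd c q)) h
         + t * frechet_derivative (g \<circ> chart_inv c) (at (snd c q)) h)) (at (snd c q))"
    by (intro has_derivative_add has_derivative_mult_right d)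
  from has_derivative_unique[OF chart_function_has_derivative[OF assms sm(1)] this]
  show "coord_vec A c b q (\<lambda>q. s * f q + t * g q) = s * coord_vec A c b q f + t * coord_vec A c b q g"
    using f g sm by (simp add: coord_vec_def)
  from has_derivative_unique[OF chart_function_has_derivative[OF assms sm(2)] has_derivative_mult[OF d]]
  show "coord_vec A c b q (\<lambda>q. f q * g q) = f q * coord_vec A c b q g + g q * coord_vec A c b q f"
    using f g sm assms by (simp add: coord_vec_def)
qed (simp add: coord_vec_def)

text \<open>
  The functions \<open>x b\<close> and the fields \<open>E b\<close> are the coordinates and the coordinate vector fields of a
  chart at \<open>p\<close>, cut off so that they are global.  That the latter span the derivations at \<open>q\<close> is
  Hadamard's lemma: near \<open>q\<close> one has \<open>f = f(q) + \<Sum>\<^sub>b (x\<^sub>b - x\<^sub>b(q)) G\<^sub>b\<close> with \<open>G\<^sub>b(q) = \<partial>\<^sub>b f(q)\<close>, and the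
  Leibniz rule at \<open>q\<close> leaves only the terms \<open>v(x\<^sub>b) G\<^sub>b(q)\<close>.  Everything below uses charts only through
  this lemma.
\<close>

lemma coordinate_frame:
  obtains V and x :: "'e \<Rightarrow> 'm \<Rightarrow> real" and E where "open V" "p \<in> V" "\<And>b. x b \<in> Fun" "\<And>b. E b \<in> Fields"
    "\<And>q v. q \<in> V \<Longrightarrow> v \<in> Tan q \<Longrightarrow> v = (\<lambda>f. \<Sum>b\<in>Basis. v (x b) * E b q f)"
    "\<And>q b b'. q \<in> V \<Longrightarrow> b \<in> Basis \<Longrightarrow> b' \<in> Basis \<Longrightarrow> E b q (x b') = (if b = b' then 1 else 0)"
proof -
  obtain c where c: "c \<in> A" "p \<in> fst c" by (rule obtain_chart)
  have img: "chart_inv c ` chart_image c = fst c"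
    using chart_homeomorphism[OF c(1)] by (simp add: homeomorphism_def)
  obtain \<rho> V where V: "open V" "p \<in> V" "V \<subseteq> fst c" and \<rho>1: "\<And>q. q \<in> V \<Longrightarrow> \<rho> q = 1"
    and \<rho>0: "\<And>q. q \<notin> fst c \<Longrightarrow> \<rho> q = 0"
    and \<rho>: "\<And>F. smooth_on (chart_image c) F \<Longrightarrow> (\<lambda>q. \<rho> q * F (snd c q)) \<in> Fun"
    by (rule chart_cutoff[OF c chart(2)[OF c(1)] order_refl chart_in_image[OF c(2)]]) (auto simp: img)
  define x where "x b = (\<lambda>q. \<rho> q * (snd c q \<bullet> b))" for b
  define E where "E b = (\<lambda>q f. \<rho> q * coord_vec A c b q f)" for b
  have x: "x b \<in> Fun" for b
    unfolding x_def by (rule \<rho>) (rule smooth_on_linear[OF chart(2)[OF c(1)] bounded_linear_inner_left])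
  have oW: "open (snd c ` (fst c \<inter> V))" by (rule open_chart_map[OF c(1) V(1)])
  have E: "E b \<in> Fields" for b
  proof (rule fieldsI)
    fix q show "E b q \<in> Tan q"
    proof (cases "q \<in> fst c")
      case True
      then show ?thesis using tan_combo[of "{b}" "\<lambda>b. coord_vec A c b q" q "\<lambda>b. \<rho> q"] coord_vec_tan[OF c(1)]
        by (simp add: E_def)
    qed (simp add: E_def \<rho>0 tangent_space_def)
  next
    fix f assume f: "f \<in> Fun"
    show "(\<lambda>q. E b q f) \<in> Fun"
      using \<rho>[OF smooth_on_frechet_derivative[OF smooth_funD[OF f c(1)]], of b] f
      by (simp add: E_def coord_vec_def comp_def)
  qed
  have Ef: "E b q f = frechet_derivative (\<lambda>x. f (chart_inv c x)) (at (snd c q)) b" if "q \<in> V" "f \<in> Fun" for b q f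
    using that by (simp add: E_def \<rho>1 coord_vec_def comp_def)
  have Ex: "E b q (x b') = (if b = b' then 1 else 0)" if q: "q \<in> V" and b: "b \<in> Basis" "b' \<in> Basis" for q b b'
  proof -
    have "((\<lambda>y. x b' (chart_inv c y)) has_derivative (\<lambda>y. y \<bullet> b')) (at (snd c q))"
    proof (rule has_derivative_transform_within_open[OF _ oW])
      show "((\<lambda>y. y \<bullet> b') has_derivative (\<lambda>y. y \<bullet> b')) (at (snd c q))"
        by (rule bounded_linear_imp_has_derivative[OF bounded_linear_inner_left])
    qed (use q V c \<rho>1 in \<open>auto simp: x_def\<close>)
    from frechet_derivative_at[OF this] show ?thesis
      using Ef[OF q x] b by (metis inner_Basis)
  qed
  have vf: "v f = (\<Sum>b\<in>Basis. v (x b) * E b q f)" if q: "q \<in> V" and v: "v \<in> Tan q" and f: "f \<in> Fun" for q v f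
  proof -
    let ?y = "snd c q"
    have qc: "q \<in> fst c" using q V by blast
    have "?y \<in> snd c ` (fst c \<inter> V)" using q qc by blast
    then obtain r where r: "r > 0" "ball ?y r \<subseteq> snd c ` (fst c \<inter> V)"
      using oW open_contains_ball by blast
    have sub: "ball ?y r \<subseteq> chart_image c" using r(2) by (auto simp: chart_image_def)
    obtain g where g: "\<And>b. smooth_on (ball ?y r) (g b)"
      and g0: "\<And>b. g b ?y = frechet_derivative (\<lambda>x. f (chart_inv c x)) (at ?y) b"
      and gf: "\<And>z. z \<in> ball ?y r \<Longrightarrow> f (chart_inv c z) = f (chart_inv c ?y) + (\<Sum>b\<in>Basis. ((z - ?y) \<bullet> b) * g b z)"
      by (rule hadamard[OF smooth_on_subset[OF smooth_funD[OF f c(1)] sub] r(1)]) blast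
    obtain \<sigma> U where U: "open U" "q \<in> U" "U \<subseteq> chart_inv c ` ball ?y r" and \<sigma>1: "\<And>q. q \<in> U \<Longrightarrow> \<sigma> q = 1"
      and \<sigma>: "\<And>F. smooth_on (ball ?y r) F \<Longrightarrow> (\<lambda>q. \<sigma> q * F (snd c q)) \<in> Fun"
      by (rule chart_cutoff[OF c(1) qc open_ball sub]) (use r in auto)
    define G where "G b = (\<lambda>q. \<sigma> q * g b (snd c q))" for b
    have G: "G b \<in> Fun" for b unfolding G_def by (rule \<sigma>[OF g])
    have xd: "(\<lambda>q'. x b q' - ?y \<bullet> b) \<in> Fun" for b by (rule smooth_fun_diff[OF x smooth_fun_const])
    have xG: "(\<lambda>q'. (x b q' - ?y \<bullet> b) * G b q') \<in> Fun" for b by (rule smooth_fun_mult[OF xd G])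
    have "v f = v (\<lambda>q'. f q + (\<Sum>b\<in>Basis. (x b q' - ?y \<bullet> b) * G b q'))"
    proof (rule tan_local[OF v U(1,2) f smooth_fun_add[OF smooth_fun_const smooth_fun_sum[OF xG]]])
      fix q' assume q': "q' \<in> U"
      then obtain z where z: "z \<in> ball ?y r" "q' = chart_inv c z" using U(3) by blast
      then have zi: "z \<in> chart_image c" using sub by blast
      have "q' \<in> V" using z(1) r(2) c(1) unfolding z(2) by force
      then have "x b q' = z \<bullet> b" for b using z(2) zi c(1) by (simp add: x_def \<rho>1)
      then show "f q' = f q + (\<Sum>b\<in>Basis. (x b q' - ?y \<bullet> b) * G b q')"
        using gf[OF z(1)] z(2) zi c(1) qc \<sigma>1[OF q'] by (simp add: G_def inner_diff_left)
    qed
    also have "\<dots> = (\<Sum>b\<in>Basis. v (\<lambda>q'. (x b q' - ?y \<bullet> b) * G b q'))"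
      by (simp add: tan_add[OF v smooth_fun_const smooth_fun_sum[OF xG]] tan_const[OF v] tan_sum[OF v xG])
    also have "\<dots> = (\<Sum>b\<in>Basis. v (x b) * E b q f)"
    proof (rule sum.cong[OF refl])
      fix b :: 'e
      have "v (\<lambda>q'. (x b q' - ?y \<bullet> b) * G b q') = (x b q - ?y \<bullet> b) * v (G b) + G b q * v (x b)"
        by (simp add: tan_mult[OF v xd G] tan_diff[OF v x smooth_fun_const] tan_const[OF v])
      also have "\<dots> = v (x b) * E b q f"
        using \<rho>1[OF q] \<sigma>1[OF U(2)] g0 Ef[OF q f] by (simp add: x_def G_def)
      finally show "v (\<lambda>q'. (x b q' - ?y \<bullet> b) * G b q') = v (x b) * E b q f" .
    qed
    finally show ?thesis .
  qed
  have "v = (\<lambda>f. \<Sum>b\<in>Basis. v (x b) * E b q f)" if "q \<in> V" "v \<in> Tan q" for q v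
  proof
    fix f show "v f = (\<Sum>b\<in>Basis. v (x b) * E b q f)"
      using vf[OF that] tan_outside[OF that(2), of f] tan_outside[OF fields_tan[OF E], of f]
      by (cases "f \<in> Fun") auto
  qed
  then show ?thesis by (rule that[OF V(1,2) x E _ Ex])
qed

section \<open>Covectors and 1-forms\<close>

lemma cot_lin: "\<alpha> \<in> Cot p \<Longrightarrow> v \<in> Tan p \<Longrightarrow> w \<in> Tan p \<Longrightarrow> \<alpha> (\<lambda>f. a * v f + b * w f) = a * \<alpha> v + b * \<alpha> w"
  and cot_outside: "\<alpha> \<in> Cot p \<Longrightarrow> v \<notin> Tan p \<Longrightarrow> \<alpha> v = 0"
  by (simp_all add: cotangent_space_def)

lemma cotI:
  "(\<And>v. v \<notin> Tan p \<Longrightarrow> \<alpha> v = 0) \<Longrightarrow>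
   (\<And>v w a b. v \<in> Tan p \<Longrightarrow> w \<in> Tan p \<Longrightarrow> \<alpha> (\<lambda>f. a * v f + b * w f) = a * \<alpha> v + b * \<alpha> w) \<Longrightarrow> \<alpha> \<in> Cot p"
  by (simp add: cotangent_space_def)

lemma tan_zero: "(\<lambda>f. 0) \<in> Tan p"
  using tan_combo[of "{}"] by simp

lemma cot_sum:
  assumes "\<alpha> \<in> Cot p" "\<And>i. i \<in> I \<Longrightarrow> v i \<in> Tan p"
  shows "\<alpha> (\<lambda>f. \<Sum>i\<in>I. a i * v i f) = (\<Sum>i\<in>I. a i * \<alpha> (v i))"
proof -
  have 0: "\<alpha> (\<lambda>f. 0) = 0" using cot_lin[OF assms(1) tan_zero tan_zero, of 0 0] by simp
  show ?thesis using assms(2)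
  proof (induction I rule: infinite_finite_induct)
    case (insert i I)
    have "(\<lambda>f. \<Sum>i\<in>I. a i * v i f) \<in> Tan p" by (rule tan_combo) (use insert in auto)
    then show ?case using insert cot_lin[OF assms(1), of "v i" "\<lambda>f. \<Sum>i\<in>I. a i * v i f" "a i" 1] by simp
  qed (simp_all add: 0)
qed

lemma cot_combo:
  assumes "\<And>i. i \<in> I \<Longrightarrow> \<alpha> i \<in> Cot p"
  shows "(\<lambda>v. \<Sum>i\<in>I. a i * \<alpha> i v) \<in> Cot p"
proof (rule cotI)
  fix v w s t assume vw: "v \<in> Tan p" "w \<in> Tan p"
  have "(\<Sum>i\<in>I. a i * \<alpha> i (\<lambda>f. s * v f + t * w f)) = (\<Sum>i\<in>I. s * (a i * \<alpha> i v) + t * (a i * \<alpha> i w))"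
    by (intro sum.cong refl) (simp add: cot_lin[OF assms vw] algebra_simps)
  then show "(\<Sum>i\<in>I. a i * \<alpha> i (\<lambda>f. s * v f + t * w f)) = s * (\<Sum>i\<in>I. a i * \<alpha> i v) + t * (\<Sum>i\<in>I. a i * \<alpha> i w)"
    by (simp add: sum.distrib sum_distrib_left)
qed (simp add: cot_outside[OF assms])

lemma cot_lincomb: "\<alpha> \<in> Cot p \<Longrightarrow> \<beta> \<in> Cot p \<Longrightarrow> (\<lambda>v. a * \<alpha> v + b * \<beta> v) \<in> Cot p"
  using cot_combo[of "{True, False}" "\<lambda>i. if i then \<alpha> else \<beta>" p "\<lambda>i. if i then a else b"] by simp

lemma formsI:
  "(\<And>p. \<omega> p \<in> Cot p) \<Longrightarrow> (\<And>X. X \<in> Fields \<Longrightarrow> (\<lambda>p. \<omega> p (X p)) \<in> Fun) \<Longrightarrow> \<omega> \<in> Forms"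
  by (simp add: one_forms_def)

lemma forms_cot: "\<omega> \<in> Forms \<Longrightarrow> \<omega> p \<in> Cot p"
  and forms_smooth: "\<omega> \<in> Forms \<Longrightarrow> X \<in> Fields \<Longrightarrow> (\<lambda>p. \<omega> p (X p)) \<in> Fun"
  by (simp_all add: one_forms_def)

lemma forms_combo:
  assumes "\<And>i. i \<in> I \<Longrightarrow> \<omega> i \<in> Forms" "\<And>i. i \<in> I \<Longrightarrow> a i \<in> Fun"
  shows "(\<lambda>q v. \<Sum>i\<in>I. a i q * \<omega> i q v) \<in> Forms"
  by (rule formsI, rule cot_combo[OF forms_cot[OF assms(1)]], assumption,
      rule smooth_fun_sum, rule smooth_fun_mult[OF assms(2) forms_smooth[OF assms(1)]])

lemma ext_deriv_apply: "v \<in> Tan p \<Longrightarrow> ext_deriv A f p v = v f"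
  by (simp add: ext_deriv_def)

lemma ext_deriv_forms: "f \<in> Fun \<Longrightarrow> ext_deriv A f \<in> Forms"
proof (rule formsI)
  fix p assume f: "f \<in> Fun"
  show "ext_deriv A f p \<in> Cot p"
  proof (rule cotI)
    fix v w a b assume vw: "v \<in> Tan p" "w \<in> Tan p"
    show "ext_deriv A f p (\<lambda>f. a * v f + b * w f) = a * ext_deriv A f p v + b * ext_deriv A f p w"
      using tan_lincomb[OF vw] vw by (simp add: ext_deriv_apply)
  qed (simp add: ext_deriv_def)
qed (simp add: ext_deriv_apply[OF fields_tan] fields_smooth)

text \<open>
  A coordinate frame with constant coefficients gives the extension.
\<close>

lemma field_extension:
  assumes "v \<in> Tan p"
  obtains Y where "Y \<in> Fields" "Y p = v"
proof -
  obtain V and x :: "'e \<Rightarrow> 'm \<Rightarrow> real" and E where fr: "open V" "p \<in> V" "\<And>b. x b \<in> Fun" "\<And>b. E b \<in> Fields"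
    "\<And>q v. q \<in> V \<Longrightarrow> v \<in> Tan q \<Longrightarrow> v = (\<lambda>f. \<Sum>b\<in>Basis. v (x b) * E b q f)"
    by (rule coordinate_frame[of p]) blast
  have "(\<lambda>q f. \<Sum>b\<in>Basis. v (x b) * E b q f) \<in> Fields"
    by (rule fields_combo[OF fr(4) smooth_fun_const])
  then show ?thesis by (rule that) (rule fr(5)[OF fr(2) assms, symmetric])
qed

lemma forms_eqI:
  assumes "\<omega> \<in> Forms" "\<zeta> \<in> Forms" "\<And>Y p. Y \<in> Fields \<Longrightarrow> \<omega> p (Y p) = \<zeta> p (Y p)"
  shows "\<omega> = \<zeta>"
proof (intro ext)
  fix p v show "\<omega> p v = \<zeta> p v"
  proof (cases "v \<in> Tan p")
    case True
    then obtain Y where "Y \<in> Fields" "Y p = v" by (rule field_extension)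
    then show ?thesis using assms(3)[of Y p] by simp
  qed (simp add: cot_outside[OF forms_cot[OF assms(1)]] cot_outside[OF forms_cot[OF assms(2)]])
qed

section \<open>The Lie derivative of a 1-form\<close>

lemma lie_bracket_fields:
  assumes X: "X \<in> Fields" and Y: "Y \<in> Fields"
  shows "lie_bracket X Y \<in> Fields"
proof (rule fieldsI)
  fix p
  note XT = fields_tan[OF X] and YT = fields_tan[OF Y] and XS = fields_smooth[OF X] and YS = fields_smooth[OF Y]
  show "lie_bracket X Y p \<in> Tan p"
  proof (rule tanI)
    fix f assume "f \<notin> Fun"
    then show "lie_bracket X Y p f = 0"
      by (simp add: lie_bracket_def tan_outside[OF XT] tan_outside[OF YT] tan_const[OF XT] tan_const[OF YT])
  next
    fix f g a b assume f: "f \<in> Fun" and g: "g \<in> Fun"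
    show "lie_bracket X Y p (\<lambda>q. a * f q + b * g q) = a * lie_bracket X Y p f + b * lie_bracket X Y p g"
      by (simp add: lie_bracket_def tan_lin[OF XT f g] tan_lin[OF YT f g]
          tan_lin[OF XT YS[OF f] YS[OF g]] tan_lin[OF YT XS[OF f] XS[OF g]] algebra_simps)
    show "lie_bracket X Y p (\<lambda>q. f q * g q) = f p * lie_bracket X Y p g + g p * lie_bracket X Y p f"
      by (simp add: lie_bracket_def tan_mult[OF XT f g] tan_mult[OF YT f g]
          tan_add[OF XT smooth_fun_mult[OF f YS[OF g]] smooth_fun_mult[OF g YS[OF f]]]
          tan_add[OF YT smooth_fun_mult[OF f XS[OF g]] smooth_fun_mult[OF g XS[OF f]]]
          tan_mult[OF XT f YS[OF g]] tan_mult[OF XT g YS[OF f]]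
          tan_mult[OF YT f XS[OF g]] tan_mult[OF YT g XS[OF f]] algebra_simps)
  qed
next
  fix f assume f: "f \<in> Fun"
  show "(\<lambda>p. lie_bracket X Y p f) \<in> Fun"
    unfolding lie_bracket_def
    by (intro smooth_fun_diff fields_smooth[OF X] fields_smooth[OF Y] f)
qed

text \<open>
  The value that the Lie derivative of \<open>\<eta>\<close> along \<open>X\<close> must take on \<open>Y\<close>.
\<close>

definition lie_value :: "'m vfield \<Rightarrow> 'm form \<Rightarrow> 'm vfield \<Rightarrow> 'm \<Rightarrow> real" where
  "lie_value X \<eta> Y p = X p (\<lambda>q. \<eta> q (Y q)) - \<eta> p (lie_bracket X Y p)"

lemma fields_lincomb: "X \<in> Fields \<Longrightarrow> Y \<in> Fields \<Longrightarrow> (\<lambda>q f. a * X q f + b * Y q f) \<in> Fields"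
  using fields_combo[of "{True, False}" "\<lambda>i. if i then X else Y" "\<lambda>i q. if i then a else b"] by simp

lemma lie_value_lin:
  assumes X: "X \<in> Fields" and \<eta>: "\<eta> \<in> Forms" and Y: "Y \<in> Fields" and Z: "Z \<in> Fields"
  shows "lie_value X \<eta> (\<lambda>q f. a * Y q f + b * Z q f) p = a * lie_value X \<eta> Y p + b * lie_value X \<eta> Z p"
proof -
  have "X p (\<lambda>q. \<eta> q (\<lambda>f. a * Y q f + b * Z q f)) = a * X p (\<lambda>q. \<eta> q (Y q)) + b * X p (\<lambda>q. \<eta> q (Z q))"
    by (simp add: cot_lin[OF forms_cot[OF \<eta>] fields_tan[OF Y] fields_tan[OF Z]]
        tan_lin[OF fields_tan[OF X] forms_smooth[OF \<eta> Y] forms_smooth[OF \<eta> Z]])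
  moreover have "lie_bracket X (\<lambda>q f. a * Y q f + b * Z q f) p
      = (\<lambda>f. a * lie_bracket X Y p f + b * lie_bracket X Z p f)"
  proof
    fix f
    show "lie_bracket X (\<lambda>q f. a * Y q f + b * Z q f) p f
      = a * lie_bracket X Y p f + b * lie_bracket X Z p f"
    proof (cases "f \<in> Fun")
      case True
      then show ?thesis
        by (simp add: lie_bracket_def algebra_simps
          tan_lin[OF fields_tan[OF X] fields_smooth[OF Y True] fields_smooth[OF Z True]])
    next
      case False
      note 0 = tan_outside[OF fields_tan[OF lie_bracket_fields[OF X]] False]
      show ?thesis using 0[OF fields_lincomb[OF Y Z]] 0[OF Y] 0[OF Z] by simp
    qed
  qed
  ultimately show ?thesis
    by (simp add: lie_value_def algebra_simps cot_lin[OF forms_cot[OF \<eta>]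
        fields_tan[OF lie_bracket_fields[OF X Y]] fields_tan[OF lie_bracket_fields[OF X Z]]])
qed

text \<open>
  The value on \<open>Y\<close> is tensorial in \<open>Y\<close>.  In a coordinate frame \<open>Y = \<Sum>\<^sub>b z\<^sub>b E\<^sub>b\<close> with \<open>z\<^sub>b(p) = 0\<close>, so both
  terms of the value are equal to \<open>\<Sum>\<^sub>b X(z\<^sub>b) \<eta>(E\<^sub>b)\<close> at \<open>p\<close> and cancel.
\<close>

lemma lie_value_eq_0:
  assumes X: "X \<in> Fields" and \<eta>: "\<eta> \<in> Forms" and Y: "Y \<in> Fields" and 0: "Y p = (\<lambda>f. 0)"
  shows "lie_value X \<eta> Y p = 0"
proof -
  obtain V and x :: "'e \<Rightarrow> 'm \<Rightarrow> real" and E where V: "open V" "p \<in> V" and x: "\<And>b. x b \<in> Fun" and E: "\<And>b. E b \<in> Fields"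
    and fr: "\<And>q v. q \<in> V \<Longrightarrow> v \<in> Tan q \<Longrightarrow> v = (\<lambda>f. \<Sum>b\<in>Basis. v (x b) * E b q f)"
    by (rule coordinate_frame[of p]) blast
  note XT = fields_tan[OF X]
  define z where "z b = (\<lambda>q. Y q (x b))" for b
  define w where "w b = (\<lambda>q. \<eta> q (E b q))" for b
  have z: "z b \<in> Fun" for b unfolding z_def by (rule fields_smooth[OF Y x])
  have w: "w b \<in> Fun" for b unfolding w_def by (rule forms_smooth[OF \<eta> E])
  have z0: "z b p = 0" for b by (simp add: z_def 0)
  have Yq: "Y q = (\<lambda>f. \<Sum>b\<in>Basis. z b q * E b q f)" if "q \<in> V" for q
    unfolding z_def by (rule fr[OF that fields_tan[OF Y]])
  have "X p (\<lambda>q. \<eta> q (Y q)) = X p (\<lambda>q. \<Sum>b\<in>Basis. z b q * w b q)"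
  proof (rule tan_local[OF XT V forms_smooth[OF \<eta> Y] smooth_fun_sum[OF smooth_fun_mult[OF z w]]])
    fix q assume "q \<in> V"
    show "\<eta> q (Y q) = (\<Sum>b\<in>Basis. z b q * w b q)"
      unfolding w_def by (subst Yq[OF \<open>q \<in> V\<close>]) (rule cot_sum[OF forms_cot[OF \<eta>] fields_tan[OF E]])
  qed
  also have "\<dots> = (\<Sum>b\<in>Basis. X p (z b) * w b p)"
    unfolding tan_sum[OF XT smooth_fun_mult[OF z w]] tan_mult[OF XT z w] by (simp add: z0 mult.commute)
  finally have 1: "X p (\<lambda>q. \<eta> q (Y q)) = (\<Sum>b\<in>Basis. X p (z b) * w b p)" .
  have br: "lie_bracket X Y p f = (\<Sum>b\<in>Basis. X p (z b) * E b p f)" for f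
  proof (cases "f \<in> Fun")
    case True
    note Ef = fields_smooth[OF E True]
    have "X p (\<lambda>q. Y q f) = X p (\<lambda>q. \<Sum>b\<in>Basis. z b q * E b q f)"
      by (rule tan_local[OF XT V fields_smooth[OF Y True] smooth_fun_sum[OF smooth_fun_mult[OF z Ef]]])
        (simp add: Yq)
    also have "\<dots> = (\<Sum>b\<in>Basis. X p (z b) * E b p f)"
      unfolding tan_sum[OF XT smooth_fun_mult[OF z Ef]] tan_mult[OF XT z Ef] by (simp add: z0 mult.commute)
    finally show ?thesis by (simp add: lie_bracket_def 0)
  next
    case False
    then show ?thesis
      using tan_outside[OF fields_tan[OF lie_bracket_fields[OF X Y]] False] tan_outside[OF fields_tan[OF E] False] by simp
  qed
  have "\<eta> p (lie_bracket X Y p) = \<eta> p (\<lambda>f. \<Sum>b\<in>Basis. X p (z b) * E b p f)"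
    by (rule arg_cong[of _ _ "\<eta> p"]) (rule ext, rule br)
  also have "\<dots> = (\<Sum>b\<in>Basis. X p (z b) * w b p)"
    unfolding w_def by (rule cot_sum[OF forms_cot[OF \<eta>] fields_tan[OF E]])
  finally show ?thesis using 1 by (simp add: lie_value_def)
qed

text \<open>
  The definite description of the Lie derivative denotes: by tensoriality the value on a tangent
  vector may be computed from any extension to a vector field, and extensions exist, which also gives
  uniqueness.
\<close>

lemma lie_deriv_apply:
  assumes X: "X \<in> Fields" and \<eta>: "\<eta> \<in> Forms" and "Y \<in> Fields"
  shows "lie_deriv A X \<eta> p (Y p) = X p (\<lambda>q. \<eta> q (Y q)) - \<eta> p (lie_bracket X Y p)"
proof -
  define \<zeta> where "\<zeta> p v = (if v \<in> Tan p then lie_value X \<eta> (SOME Y. Y \<in> Fields \<and> Y p = v) p else 0)" for p v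
  have \<zeta>: "\<zeta> p (Y p) = lie_value X \<eta> Y p" if Y: "Y \<in> Fields" for Y p
  proof -
    define Z where "Z = (SOME Z. Z \<in> Fields \<and> Z p = Y p)"
    have "Z \<in> Fields \<and> Z p = Y p" unfolding Z_def by (rule someI[of _ Y]) (simp add: Y)
    then have Z: "Z \<in> Fields" "Z p = Y p" by auto
    have "lie_value X \<eta> (\<lambda>q f. 1 * Z q f + (- 1) * Y q f) p = 0"
      by (rule lie_value_eq_0[OF X \<eta> fields_lincomb[OF Z(1) Y]]) (simp add: Z(2))
    then show ?thesis
      using lie_value_lin[OF X \<eta> Z(1) Y, of 1 "-1" p] fields_tan[OF Y, of p] by (simp add: \<zeta>_def Z_def)
  qed
  have "\<zeta> \<in> Forms"
  proof (rule formsI)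
    fix p show "\<zeta> p \<in> Cot p"
    proof (rule cotI)
      fix v w a b assume "v \<in> Tan p" "w \<in> Tan p"
      then obtain Y Z where Y: "Y \<in> Fields" "Y p = v" and Z: "Z \<in> Fields" "Z p = w"
        by (metis field_extension)
      show "\<zeta> p (\<lambda>f. a * v f + b * w f) = a * \<zeta> p v + b * \<zeta> p w"
        using \<zeta>[OF fields_lincomb[OF Y(1) Z(1)], of p a b] \<zeta>[OF Y(1), of p] \<zeta>[OF Z(1), of p]
          lie_value_lin[OF X \<eta> Y(1) Z(1), of a b p] by (simp add: Y(2) Z(2))
    qed (simp add: \<zeta>_def)
  next
    fix Y assume Y: "Y \<in> Fields"
    show "(\<lambda>p. \<zeta> p (Y p)) \<in> Fun"
      unfolding \<zeta>[OF Y] lie_value_def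
      by (intro smooth_fun_diff fields_smooth[OF X] forms_smooth[OF \<eta>] Y lie_bracket_fields X)
  qed
  then have "\<exists>!\<zeta>. \<zeta> \<in> Forms \<and>
     (\<forall>Y\<in>Fields. \<forall>p. \<zeta> p (Y p) = X p (\<lambda>q. \<eta> q (Y q)) - \<eta> p (lie_bracket X Y p))"
    by (intro ex1I[of _ \<zeta>]) (auto simp: \<zeta> lie_value_def intro!: forms_eqI)
  from theI'[OF this, folded lie_deriv_def] show ?thesis using \<open>Y \<in> Fields\<close> by blast
qed

end

section \<open>The sharp map of a bivector field\<close>

locale bivector_manifold = smooth_manifold A
  for A :: "('m::{t2_space,second_countable_topology}, 'e::euclidean_space) chart set" +
  fixes P :: "'m cobilinear"
  assumes bivector: "bivector_field A P"
begin

lemma P_lin: "\<alpha> \<in> Cot p \<Longrightarrow> \<beta> \<in> Cot p \<Longrightarrow> \<gamma> \<in> Cot p \<Longrightarrow> P p (\<lambda>v. a * \<alpha> v + b * \<beta> v) \<gamma> = a * P p \<alpha> \<gamma> + b * P p \<beta> \<gamma>"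
  and P_antisym: "\<alpha> \<in> Cot p \<Longrightarrow> \<beta> \<in> Cot p \<Longrightarrow> P p \<alpha> \<beta> = - P p \<beta> \<alpha>"
  and P_smooth: "\<omega> \<in> Forms \<Longrightarrow> \<zeta> \<in> Forms \<Longrightarrow> (\<lambda>p. P p (\<omega> p) (\<zeta> p)) \<in> Fun"
  using bivector unfolding bivector_field_def by blast+

lemma P_sum:
  assumes \<alpha>: "\<alpha> \<in> Cot p" and \<beta>: "\<And>i. i \<in> I \<Longrightarrow> \<beta> i \<in> Cot p"
  shows "P p (\<lambda>v. \<Sum>i\<in>I. a i * \<beta> i v) \<alpha> = (\<Sum>i\<in>I. a i * P p (\<beta> i) \<alpha>)"
proof -
  have 0: "P p (\<lambda>v. 0) \<alpha> = 0" using P_lin[OF \<alpha> \<alpha> \<alpha>, of 0 0] by simp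
  show ?thesis using \<beta>
  proof (induction I rule: infinite_finite_induct)
    case (insert i I)
    have "(\<lambda>v. \<Sum>i\<in>I. a i * \<beta> i v) \<in> Cot p" by (rule cot_combo) (use insert in auto)
    then show ?case using insert P_lin[of "\<beta> i" p "\<lambda>v. \<Sum>i\<in>I. a i * \<beta> i v" \<alpha> "a i" 1] \<alpha> by simp
  qed (simp_all add: 0)
qed

text \<open>
  Tangent spaces are finite-dimensional, hence reflexive.  Explicitly, the functional
  \<open>\<beta> \<mapsto> P(\<omega>,\<beta>)\<close> is represented by \<open>\<Sum>\<^sub>b P(\<omega>, dx\<^sub>b) E\<^sub>b\<close> because \<open>\<beta> = \<Sum>\<^sub>b \<beta>(E\<^sub>b) dx\<^sub>b\<close>; and a tangent vector is
  determined by the values of the \<open>dx\<^sub>b\<close> on it.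
\<close>

lemma sharp_props:
  assumes \<omega>: "\<omega> \<in> Forms"
  shows sharp_tan: "sharp A P \<omega> p \<in> Tan p"
    and sharp_apply: "\<beta> \<in> Cot p \<Longrightarrow> \<beta> (sharp A P \<omega> p) = P p (\<omega> p) \<beta>"
proof -
  obtain V and x :: "'e \<Rightarrow> 'm \<Rightarrow> real" and E where V: "open V" "p \<in> V" and x: "\<And>b. x b \<in> Fun" and E: "\<And>b. E b \<in> Fields"
    and fr: "\<And>q v. q \<in> V \<Longrightarrow> v \<in> Tan q \<Longrightarrow> v = (\<lambda>f. \<Sum>b\<in>Basis. v (x b) * E b q f)"
    by (rule coordinate_frame[of p]) blast
  note dx = forms_cot[OF ext_deriv_forms[OF x]] and \<omega>p = forms_cot[OF \<omega>, of p]
  let ?v = "\<lambda>f. \<Sum>b\<in>Basis. P p (\<omega> p) (ext_deriv A (x b) p) * E b p f"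
  have v: "?v \<in> Tan p" by (rule tan_combo[OF fields_tan[OF E]])
  have \<beta>v: "\<beta> ?v = P p (\<omega> p) \<beta>" if \<beta>: "\<beta> \<in> Cot p" for \<beta>
  proof -
    have "\<beta> = (\<lambda>v. \<Sum>b\<in>Basis. \<beta> (E b p) * ext_deriv A (x b) p v)"
    proof
      fix v show "\<beta> v = (\<Sum>b\<in>Basis. \<beta> (E b p) * ext_deriv A (x b) p v)"
      proof (cases "v \<in> Tan p")
        case True
        have "\<beta> v = \<beta> (\<lambda>f. \<Sum>b\<in>Basis. v (x b) * E b p f)" by (rule arg_cong[OF fr[OF V(2) True]])
        also have "\<dots> = (\<Sum>b\<in>Basis. v (x b) * \<beta> (E b p))" by (rule cot_sum[OF \<beta> fields_tan[OF E]])
        finally show ?thesis using True by (simp add: ext_deriv_apply mult.commute)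
      qed (simp add: ext_deriv_def cot_outside[OF \<beta>])
    qed
    then have "P p \<beta> (\<omega> p) = P p (\<lambda>v. \<Sum>b\<in>Basis. \<beta> (E b p) * ext_deriv A (x b) p v) (\<omega> p)"
      by (rule arg_cong)
    also have "\<dots> = (\<Sum>b\<in>Basis. \<beta> (E b p) * P p (ext_deriv A (x b) p) (\<omega> p))"
      by (rule P_sum[OF \<omega>p dx])
    also have "\<dots> = - (\<Sum>b\<in>Basis. P p (\<omega> p) (ext_deriv A (x b) p) * \<beta> (E b p))"
      by (simp add: P_antisym[OF dx \<omega>p] sum_negf mult.commute)
    also have "\<dots> = - \<beta> ?v" by (simp add: cot_sum[OF \<beta> fields_tan[OF E]])
    finally show ?thesis using P_antisym[OF \<omega>p \<beta>] by simp
  qed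
  have "\<exists>!v. v \<in> Tan p \<and> (\<forall>\<beta>\<in>Cot p. \<beta> v = P p (\<omega> p) \<beta>)"
  proof (rule ex1I[of _ ?v])
    show "?v \<in> Tan p \<and> (\<forall>\<beta>\<in>Cot p. \<beta> ?v = P p (\<omega> p) \<beta>)" using v \<beta>v by blast
  next
    fix w assume w: "w \<in> Tan p \<and> (\<forall>\<beta>\<in>Cot p. \<beta> w = P p (\<omega> p) \<beta>)"
    then have wx: "w (x b) = P p (\<omega> p) (ext_deriv A (x b) p)" for b
      using dx[of b p] by (metis ext_deriv_apply)
    have "w = (\<lambda>f. \<Sum>b\<in>Basis. w (x b) * E b p f)" by (rule fr[OF V(2)]) (simp add: w)
    then show "w = ?v" by (simp only: wx)
  qed
  from theI'[OF this] show "sharp A P \<omega> p \<in> Tan p" "\<beta> \<in> Cot p \<Longrightarrow> \<beta> (sharp A P \<omega> p) = P p (\<omega> p) \<beta>"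
    unfolding sharp_def by blast+
qed

lemma sharp_fun: "\<omega> \<in> Forms \<Longrightarrow> f \<in> Fun \<Longrightarrow> sharp A P \<omega> p f = P p (\<omega> p) (ext_deriv A f p)"
  using sharp_apply[of \<omega> "ext_deriv A f p" p] forms_cot[OF ext_deriv_forms] ext_deriv_apply[OF sharp_tan] by metis

lemma sharp_fields: "\<omega> \<in> Forms \<Longrightarrow> sharp A P \<omega> \<in> Fields"
  by (rule fieldsI[OF sharp_tan]) (simp_all add: sharp_fun P_smooth ext_deriv_forms)

end

section \<open>Orthonormal frames and the cometric\<close>

text \<open>
  With \<open>s = t\<^sup>T t\<close>, the sum of the squared entries of \<open>s - 1\<close> is \<open>tr(s\<^sup>2) - 2 tr(s) + n\<close>.  The traces of \<open>s\<close>
  and \<open>s\<^sup>2\<close> are those of \<open>t t\<^sup>T = 1\<close> and its square, so this is \<open>n - 2n + n = 0\<close>.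
\<close>

lemma columns_orthonormal:
  fixes t :: "nat \<Rightarrow> nat \<Rightarrow> real"
  assumes rows: "\<And>i i'. i < n \<Longrightarrow> i' < n \<Longrightarrow> (\<Sum>j<n. t i j * t i' j) = (if i = i' then 1 else 0)"
    and "j < n" "k < n"
  shows "(\<Sum>i<n. t i j * t i k) = (if j = k then 1 else 0)"
proof -
  define s where "s j k = (\<Sum>i<n. t i j * t i k)" for j k
  define d where "d j k = (if j = k then 1 else (0::real))" for j k :: nat
  have "(\<Sum>j<n. \<Sum>k<n. s j k * s j k) = (\<Sum>j<n. \<Sum>k<n. \<Sum>i<n. \<Sum>i'<n. (t i j * t i' j) * (t i k * t i' k))"
    by (simp add: s_def sum_product mult_ac)
  also have "\<dots> = (\<Sum>j<n. \<Sum>i<n. \<Sum>k<n. \<Sum>i'<n. (t i j * t i' j) * (t i k * t i' k))"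
    by (rule sum.cong[OF refl]) (rule sum.swap)
  also have "\<dots> = (\<Sum>j<n. \<Sum>i<n. \<Sum>i'<n. \<Sum>k<n. (t i j * t i' j) * (t i k * t i' k))"
    by (rule sum.cong[OF refl], rule sum.cong[OF refl]) (rule sum.swap)
  also have "\<dots> = (\<Sum>i<n. \<Sum>j<n. \<Sum>i'<n. \<Sum>k<n. (t i j * t i' j) * (t i k * t i' k))"
    by (rule sum.swap)
  also have "\<dots> = (\<Sum>i<n. \<Sum>i'<n. \<Sum>j<n. \<Sum>k<n. (t i j * t i' j) * (t i k * t i' k))"
    by (rule sum.cong[OF refl]) (rule sum.swap)
  also have "\<dots> = (\<Sum>i<n. \<Sum>i'<n. (\<Sum>j<n. t i j * t i' j) * (\<Sum>k<n. t i k * t i' k))"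
    by (simp add: sum_product)
  also have "\<dots> = (\<Sum>i<n. \<Sum>i'<n. if i = i' then 1 else 0)"
    by (intro sum.cong refl) (simp add: rows)
  also have "\<dots> = real n" by simp
  finally have ss: "(\<Sum>j<n. \<Sum>k<n. s j k * s j k) = real n" .
  have "(\<Sum>j<n. \<Sum>k<n. s j k * d j k) = (\<Sum>j<n. \<Sum>k<n. if j = k then s j k else 0)"
    by (intro sum.cong refl) (simp add: d_def)
  also have "\<dots> = (\<Sum>j<n. s j j)" by simp
  also have "\<dots> = (\<Sum>i<n. \<Sum>j<n. t i j * t i j)" unfolding s_def by (rule sum.swap)
  also have "\<dots> = real n" by (simp add: rows)
  finally have sd: "(\<Sum>j<n. \<Sum>k<n. s j k * d j k) = real n" .
  have dd: "(\<Sum>j<n. \<Sum>k<n. d j k * d j k) = real n"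
  proof -
    have "(\<Sum>j<n. \<Sum>k<n. d j k * d j k) = (\<Sum>j<n. \<Sum>k<n. if j = k then 1 else 0)"
      by (intro sum.cong refl) (simp add: d_def)
    then show ?thesis by simp
  qed
  have "(\<Sum>j<n. \<Sum>k<n. (s j k - d j k)\<^sup>2)
      = (\<Sum>j<n. \<Sum>k<n. s j k * s j k) - 2 * (\<Sum>j<n. \<Sum>k<n. s j k * d j k) + (\<Sum>j<n. \<Sum>k<n. d j k * d j k)"
    by (simp add: power2_eq_square algebra_simps sum.distrib sum_subtractf sum_distrib_left)
  also have "\<dots> = 0" using ss sd dd by simp
  finally have "(\<Sum>j<n. \<Sum>k<n. (s j k - d j k)\<^sup>2) = 0" .
  then have "(\<Sum>k<n. (s j k - d j k)\<^sup>2) = 0"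
    using assms(2) by (subst (asm) sum_nonneg_eq_0_iff) (auto intro: sum_nonneg)
  then have "(s j k - d j k)\<^sup>2 = 0"
    using assms(3) by (subst (asm) sum_nonneg_eq_0_iff) auto
  then show ?thesis by (simp add: s_def d_def)
qed

locale metric_manifold = smooth_manifold A
  for A :: "('m::{t2_space,second_countable_topology}, 'e::euclidean_space) chart set" +
  fixes h :: "'m metric"
  assumes metric: "riemannian_metric A h"
begin

lemma h_lin: "u \<in> Tan p \<Longrightarrow> v \<in> Tan p \<Longrightarrow> w \<in> Tan p \<Longrightarrow> h p (\<lambda>f. a * u f + b * v f) w = a * h p u w + b * h p v w"
  and h_sym: "v \<in> Tan p \<Longrightarrow> w \<in> Tan p \<Longrightarrow> h p v w = h p w v"
  and h_pos: "v \<in> Tan p \<Longrightarrow> v \<noteq> (\<lambda>f. 0) \<Longrightarrow> h p v v > 0"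
  and h_smooth: "X \<in> Fields \<Longrightarrow> Y \<in> Fields \<Longrightarrow> (\<lambda>p. h p (X p) (Y p)) \<in> Fun"
  using metric unfolding riemannian_metric_def by blast+

lemma h_sum_left:
  assumes w: "w \<in> Tan p" and v: "\<And>i. i \<in> I \<Longrightarrow> v i \<in> Tan p"
  shows "h p (\<lambda>f. \<Sum>i\<in>I. a i * v i f) w = (\<Sum>i\<in>I. a i * h p (v i) w)"
proof -
  have 0: "h p (\<lambda>f. 0) w = 0" using h_lin[OF w w w, of 0 0] by simp
  show ?thesis using v
  proof (induction I rule: infinite_finite_induct)
    case (insert i I)
    have "(\<lambda>f. \<Sum>i\<in>I. a i * v i f) \<in> Tan p" by (rule tan_combo) (use insert in auto)
    then show ?case using insert h_lin[of "v i" p "\<lambda>f. \<Sum>i\<in>I. a i * v i f" w "a i" 1] w by simp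
  qed (simp_all add: 0)
qed

lemma h_sum_right:
  assumes w: "w \<in> Tan p" and v: "\<And>i. i \<in> I \<Longrightarrow> v i \<in> Tan p"
  shows "h p w (\<lambda>f. \<Sum>i\<in>I. a i * v i f) = (\<Sum>i\<in>I. a i * h p w (v i))"
proof -
  have "h p w (\<lambda>f. \<Sum>i\<in>I. a i * v i f) = h p (\<lambda>f. \<Sum>i\<in>I. a i * v i f) w"
    by (rule h_sym[OF w tan_combo[OF v]])
  also have "\<dots> = (\<Sum>i\<in>I. a i * h p (v i) w)" by (rule h_sum_left[OF w v])
  also have "\<dots> = (\<Sum>i\<in>I. a i * h p w (v i))" by (intro sum.cong refl) (simp add: h_sym[OF v w])
  finally show ?thesis .
qed

text \<open>
  The functions \<open>y\<close> are dual to the fields \<open>X\<close>.  The last clause expresses the triangular shape of the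
  process: the first \<open>k\<close> orthonormal fields do not involve \<open>X\<^sub>k, X\<^sub>k\<^sub>+\<^sub>1, \<dots>\<close>, so that \<open>y\<^sub>k\<close> takes the value 1
  on the next field before normalisation.  That field is therefore nonzero at \<open>p\<close>, and each
  normalisation shrinks the neighbourhood to where its norm stays positive.
\<close>

lemma gram_schmidt:
  fixes X :: "nat \<Rightarrow> 'm vfield" and y :: "nat \<Rightarrow> 'm \<Rightarrow> real"
  assumes V: "open V" "p \<in> V" and X: "\<And>i. X i \<in> Fields"
    and dual: "\<And>q i j. q \<in> V \<Longrightarrow> i < n \<Longrightarrow> j < n \<Longrightarrow> X i q (y j) = (if i = j then 1 else 0)"
    and "k \<le> n"
  shows "\<exists>e U. open U \<and> p \<in> U \<and> U \<subseteq> V \<and> (\<forall>i<k. e i \<in> Fields) \<and>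
    (\<forall>q\<in>U. \<forall>i<k. \<forall>j<k. h q (e i q) (e j q) = (if i = j then 1 else 0)) \<and>
    (\<forall>q\<in>U. \<forall>i<k. \<exists>a. X i q = (\<lambda>f. \<Sum>j<k. a j * e j q f)) \<and>
    (\<forall>q\<in>U. \<forall>i<k. \<forall>j. k \<le> j \<and> j < n \<longrightarrow> e i q (y j) = 0)"
  using \<open>k \<le> n\<close>
proof (induction k)
  case 0
  then show ?case using V by (intro exI[of _ X] exI[of _ V]) auto
next
  case (Suc k)
  then have kn: "k < n" by simp
  from Suc.IH[OF less_imp_le[OF kn]] obtain e U where U: "open U" "p \<in> U" "U \<subseteq> V"
    and ex: "\<forall>i<k. e i \<in> Fields"
      "\<forall>q\<in>U. \<forall>i<k. \<forall>j<k. h q (e i q) (e j q) = (if i = j then 1 else 0)"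
      "\<forall>q\<in>U. \<forall>i<k. \<exists>a. X i q = (\<lambda>f. \<Sum>j<k. a j * e j q f)"
      "\<forall>q\<in>U. \<forall>i<k. \<forall>j. k \<le> j \<and> j < n \<longrightarrow> e i q (y j) = 0"
    by (elim exE conjE)
  have e: "\<And>i. i < k \<Longrightarrow> e i \<in> Fields"
    and orth: "\<And>q i j. q \<in> U \<Longrightarrow> i < k \<Longrightarrow> j < k \<Longrightarrow> h q (e i q) (e j q) = (if i = j then 1 else 0)"
    and span: "\<And>q i. q \<in> U \<Longrightarrow> i < k \<Longrightarrow> \<exists>a. X i q = (\<lambda>f. \<Sum>j<k. a j * e j q f)"
    and tri: "\<And>q i j. q \<in> U \<Longrightarrow> i < k \<Longrightarrow> k \<le> j \<Longrightarrow> j < n \<Longrightarrow> e i q (y j) = 0"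
    using ex by blast+
  have eT: "e i q \<in> Tan q" if "i < k" for i q by (rule fields_tan[OF e[OF that]])
  define c where "c i = (\<lambda>q. h q (X k q) (e i q))" for i
  define S where "S = (\<lambda>q f. \<Sum>i<k. c i q * e i q f)"
  define Y where "Y = (\<lambda>q f. 1 * X k q f + (- 1) * S q f)"
  have S: "S \<in> Fields" unfolding S_def
    by (rule fields_combo) (use e h_smooth[OF X] in \<open>auto simp: c_def\<close>)
  have Y: "Y \<in> Fields" unfolding Y_def by (rule fields_lincomb[OF X S])
  note YT = fields_tan[OF Y] and ST = fields_tan[OF S] and XT = fields_tan[OF X]
  have Yy: "Y q (y j) = (if k = j then 1 else 0)" if "q \<in> U" "k \<le> j" "j < n" for q j
    using that U(3) kn by (auto simp: Y_def S_def tri dual subset_iff)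
  have Ye: "h q (Y q) (e j q) = 0" if q: "q \<in> U" and j: "j < k" for q j
  proof -
    have "h q (S q) (e j q) = (\<Sum>i<k. c i q * h q (e i q) (e j q))"
      unfolding S_def by (rule h_sum_left[OF eT[OF j]]) (simp add: eT)
    also have "\<dots> = (\<Sum>i<k. if i = j then c i q else 0)"
      by (rule sum.cong[OF refl]) (simp add: orth[OF q _ j])
    also have "\<dots> = c j q" using j by simp
    finally show ?thesis
      unfolding Y_def h_lin[OF XT ST eT[OF j]] by (simp add: c_def)
  qed
  define F where "F = (\<lambda>q. h q (Y q) (Y q))"
  have F: "F \<in> Fun" unfolding F_def by (rule h_smooth[OF Y Y])
  \<comment> \<open>The dual function \<open>y k\<close> takes the value 1 on \<open>Y p\<close>.\<close>
  have "Y p \<noteq> (\<lambda>f. 0)" using Yy[OF U(2) order_refl kn] by auto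
  then have Fp: "F p > 0" unfolding F_def by (rule h_pos[OF YT])
  obtain s W where s: "s \<in> Fun" and W: "open W" "p \<in> W"
    and sF: "\<And>q. q \<in> W \<Longrightarrow> F q > 0 \<and> s q = F q powr (-(1/2))"
    by (rule smooth_fun_powr[where f=F and a="-(1/2)", OF F Fp]) blast
  have s2: "s q * s q * F q = 1" "s q > 0" if "q \<in> W" for q
  proof -
    define r where "r = F q powr (1/2)"
    have r: "r > 0" "s q = inverse r" "F q = r * r"
      using sF[OF that] powr_add[of "F q" "1/2" "1/2"] by (simp_all add: powr_minus r_def)
    show "s q * s q * F q = 1" "s q > 0"
      using r(1) unfolding r(2,3) by (simp_all add: field_simps)
  qed
  define Z where "Z = (\<lambda>q f. s q * Y q f)"
  have Z: "Z \<in> Fields" using fields_combo[of "{0::nat}" "\<lambda>_. Y" "\<lambda>_. s"] Y s by (simp add: Z_def)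
  have Zh: "h q (Z q) w = s q * h q (Y q) w" if "w \<in> Tan q" for q w
    using h_sum_left[OF that, of "{0::nat}" "\<lambda>_. Y q" "\<lambda>_. s q"] YT by (simp add: Z_def)
  define e' where "e' = e(k := Z)"
  have e'k: "e' k = Z" and e'i: "i < k \<Longrightarrow> e' i = e i" for i by (auto simp: e'_def)
  have e'F: "e' i \<in> Fields" if "i < Suc k" for i
    using that e'k e'i Z e by (cases "i = k") auto
  have "h q (e' i q) (e' j q) = (if i = j then 1 else 0)" if q: "q \<in> U \<inter> W" and ij: "i < Suc k" "j < Suc k" for q i j
  proof -
    have kk: "h q (Z q) (Z q) = 1"
    proof -
      have "h q (Z q) (Z q) = s q * (s q * F q)"
        by (simp add: Zh fields_tan[OF Z] h_sym[OF YT fields_tan[OF Z]] YT F_def)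
      then show ?thesis using s2(1)[of q] q by simp
    qed
    have kj: "h q (Z q) (e j q) = 0" if "j < k" for j using q by (simp add: Zh[OF eT[OF that]] Ye that)
    have jk: "h q (e j q) (Z q) = 0" if "j < k" for j
      using kj[OF that] h_sym[OF eT[OF that] fields_tan[OF Z]] by simp
    show ?thesis
      using kk kj jk orth[of q i j] q ij e'k e'i by (cases "i = k"; cases "j = k") auto
  qed
  moreover have "\<exists>a. X i q = (\<lambda>f. \<Sum>j<Suc k. a j * e' j q f)" if q: "q \<in> U \<inter> W" and i: "i < Suc k" for q i
  proof (cases "i = k")
    case True
    have "X k q f = (\<Sum>j<k. c j q * e j q f) + (1 / s q) * Z q f" for f
      using s2(2)[of q] q by (simp add: Z_def Y_def S_def)
    moreover have "(\<Sum>j<k. c j q * e j q f) = (\<Sum>j<k. (if j < k then c j q else 1 / s q) * e' j q f)" for f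
      by (rule sum.cong[OF refl]) (simp add: e'i)
    ultimately show ?thesis unfolding True
      by (intro exI[of _ "\<lambda>j. if j < k then c j q else 1 / s q"] ext) (simp add: e'k)
  next
    case False
    then have ik: "i < k" using i by simp
    obtain a where a: "X i q = (\<lambda>f. \<Sum>j<k. a j * e j q f)" using span[OF _ ik, of q] q by blast
    have "(\<Sum>j<k. a j * e j q f) = (\<Sum>j<k. (if j < k then a j else 0) * e' j q f)" for f
      by (rule sum.cong[OF refl]) (simp add: e'i)
    then show ?thesis
      by (intro exI[of _ "\<lambda>j. if j < k then a j else 0"] ext) (simp add: a)
  qed
  moreover have "e' i q (y j) = 0" if q: "q \<in> U \<inter> W" and i: "i < Suc k" and j: "Suc k \<le> j" "j < n" for q i j
    using tri[of q i j] Yy[of q j] q i j e'k e'i by (cases "i = k") (auto simp: Z_def)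
  ultimately show ?case
    using U W e'F by (intro exI[of _ e'] exI[of _ "U \<inter> W"]) auto
qed

lemma orthonormal_frame:
  obtains U e where "open U" "p \<in> U" "\<And>i. i < DIM('e) \<Longrightarrow> e i \<in> Fields"
    "\<And>q i j. q \<in> U \<Longrightarrow> i < DIM('e) \<Longrightarrow> j < DIM('e) \<Longrightarrow> h q (e i q) (e j q) = (if i = j then 1 else 0)"
    "\<And>q v. q \<in> U \<Longrightarrow> v \<in> Tan q \<Longrightarrow> v = (\<lambda>f. \<Sum>i<DIM('e). h q v (e i q) * e i q f)"
proof -
  let ?n = "DIM('e)"
  obtain V and x :: "'e \<Rightarrow> 'm \<Rightarrow> real" and E where V: "open V" "p \<in> V" and E: "\<And>b. E b \<in> Fields"
    and fr: "\<And>q v. q \<in> V \<Longrightarrow> v \<in> Tan q \<Longrightarrow> v = (\<lambda>f. \<Sum>b\<in>Basis. v (x b) * E b q f)"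
    and Ex: "\<And>q b b'. q \<in> V \<Longrightarrow> b \<in> Basis \<Longrightarrow> b' \<in> Basis \<Longrightarrow> E b q (x b') = (if b = b' then 1 else 0)"
    by (rule coordinate_frame[of p]) blast
  obtain b :: "nat \<Rightarrow> 'e" where b: "bij_betw b {..<?n} Basis"
    using ex_bij_betw_nat_finite[OF finite_Basis, where 'a1='e] by (auto simp: atLeast0LessThan)
  have bB: "b i \<in> Basis" if "i < ?n" for i using b that by (auto simp: bij_betw_def)
  have bi: "b i = b j \<longleftrightarrow> i = j" if "i < ?n" "j < ?n" for i j
    using b that by (auto simp: bij_betw_def inj_on_def)
  have dual: "E (b i) q (x (b j)) = (if i = j then 1 else 0)" if "q \<in> V" "i < ?n" "j < ?n" for q i j
    using Ex[OF that(1) bB bB, of i j] that bi by simp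
  have E': "E (b i) \<in> Fields" for i by (rule E)
  have "\<exists>e U. open U \<and> p \<in> U \<and> U \<subseteq> V \<and> (\<forall>i<?n. e i \<in> Fields) \<and>
    (\<forall>q\<in>U. \<forall>i<?n. \<forall>j<?n. h q (e i q) (e j q) = (if i = j then 1 else 0)) \<and>
    (\<forall>q\<in>U. \<forall>i<?n. \<exists>a. E (b i) q = (\<lambda>f. \<Sum>j<?n. a j * e j q f)) \<and>
    (\<forall>q\<in>U. \<forall>i<?n. \<forall>j. ?n \<le> j \<and> j < ?n \<longrightarrow> e i q (x (b j)) = 0)"
    by (rule gram_schmidt[OF V E' _ order_refl]) (rule dual)
  then obtain e U where U: "open U" "p \<in> U" "U \<subseteq> V"
    and ex: "\<forall>i<?n. e i \<in> Fields"
      "\<forall>q\<in>U. \<forall>i<?n. \<forall>j<?n. h q (e i q) (e j q) = (if i = j then 1 else 0)"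
      "\<forall>q\<in>U. \<forall>i<?n. \<exists>a. E (b i) q = (\<lambda>f. \<Sum>j<?n. a j * e j q f)"
    by (elim exE conjE)
  have e: "\<And>i. i < ?n \<Longrightarrow> e i \<in> Fields"
    and orth: "\<And>q i j. q \<in> U \<Longrightarrow> i < ?n \<Longrightarrow> j < ?n \<Longrightarrow> h q (e i q) (e j q) = (if i = j then 1 else 0)"
    and span: "\<And>q i. q \<in> U \<Longrightarrow> i < ?n \<Longrightarrow> \<exists>a. E (b i) q = (\<lambda>f. \<Sum>j<?n. a j * e j q f)"
    using ex by blast+
  have eT: "e i q \<in> Tan q" if "i < ?n" for i q by (rule fields_tan[OF e[OF that]])
  have expand: "v = (\<lambda>f. \<Sum>i<?n. h q v (e i q) * e i q f)" if q: "q \<in> U" and v: "v \<in> Tan q" for q v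
  proof -
    obtain a where a: "\<And>i. i < ?n \<Longrightarrow> E (b i) q = (\<lambda>f. \<Sum>j<?n. a i j * e j q f)"
      using span[OF q] by metis
    define c where "c j = (\<Sum>i<?n. v (x (b i)) * a i j)" for j
    have vf: "v f = (\<Sum>j<?n. c j * e j q f)" for f
    proof -
      have "v f = (\<Sum>b\<in>Basis. v (x b) * E b q f)" using fun_cong[OF fr[of q v]] q U(3) v by blast
      also have "\<dots> = (\<Sum>i<?n. v (x (b i)) * E (b i) q f)"
        by (rule sum.reindex_bij_betw[OF b, symmetric])
      also have "\<dots> = (\<Sum>i<?n. \<Sum>j<?n. v (x (b i)) * a i j * e j q f)"
        by (rule sum.cong[OF refl]) (simp add: a sum_distrib_left mult.assoc)
      also have "\<dots> = (\<Sum>j<?n. \<Sum>i<?n. v (x (b i)) * a i j * e j q f)" by (rule sum.swap)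
      finally show ?thesis by (simp add: c_def sum_distrib_right)
    qed
    have "h q v (e j q) = c j" if j: "j < ?n" for j
    proof -
      have "h q v (e j q) = h q (\<lambda>f. \<Sum>i<?n. c i * e i q f) (e j q)"
        by (rule arg_cong[where f="\<lambda>v. h q v (e j q)"]) (rule ext, rule vf)
      also have "\<dots> = (\<Sum>i<?n. c i * h q (e i q) (e j q))"
        by (rule h_sum_left[OF eT[OF j]]) (simp add: eT)
      also have "\<dots> = (\<Sum>i<?n. if i = j then c i else 0)"
        by (rule sum.cong[OF refl]) (simp add: orth[OF q _ j])
      finally show ?thesis using j by simp
    qed
    then show ?thesis by (intro ext) (simp add: vf)
  qed
  show ?thesis by (rule that[OF U(1,2) e orth expand])
qed

abbreviation "g \<equiv> cometric A h"

text \<open>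
  An orthonormal frame turns the definite description of the metric sharp map into a formula.
\<close>

lemma metric_sharp_frame:
  assumes e: "\<And>i. i < n \<Longrightarrow> e i \<in> Tan q" and \<alpha>: "\<alpha> \<in> Cot q"
    and span: "\<And>v. v \<in> Tan q \<Longrightarrow> v = (\<lambda>f. \<Sum>i<n. h q v (e i) * e i f)"
  shows "metric_sharp A h q \<alpha> = (\<lambda>f. \<Sum>i<n. \<alpha> (e i) * e i f)" (is "_ = ?v")
  unfolding metric_sharp_def
proof (rule the_equality)
  have v: "?v \<in> Tan q" by (rule tan_combo) (simp add: e)
  have "h q ?v w = \<alpha> w" if w: "w \<in> Tan q" for w
  proof -
    have "h q ?v w = (\<Sum>i<n. \<alpha> (e i) * h q (e i) w)" by (rule h_sum_left[OF w]) (simp add: e)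
    also have "\<dots> = (\<Sum>i<n. h q w (e i) * \<alpha> (e i))"
      by (rule sum.cong[OF refl]) (simp add: h_sym[OF e w])
    also have "\<dots> = \<alpha> (\<lambda>f. \<Sum>i<n. h q w (e i) * e i f)"
      by (rule cot_sum[OF \<alpha>, symmetric]) (simp add: e)
    also have "\<dots> = \<alpha> w" by (rule arg_cong[OF span[OF w, symmetric]])
    finally show ?thesis .
  qed
  then show "?v \<in> Tan q \<and> (\<forall>w\<in>Tan q. h q ?v w = \<alpha> w)" using v by blast
next
  fix w assume w: "w \<in> Tan q \<and> (\<forall>u\<in>Tan q. h q w u = \<alpha> u)"
  have "w = (\<lambda>f. \<Sum>i<n. h q w (e i) * e i f)" by (rule span) (simp add: w)
  also have "\<dots> = ?v" by (intro ext sum.cong refl) (simp add: w e)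
  finally show "w = ?v" .
qed

text \<open>
  Near \<open>p\<close> the cometric is the standard inner product of the components in an orthonormal frame;
  bilinearity, symmetry, definiteness and smoothness are read off from this formula.
\<close>

lemma cometric_frame:
  obtains U e where "open U" "p \<in> U" "\<And>i. i < DIM('e) \<Longrightarrow> e i \<in> Fields"
    "\<And>q i j. q \<in> U \<Longrightarrow> i < DIM('e) \<Longrightarrow> j < DIM('e) \<Longrightarrow> h q (e i q) (e j q) = (if i = j then 1 else 0)"
    "\<And>q v. q \<in> U \<Longrightarrow> v \<in> Tan q \<Longrightarrow> v = (\<lambda>f. \<Sum>i<DIM('e). h q v (e i q) * e i q f)"
    "\<And>q \<alpha> \<beta>. q \<in> U \<Longrightarrow> \<alpha> \<in> Cot q \<Longrightarrow> \<beta> \<in> Cot q \<Longrightarrow> g q \<alpha> \<beta> = (\<Sum>i<DIM('e). \<alpha> (e i q) * \<beta> (e i q))"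
proof -
  let ?n = "DIM('e)"
  obtain U e where U: "open U" "p \<in> U" and e: "\<And>i. i < ?n \<Longrightarrow> e i \<in> Fields"
    and orth: "\<And>q i j. q \<in> U \<Longrightarrow> i < ?n \<Longrightarrow> j < ?n \<Longrightarrow> h q (e i q) (e j q) = (if i = j then 1 else 0)"
    and span: "\<And>q v. q \<in> U \<Longrightarrow> v \<in> Tan q \<Longrightarrow> v = (\<lambda>f. \<Sum>i<?n. h q v (e i q) * e i q f)"
    by (rule orthonormal_frame[of p]) blast
  have eT: "e i q \<in> Tan q" if "i < ?n" for i q by (rule fields_tan[OF e[OF that]])
  have gf: "g q \<alpha> \<beta> = (\<Sum>i<?n. \<alpha> (e i q) * \<beta> (e i q))" if q: "q \<in> U" and \<alpha>: "\<alpha> \<in> Cot q" and \<beta>: "\<beta> \<in> Cot q" for q \<alpha> \<beta>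
  proof -
    have ms: "metric_sharp A h q \<gamma> = (\<lambda>f. \<Sum>i<?n. \<gamma> (e i q) * e i q f)" if "\<gamma> \<in> Cot q" for \<gamma>
      by (rule metric_sharp_frame[OF eT that span[OF q]])
    have T: "(\<lambda>f. \<Sum>i<?n. \<beta> (e i q) * e i q f) \<in> Tan q" by (rule tan_combo) (simp add: eT)
    have "g q \<alpha> \<beta> = (\<Sum>i<?n. \<alpha> (e i q) * h q (e i q) (\<lambda>f. \<Sum>j<?n. \<beta> (e j q) * e j q f))"
      unfolding cometric_def ms[OF \<alpha>] ms[OF \<beta>] by (rule h_sum_left[OF T]) (simp add: eT)
    also have "\<dots> = (\<Sum>i<?n. \<alpha> (e i q) * \<beta> (e i q))"
    proof (rule sum.cong[OF refl])
      fix i assume "i \<in> {..<?n}"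
      then have i: "i < ?n" by simp
      have "h q (e i q) (\<lambda>f. \<Sum>j<?n. \<beta> (e j q) * e j q f) = (\<Sum>j<?n. \<beta> (e j q) * h q (e i q) (e j q))"
        by (rule h_sum_right[OF eT[OF i]]) (simp add: eT)
      also have "\<dots> = (\<Sum>j<?n. if i = j then \<beta> (e j q) else 0)"
        by (rule sum.cong[OF refl]) (simp add: orth[OF q i])
      also have "\<dots> = \<beta> (e i q)" using i by simp
      finally show "\<alpha> (e i q) * h q (e i q) (\<lambda>f. \<Sum>j<?n. \<beta> (e j q) * e j q f) = \<alpha> (e i q) * \<beta> (e i q)" by simp
    qed
    finally show ?thesis .
  qed
  show ?thesis by (rule that[OF U e orth span gf])
qed

lemma g_lin:
  assumes "\<alpha> \<in> Cot p" "\<beta> \<in> Cot p" "\<gamma> \<in> Cot p"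
  shows "g p (\<lambda>v. a * \<alpha> v + b * \<beta> v) \<gamma> = a * g p \<alpha> \<gamma> + b * g p \<beta> \<gamma>"
proof -
  obtain U e where U: "open U" "p \<in> U"
    and g: "\<And>q \<alpha> \<beta>. q \<in> U \<Longrightarrow> \<alpha> \<in> Cot q \<Longrightarrow> \<beta> \<in> Cot q \<Longrightarrow> g q \<alpha> \<beta> = (\<Sum>i<DIM('e). \<alpha> (e i q) * \<beta> (e i q))"
    by (rule cometric_frame[of p]) blast
  show ?thesis
    by (simp add: g[OF U(2)] assms cot_lincomb[OF assms(1,2)] algebra_simps sum.distrib sum_distrib_left)
qed

lemma g_sym: "g p \<alpha> \<beta> = g p \<beta> \<alpha>" if "\<alpha> \<in> Cot p" "\<beta> \<in> Cot p"
proof -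
  obtain U e where U: "open U" "p \<in> U"
    and g: "\<And>q \<alpha> \<beta>. q \<in> U \<Longrightarrow> \<alpha> \<in> Cot q \<Longrightarrow> \<beta> \<in> Cot q \<Longrightarrow> g q \<alpha> \<beta> = (\<Sum>i<DIM('e). \<alpha> (e i q) * \<beta> (e i q))"
    by (rule cometric_frame[of p]) blast
  show ?thesis by (simp add: g[OF U(2)] that mult.commute)
qed

lemma g_nonneg: "g p \<alpha> \<alpha> \<ge> 0" if "\<alpha> \<in> Cot p"
proof -
  obtain U e where U: "open U" "p \<in> U"
    and g: "\<And>q \<alpha> \<beta>. q \<in> U \<Longrightarrow> \<alpha> \<in> Cot q \<Longrightarrow> \<beta> \<in> Cot q \<Longrightarrow> g q \<alpha> \<beta> = (\<Sum>i<DIM('e). \<alpha> (e i q) * \<beta> (e i q))"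
    by (rule cometric_frame[of p]) blast
  show ?thesis by (simp add: g[OF U(2)] that sum_nonneg)
qed

lemma g_definite:
  assumes \<alpha>: "\<alpha> \<in> Cot p" and 0: "g p \<alpha> \<alpha> = 0"
  shows "\<alpha> = (\<lambda>v. 0)"
proof
  fix v
  obtain U e where U: "open U" "p \<in> U" and e: "\<And>i. i < DIM('e) \<Longrightarrow> e i \<in> Fields"
    and span: "\<And>q v. q \<in> U \<Longrightarrow> v \<in> Tan q \<Longrightarrow> v = (\<lambda>f. \<Sum>i<DIM('e). h q v (e i q) * e i q f)"
    and g: "\<And>q \<alpha> \<beta>. q \<in> U \<Longrightarrow> \<alpha> \<in> Cot q \<Longrightarrow> \<beta> \<in> Cot q \<Longrightarrow> g q \<alpha> \<beta> = (\<Sum>i<DIM('e). \<alpha> (e i q) * \<beta> (e i q))"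
    by (rule cometric_frame[of p]) blast
  have "(\<Sum>i<DIM('e). \<alpha> (e i p) * \<alpha> (e i p)) = 0" using g[OF U(2) \<alpha> \<alpha>] 0 by simp
  then have z: "\<alpha> (e i p) = 0" if "i < DIM('e)" for i
    using that by (subst (asm) sum_nonneg_eq_0_iff) auto
  show "\<alpha> v = 0"
  proof (cases "v \<in> Tan p")
    case True
    have "\<alpha> v = \<alpha> (\<lambda>f. \<Sum>i<DIM('e). h p v (e i p) * e i p f)" by (rule arg_cong[OF span[OF U(2) True]])
    also have "\<dots> = (\<Sum>i<DIM('e). h p v (e i p) * \<alpha> (e i p))"
      by (rule cot_sum[OF \<alpha>]) (simp add: fields_tan[OF e])
    finally show ?thesis by (simp add: z)
  qed (rule cot_outside[OF \<alpha>])
qed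

lemma g_smooth:
  assumes \<omega>: "\<omega> \<in> Forms" and \<zeta>: "\<zeta> \<in> Forms"
  shows "(\<lambda>p. g p (\<omega> p) (\<zeta> p)) \<in> Fun"
proof (rule smooth_fun_glue)
  fix p
  obtain U e where U: "open U" "p \<in> U" and e: "\<And>i. i < DIM('e) \<Longrightarrow> e i \<in> Fields"
    and g: "\<And>q \<alpha> \<beta>. q \<in> U \<Longrightarrow> \<alpha> \<in> Cot q \<Longrightarrow> \<beta> \<in> Cot q \<Longrightarrow> g q \<alpha> \<beta> = (\<Sum>i<DIM('e). \<alpha> (e i q) * \<beta> (e i q))"
    by (rule cometric_frame[of p]) blast
  have "(\<lambda>q. \<Sum>i<DIM('e). \<omega> q (e i q) * \<zeta> q (e i q)) \<in> Fun"
    by (rule smooth_fun_sum, rule smooth_fun_mult) (simp_all add: forms_smooth \<omega> \<zeta> e)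
  moreover have "\<forall>q\<in>U. g q (\<omega> q) (\<zeta> q) = (\<Sum>i<DIM('e). \<omega> q (e i q) * \<zeta> q (e i q))"
    using g forms_cot[OF \<omega>] forms_cot[OF \<zeta>] by blast
  ultimately show "\<exists>V f. open V \<and> p \<in> V \<and> f \<in> Fun \<and> (\<forall>q\<in>V. g q (\<omega> q) (\<zeta> q) = f q)"
    using U by blast
qed

text \<open>
  The coframe is dual to an orthonormal frame.
\<close>

lemma local_orthonormal_coframe_exists: "\<exists>\<theta>. local_orthonormal_coframe A g p \<theta>"
proof -
  let ?n = "DIM('e)"
  obtain U e where U: "open U" "p \<in> U" and e: "\<And>i. i < ?n \<Longrightarrow> e i \<in> Fields"
    and orth: "\<And>q i j. q \<in> U \<Longrightarrow> i < ?n \<Longrightarrow> j < ?n \<Longrightarrow> h q (e i q) (e j q) = (if i = j then 1 else 0)"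
    and g: "\<And>q \<alpha> \<beta>. q \<in> U \<Longrightarrow> \<alpha> \<in> Cot q \<Longrightarrow> \<beta> \<in> Cot q \<Longrightarrow> g q \<alpha> \<beta> = (\<Sum>i<DIM('e). \<alpha> (e i q) * \<beta> (e i q))"
    by (rule cometric_frame[of p]) blast
  have eT: "e i q \<in> Tan q" if "i < ?n" for i q by (rule fields_tan[OF e[OF that]])
  define \<theta> where "\<theta> i = (\<lambda>q v. if v \<in> Tan q then h q v (e i q) else 0)" for i
  have \<theta>: "\<theta> i \<in> Forms" if i: "i < ?n" for i
  proof (rule formsI)
    fix q show "\<theta> i q \<in> Cot q"
    proof (rule cotI)
      fix v w a b assume vw: "v \<in> Tan q" "w \<in> Tan q"
      show "\<theta> i q (\<lambda>f. a * v f + b * w f) = a * \<theta> i q v + b * \<theta> i q w"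
        using tan_lincomb[OF vw] h_lin[OF vw eT[OF i]] vw by (simp add: \<theta>_def)
    qed (simp add: \<theta>_def)
  next
    fix X assume X: "X \<in> Fields"
    show "(\<lambda>q. \<theta> i q (X q)) \<in> Fun"
      using h_smooth[OF X e[OF i]] fields_tan[OF X] by (simp add: \<theta>_def)
  qed
  have "g q (\<theta> i q) (\<theta> j q) = (if i = j then 1 else 0)" if q: "q \<in> U" and ij: "i < ?n" "j < ?n" for q i j
  proof -
    have "g q (\<theta> i q) (\<theta> j q) = (\<Sum>k<?n. \<theta> i q (e k q) * \<theta> j q (e k q))"
      by (rule g[OF q forms_cot[OF \<theta>[OF ij(1)]] forms_cot[OF \<theta>[OF ij(2)]]])
    also have "\<dots> = (\<Sum>k<?n. if i = k then (if i = j then 1 else 0) else 0)"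
      by (rule sum.cong[OF refl]) (simp add: \<theta>_def eT orth[OF q] ij)
    finally show ?thesis using ij by simp
  qed
  then show ?thesis using \<theta> U unfolding local_orthonormal_coframe_def by blast
qed

text \<open>
  Orthonormal covectors span as soon as their number is the dimension: the components of the \<open>\<theta>\<^sub>i\<close> in an
  orthonormal frame form a square matrix with orthonormal rows, and its columns, then orthonormal as
  well, give the expansion on the vectors of the frame.
\<close>

lemma coframe_expansion:
  assumes \<theta>: "\<And>i. i < DIM('e) \<Longrightarrow> \<theta> i \<in> Cot p"
    and orth: "\<And>i j. i < DIM('e) \<Longrightarrow> j < DIM('e) \<Longrightarrow> g p (\<theta> i) (\<theta> j) = (if i = j then 1 else 0)"
    and \<alpha>: "\<alpha> \<in> Cot p"
  shows "\<alpha> = (\<lambda>v. \<Sum>i<DIM('e). g p \<alpha> (\<theta> i) * \<theta> i v)"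
proof
  let ?n = "DIM('e)"
  obtain U e where U: "open U" "p \<in> U" and e: "\<And>i. i < ?n \<Longrightarrow> e i \<in> Fields"
    and span: "\<And>q v. q \<in> U \<Longrightarrow> v \<in> Tan q \<Longrightarrow> v = (\<lambda>f. \<Sum>i<?n. h q v (e i q) * e i q f)"
    and g: "\<And>q \<alpha> \<beta>. q \<in> U \<Longrightarrow> \<alpha> \<in> Cot q \<Longrightarrow> \<beta> \<in> Cot q \<Longrightarrow> g q \<alpha> \<beta> = (\<Sum>i<DIM('e). \<alpha> (e i q) * \<beta> (e i q))"
    by (rule cometric_frame[of p]) blast
  note g = g[OF U(2)]
  define t where "t i j = \<theta> i (e j p)" for i j
  have rows: "(\<Sum>j<?n. t i j * t i' j) = (if i = i' then 1 else 0)" if "i < ?n" "i' < ?n" for i i'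
    using g[OF \<theta>[OF that(1)] \<theta>[OF that(2)]] orth[OF that] by (simp add: t_def)
  have eval: "\<alpha> (e j p) = (\<Sum>i<?n. g p \<alpha> (\<theta> i) * t i j)" if j: "j < ?n" for j
  proof -
    have "(\<Sum>i<?n. g p \<alpha> (\<theta> i) * t i j) = (\<Sum>i<?n. \<Sum>k<?n. \<alpha> (e k p) * (t i k * t i j))"
      by (rule sum.cong[OF refl]) (simp add: g[OF \<alpha> \<theta>] t_def sum_distrib_right mult.assoc)
    also have "\<dots> = (\<Sum>k<?n. \<Sum>i<?n. \<alpha> (e k p) * (t i k * t i j))" by (rule sum.swap)
    also have "\<dots> = (\<Sum>k<?n. if k = j then \<alpha> (e k p) else 0)"
      by (rule sum.cong[OF refl]) (simp add: sum_distrib_left[symmetric] columns_orthonormal[of ?n t, OF rows _ j])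
    finally show ?thesis using j by simp
  qed
  fix v
  show "\<alpha> v = (\<Sum>i<?n. g p \<alpha> (\<theta> i) * \<theta> i v)"
  proof (cases "v \<in> Tan p")
    case True
    have ev: "\<beta> v = (\<Sum>j<?n. h p v (e j p) * \<beta> (e j p))" if \<beta>: "\<beta> \<in> Cot p" for \<beta>
    proof -
      have "\<beta> v = \<beta> (\<lambda>f. \<Sum>i<?n. h p v (e i p) * e i p f)" by (rule arg_cong[OF span[OF U(2) True]])
      also have "\<dots> = (\<Sum>i<?n. h p v (e i p) * \<beta> (e i p))"
        by (rule cot_sum[OF \<beta>]) (simp add: fields_tan[OF e])
      finally show ?thesis .
    qed
    have "(\<Sum>i<?n. g p \<alpha> (\<theta> i) * \<theta> i v) = (\<Sum>i<?n. \<Sum>j<?n. h p v (e j p) * (g p \<alpha> (\<theta> i) * t i j))"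
      by (rule sum.cong[OF refl]) (simp add: ev[OF \<theta>] t_def sum_distrib_left mult_ac)
    also have "\<dots> = (\<Sum>j<?n. \<Sum>i<?n. h p v (e j p) * (g p \<alpha> (\<theta> i) * t i j))" by (rule sum.swap)
    also have "\<dots> = (\<Sum>j<?n. h p v (e j p) * \<alpha> (e j p))"
      by (rule sum.cong[OF refl]) (simp add: sum_distrib_left[symmetric] eval)
    finally show ?thesis using ev[OF \<alpha>] by simp
  next
    case False
    then show ?thesis by (simp add: cot_outside[OF \<alpha>] cot_outside[OF \<theta>])
  qed
qed

end

section \<open>Killing 1-forms on Riemannian Poisson manifolds\<close>

locale riemannian_poisson = bivector_manifold A P + metric_manifold A h
  for A :: "('m::{t2_space,second_countable_topology}, 'e::euclidean_space) chart set"
    and P :: "'m cobilinear" and h :: "'m metric" +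
  fixes D :: "'m form \<Rightarrow> 'm form \<Rightarrow> 'm form"
  assumes levi_civita: "contravariant_levi_civita A P (cometric A h) D"
    and parallel: "parallel_bivector A P D"
begin

abbreviation "S \<equiv> sharp A P"
abbreviation "K \<equiv> koszul A P"

lemma D_forms: "\<omega> \<in> Forms \<Longrightarrow> \<zeta> \<in> Forms \<Longrightarrow> D \<omega> \<zeta> \<in> Forms"
  and D_add_left: "\<omega> \<in> Forms \<Longrightarrow> \<omega>' \<in> Forms \<Longrightarrow> \<zeta> \<in> Forms \<Longrightarrow> D (\<omega> +\<^sub>F \<omega>') \<zeta> = D \<omega> \<zeta> +\<^sub>F D \<omega>' \<zeta>"
  and D_scale_left: "\<omega> \<in> Forms \<Longrightarrow> \<zeta> \<in> Forms \<Longrightarrow> \<phi> \<in> Fun \<Longrightarrow> D (\<phi> *\<^sub>F \<omega>) \<zeta> = \<phi> *\<^sub>F D \<omega> \<zeta>"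
  and torsion_free: "\<omega> \<in> Forms \<Longrightarrow> \<zeta> \<in> Forms \<Longrightarrow> K \<omega> \<zeta> = D \<omega> \<zeta> -\<^sub>F D \<zeta> \<omega>"
  and compatible: "\<omega> \<in> Forms \<Longrightarrow> \<zeta> \<in> Forms \<Longrightarrow> \<gamma> \<in> Forms \<Longrightarrow>
     S \<omega> p (\<lambda>q. g q (\<zeta> q) (\<gamma> q)) = g p (D \<omega> \<zeta> p) (\<gamma> p) + g p (\<zeta> p) (D \<omega> \<gamma> p)"
  using levi_civita unfolding contravariant_levi_civita_def contravariant_connection_def by auto

lemma P_parallel: "\<omega> \<in> Forms \<Longrightarrow> \<zeta> \<in> Forms \<Longrightarrow> \<gamma> \<in> Forms \<Longrightarrow>
     S \<omega> p (\<lambda>q. P q (\<zeta> q) (\<gamma> q)) = P p (D \<omega> \<zeta> p) (\<gamma> p) + P p (\<zeta> p) (D \<omega> \<gamma> p)"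
  using parallel unfolding parallel_bivector_def by auto

lemma torsion_free_at: "\<omega> \<in> Forms \<Longrightarrow> \<zeta> \<in> Forms \<Longrightarrow> K \<omega> \<zeta> p = (\<lambda>v. 1 * D \<omega> \<zeta> p v + (- 1) * D \<zeta> \<omega> p v)"
  by (simp add: torsion_free form_diff_def)

lemma K_forms: "\<omega> \<in> Forms \<Longrightarrow> \<zeta> \<in> Forms \<Longrightarrow> K \<omega> \<zeta> \<in> Forms"
proof -
  assume f: "\<omega> \<in> Forms" "\<zeta> \<in> Forms"
  show ?thesis
    using forms_combo[of "{True, False}" "\<lambda>i. if i then D \<omega> \<zeta> else D \<zeta> \<omega>" "\<lambda>i q. if i then 1 else - 1"]
      D_forms f by (simp add: torsion_free form_diff_def)
qed

lemma K_apply: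
  assumes "\<omega> \<in> Forms" "\<zeta> \<in> Forms" "Y \<in> Fields"
  shows "K \<omega> \<zeta> p (Y p) = (S \<omega> p (\<lambda>q. \<zeta> q (Y q)) - \<zeta> p (lie_bracket (S \<omega>) Y p))
     - (S \<zeta> p (\<lambda>q. \<omega> q (Y q)) - \<omega> p (lie_bracket (S \<zeta>) Y p)) - Y p (\<lambda>q. P q (\<omega> q) (\<zeta> q))"
  by (simp add: koszul_def form_diff_def ext_deriv_apply[OF fields_tan[OF assms(3)]]
      lie_deriv_apply[OF sharp_fields[OF assms(1)] assms(2,3)] lie_deriv_apply[OF sharp_fields[OF assms(2)] assms(1,3)])

lemma cot_bracket_swap:
  assumes "\<alpha> \<in> Cot p" "X \<in> Fields" "Y \<in> Fields"
  shows "\<alpha> (lie_bracket Y X p) = - \<alpha> (lie_bracket X Y p)"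
proof -
  have "lie_bracket Y X p = (\<lambda>f. (- 1) * lie_bracket X Y p f + 0 * lie_bracket X Y p f)"
    by (simp add: lie_bracket_def)
  then show ?thesis
    using cot_lin[OF assms(1) fields_tan[OF lie_bracket_fields[OF assms(2,3)]] fields_tan[OF lie_bracket_fields[OF assms(2,3)]], of "-1" 0]
    by simp
qed

text \<open>
  Let \<open>\<gamma> = df\<close>.  The cyclic sum of \<open>\<sharp>\<alpha> P(\<beta>,\<gamma>) - P([\<alpha>,\<beta>],\<gamma>)\<close> over \<open>(\<alpha>,\<beta>,\<gamma>)\<close> is zero, since \<open>P\<close> is parallel
  and the Koszul bracket is \<open>D\<^sub>\<alpha> \<beta> - D\<^sub>\<beta> \<alpha>\<close>.  By the formula for the Lie derivative the same sum is twice
  the difference of the two sides.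
\<close>

lemma anchor_bracket:
  assumes \<alpha>: "\<alpha> \<in> Forms" and \<beta>: "\<beta> \<in> Forms" and f: "f \<in> Fun"
  shows "S \<alpha> p (\<lambda>q. S \<beta> q f) - S \<beta> p (\<lambda>q. S \<alpha> q f) = S (K \<alpha> \<beta>) p f"
proof -
  define \<gamma> where "\<gamma> = ext_deriv A f"
  have \<gamma>: "\<gamma> \<in> Forms" unfolding \<gamma>_def by (rule ext_deriv_forms[OF f])
  note F = sharp_fields[OF \<alpha>] sharp_fields[OF \<beta>] sharp_fields[OF \<gamma>]
  note T = fields_tan[OF F(1)] fields_tan[OF F(2)] fields_tan[OF F(3)]
  note C = forms_cot[OF \<alpha>] forms_cot[OF \<beta>] forms_cot[OF \<gamma>]
  define AB where "AB = S \<alpha> p (\<lambda>q. S \<beta> q f)"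
  define BA where "BA = S \<beta> p (\<lambda>q. S \<alpha> q f)"
  define XF where "XF = S \<gamma> p (\<lambda>q. P q (\<alpha> q) (\<beta> q))"
  define \<beta>ax where "\<beta>ax = \<beta> p (lie_bracket (S \<alpha>) (S \<gamma>) p)"
  define \<alpha>bx where "\<alpha>bx = \<alpha> p (lie_bracket (S \<beta>) (S \<gamma>) p)"
  have sm: "(\<lambda>q. S \<alpha> q f) \<in> Fun" "(\<lambda>q. S \<beta> q f) \<in> Fun" "(\<lambda>q. P q (\<alpha> q) (\<beta> q)) \<in> Fun"
    by (rule fields_smooth[OF F(1) f], rule fields_smooth[OF F(2) f], rule P_smooth[OF \<alpha> \<beta>])
  have Pg: "P q (\<alpha> q) (\<gamma> q) = S \<alpha> q f" "P q (\<beta> q) (\<gamma> q) = S \<beta> q f"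
    "P q (\<gamma> q) (\<alpha> q) = - S \<alpha> q f" "P q (\<gamma> q) (\<beta> q) = - S \<beta> q f"
    "P q (\<beta> q) (\<alpha> q) = - P q (\<alpha> q) (\<beta> q)" for q
    using sharp_fun[OF \<alpha> f, of q] sharp_fun[OF \<beta> f, of q] P_antisym[OF C(3,1), of q]
      P_antisym[OF C(3,2), of q] P_antisym[OF C(2,1), of q]
    unfolding \<gamma>_def[symmetric] by simp_all
  note neg = tan_minus[OF T(1) sm(2)] tan_minus[OF T(2) sm(1)] tan_minus[OF T(3) sm(3)]
  have \<gamma>b: "\<gamma> p v = v f" if "v \<in> Tan p" for v p unfolding \<gamma>_def by (rule ext_deriv_apply[OF that])
  \<comment> \<open>The Koszul brackets of the cyclic sum, expanded by the formula for the Lie derivative.\<close>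
  have k1: "K \<alpha> \<beta> p (S \<gamma> p) = - AB - \<beta>ax + BA + \<alpha>bx - XF"
    unfolding K_apply[OF \<alpha> \<beta> F(3)] sharp_apply[OF \<gamma> C(1)] sharp_apply[OF \<gamma> C(2)] Pg neg
    by (simp add: AB_def BA_def XF_def \<alpha>bx_def \<beta>ax_def)
  have k2: "K \<beta> \<gamma> p (S \<alpha> p) = - XF - \<beta>ax"
    unfolding K_apply[OF \<beta> \<gamma> F(1)] \<gamma>b[OF T(1)] sharp_apply[OF \<alpha> C(2)] Pg
      \<gamma>b[OF fields_tan[OF lie_bracket_fields[OF F(2,1)]]] cot_bracket_swap[OF C(2) F(1,3)]
    by (simp add: AB_def BA_def XF_def \<beta>ax_def lie_bracket_def)
  have k3: "K \<gamma> \<alpha> p (S \<beta> p) = - XF + \<alpha>bx"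
    unfolding K_apply[OF \<gamma> \<alpha> F(2)] \<gamma>b[OF T(2)] sharp_apply[OF \<beta> C(1)] Pg neg
      \<gamma>b[OF fields_tan[OF lie_bracket_fields[OF F(1,2)]]] cot_bracket_swap[OF C(1) F(2,3)]
    by (simp add: AB_def BA_def XF_def \<alpha>bx_def lie_bracket_def)
  have PK: "P p (K \<omega> \<zeta> p) (\<theta> p) = P p (D \<omega> \<zeta> p) (\<theta> p) - P p (D \<zeta> \<omega> p) (\<theta> p)"
    if "\<omega> \<in> Forms" "\<zeta> \<in> Forms" "\<theta> \<in> Forms" for \<omega> \<zeta> \<theta>
    unfolding torsion_free_at[OF that(1,2)]
    by (subst P_lin[OF forms_cot[OF D_forms[OF that(1,2)]] forms_cot[OF D_forms[OF that(2,1)]] forms_cot[OF that(3)]]) simp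
  have PK': "P p (K \<omega> \<zeta> p) (\<theta> p) = - K \<omega> \<zeta> p (S \<theta> p)"
    if "\<omega> \<in> Forms" "\<zeta> \<in> Forms" "\<theta> \<in> Forms" for \<omega> \<zeta> \<theta>
    using sharp_apply[OF that(3) forms_cot[OF K_forms[OF that(1,2)]], of p]
      P_antisym[OF forms_cot[OF K_forms[OF that(1,2)], of p] forms_cot[OF that(3), of p]] by simp
  have D': "P p (\<zeta> p) (D \<omega> \<theta> p) = - P p (D \<omega> \<theta> p) (\<zeta> p)"
    if "\<omega> \<in> Forms" "\<zeta> \<in> Forms" "\<theta> \<in> Forms" for \<omega> \<zeta> \<theta>
    by (rule P_antisym[OF forms_cot[OF that(2)] forms_cot[OF D_forms[OF that(1,3)]]])
  \<comment> \<open>The covariant derivatives of the three parallelism identities combine to Koszul brackets.\<close>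
  have "AB - BA + XF = P p (K \<alpha> \<beta> p) (\<gamma> p) + P p (K \<beta> \<gamma> p) (\<alpha> p) + P p (K \<gamma> \<alpha> p) (\<beta> p)"
    using P_parallel[OF \<alpha> \<beta> \<gamma>, of p] P_parallel[OF \<beta> \<gamma> \<alpha>, of p] P_parallel[OF \<gamma> \<alpha> \<beta>, of p]
    unfolding PK[OF \<alpha> \<beta> \<gamma>] PK[OF \<beta> \<gamma> \<alpha>] PK[OF \<gamma> \<alpha> \<beta>]
      D'[OF \<alpha> \<beta> \<gamma>] D'[OF \<beta> \<gamma> \<alpha>] D'[OF \<gamma> \<alpha> \<beta>] Pg neg
    by (simp add: AB_def BA_def XF_def)
  then have "AB - BA + XF = - K \<alpha> \<beta> p (S \<gamma> p) - K \<beta> \<gamma> p (S \<alpha> p) - K \<gamma> \<alpha> p (S \<beta> p)"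
    unfolding PK'[OF \<alpha> \<beta> \<gamma>] PK'[OF \<beta> \<gamma> \<alpha>] PK'[OF \<gamma> \<alpha> \<beta>] by simp
  then have "\<beta>ax - \<alpha>bx + XF = 0" unfolding k1 k2 k3 by simp
  moreover have "S (K \<alpha> \<beta>) p f = - K \<alpha> \<beta> p (S \<gamma> p)"
    using sharp_fun[OF K_forms[OF \<alpha> \<beta>] f, of p] PK'[OF \<alpha> \<beta> \<gamma>] by (simp add: \<gamma>_def)
  ultimately show ?thesis unfolding k1 by (simp add: AB_def BA_def)
qed

lemma g_zero: "\<alpha> \<in> Cot p \<Longrightarrow> g p \<alpha> (\<lambda>v. 0) = 0"
proof -
  assume \<alpha>: "\<alpha> \<in> Cot p"
  have "(\<lambda>v. 0) \<in> Cot p" using cot_combo[of "{}"] by simp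
  then show ?thesis using g_lin[OF \<alpha> \<alpha> \<alpha>, of 0 0] g_sym[OF \<alpha>] by simp
qed

lemma D_sum_left:
  assumes "finite I" "\<And>i. i \<in> I \<Longrightarrow> \<omega> i \<in> Forms" "\<And>i. i \<in> I \<Longrightarrow> a i \<in> Fun" "\<zeta> \<in> Forms"
  shows "D (\<lambda>q v. \<Sum>i\<in>I. a i q * \<omega> i q v) \<zeta> p v = (\<Sum>i\<in>I. a i p * D (\<omega> i) \<zeta> p v)"
  using assms(1-3)
proof (induction I rule: finite_induct)
  case empty
  have "(\<lambda>q. 0) *\<^sub>F \<zeta> = (\<lambda>q v. 0)" by (simp add: form_scale_def)
  then have "D (\<lambda>q v. 0) \<zeta> = (\<lambda>q. 0) *\<^sub>F D \<zeta> \<zeta>"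
    using D_scale_left[OF assms(4,4) smooth_fun_const, of 0] by simp
  then show ?case by (simp add: form_scale_def)
next
  case (insert i I)
  have s: "a i *\<^sub>F \<omega> i \<in> Forms"
    using forms_combo[of "{i}" \<omega> a] insert.prems by (simp add: form_scale_def)
  have r: "(\<lambda>q v. \<Sum>i\<in>I. a i q * \<omega> i q v) \<in> Forms"
    by (rule forms_combo) (use insert.prems in auto)
  have "(\<lambda>q v. \<Sum>j\<in>insert i I. a j q * \<omega> j q v) = (a i *\<^sub>F \<omega> i) +\<^sub>F (\<lambda>q v. \<Sum>i\<in>I. a i q * \<omega> i q v)"
    using insert.hyps by (simp add: form_add_def form_scale_def)
  then have "D (\<lambda>q v. \<Sum>j\<in>insert i I. a j q * \<omega> j q v) \<zeta>
      = (a i *\<^sub>F D (\<omega> i) \<zeta>) +\<^sub>F D (\<lambda>q v. \<Sum>i\<in>I. a i q * \<omega> i q v) \<zeta>"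
    using D_add_left[OF s r assms(4)] D_scale_left[of "\<omega> i" \<zeta> "a i"] insert.prems assms(4) by simp
  then show ?case using insert by (simp add: form_add_def form_scale_def)
qed

text \<open>
  Multiplied by a bump function supported where the coframe is orthonormal, \<open>\<alpha>\<close> becomes a combination of
  the \<open>\<theta>\<^sub>i\<close> with smooth coefficients on all of \<open>M\<close>, and \<open>D\<close> is function-linear in its first argument.
\<close>

lemma vanishes_if_vanishes_on_coframe:
  assumes \<theta>: "local_orthonormal_coframe A g p \<theta>" and \<eta>: "\<eta> \<in> Forms"
    and 0: "\<And>i. i < DIM('e) \<Longrightarrow> D (\<theta> i) \<eta> p = (\<lambda>v. 0)" and \<alpha>: "\<alpha> \<in> Forms"
  shows "D \<alpha> \<eta> p = (\<lambda>v. 0)"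
proof
  fix v
  let ?n = "DIM('e)"
  obtain U where U: "open U" "p \<in> U" and \<theta>F: "\<And>i. i < ?n \<Longrightarrow> \<theta> i \<in> Forms"
    and orth: "\<And>q i j. q \<in> U \<Longrightarrow> i < ?n \<Longrightarrow> j < ?n \<Longrightarrow> g q (\<theta> i q) (\<theta> j q) = (if i = j then 1 else 0)"
    using \<theta> unfolding local_orthonormal_coframe_def by blast
  obtain \<rho> V where \<rho>: "\<rho> \<in> Fun" "p \<in> V" "\<And>q. q \<in> V \<Longrightarrow> \<rho> q = 1" "\<And>q. q \<notin> U \<Longrightarrow> \<rho> q = 0"
    by (rule bump_function[OF U]) blast
  define a where "a i = (\<lambda>q. \<rho> q * g q (\<alpha> q) (\<theta> i q))" for i
  have a: "a i \<in> Fun" if "i < ?n" for i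
    unfolding a_def by (rule smooth_fun_mult[OF \<rho>(1) g_smooth[OF \<alpha> \<theta>F[OF that]]])
  have "\<rho> *\<^sub>F \<alpha> = (\<lambda>q v. \<Sum>i<?n. a i q * \<theta> i q v)"
  proof (intro ext)
    fix q v show "(\<rho> *\<^sub>F \<alpha>) q v = (\<Sum>i<?n. a i q * \<theta> i q v)"
    proof (cases "q \<in> U")
      case True
      have "\<alpha> q = (\<lambda>v. \<Sum>i<?n. g q (\<alpha> q) (\<theta> i q) * \<theta> i q v)"
        by (rule coframe_expansion[OF forms_cot[OF \<theta>F] orth[OF True] forms_cot[OF \<alpha>]])
      from fun_cong[OF this, of v] have "\<alpha> q v = (\<Sum>i<?n. g q (\<alpha> q) (\<theta> i q) * \<theta> i q v)" .
      then have "\<rho> q * \<alpha> q v = \<rho> q * (\<Sum>i<?n. g q (\<alpha> q) (\<theta> i q) * \<theta> i q v)" by (rule arg_cong)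
      then show ?thesis by (simp add: form_scale_def a_def sum_distrib_left mult.assoc)
    qed (simp add: form_scale_def a_def \<rho>(4))
  qed
  then have "D (\<rho> *\<^sub>F \<alpha>) \<eta> p v = (\<Sum>i<?n. a i p * D (\<theta> i) \<eta> p v)"
    using D_sum_left[of "{..<?n}" \<theta> a \<eta> p v] \<theta>F a \<eta> by simp
  also have "\<dots> = 0" by (simp add: 0)
  finally show "D \<alpha> \<eta> p v = 0"
    using D_scale_left[OF \<alpha> \<eta> \<rho>(1)] \<rho>(2,3) by (simp add: form_scale_def)
qed

text \<open>
  Substitute \<open>[\<eta>,\<alpha>] = D\<^sub>\<eta> \<alpha> - D\<^sub>\<alpha> \<eta>\<close> into the Killing equation; the derivatives along \<open>\<eta>\<close> cancel by metric
  compatibility.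
\<close>

lemma killing_skew:
  assumes kill: "killing_form A P g \<eta>" and \<alpha>: "\<alpha> \<in> Forms" and \<beta>: "\<beta> \<in> Forms"
  shows "g p (D \<alpha> \<eta> p) (\<beta> p) = - g p (\<alpha> p) (D \<beta> \<eta> p)"
proof -
  have \<eta>: "\<eta> \<in> Forms" using kill by (simp add: killing_form_def)
  note c = forms_cot[OF \<alpha>, of p] forms_cot[OF \<beta>, of p] forms_cot[OF D_forms[OF \<eta> \<alpha>], of p] forms_cot[OF D_forms[OF \<alpha> \<eta>], of p]
    forms_cot[OF D_forms[OF \<eta> \<beta>], of p] forms_cot[OF D_forms[OF \<beta> \<eta>], of p]
  have "lie_deriv_cometric A P g \<eta> \<alpha> \<beta> p = 0" using kill \<alpha> \<beta> by (simp add: killing_form_def)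
  then have "S \<eta> p (\<lambda>q. g q (\<alpha> q) (\<beta> q)) - g p (K \<eta> \<alpha> p) (\<beta> p) - g p (\<alpha> p) (K \<eta> \<beta> p) = 0"
    by (simp add: lie_deriv_cometric_def)
  moreover have "g p (K \<eta> \<alpha> p) (\<beta> p) = g p (D \<eta> \<alpha> p) (\<beta> p) - g p (D \<alpha> \<eta> p) (\<beta> p)"
    unfolding torsion_free_at[OF \<eta> \<alpha>] by (subst g_lin[OF c(3,4,2)]) simp
  moreover have "g p (K \<eta> \<beta> p) (\<alpha> p) = g p (D \<eta> \<beta> p) (\<alpha> p) - g p (D \<beta> \<eta> p) (\<alpha> p)"
    unfolding torsion_free_at[OF \<eta> \<beta>] by (subst g_lin[OF c(5,6,1)]) simp
  moreover have "g p (\<alpha> p) (K \<eta> \<beta> p) = g p (K \<eta> \<beta> p) (\<alpha> p)"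
    by (rule g_sym[OF c(1) forms_cot[OF K_forms[OF \<eta> \<beta>]]])
  ultimately show ?thesis
    using compatible[OF \<eta> \<alpha> \<beta>, of p] g_sym[OF c(5,1)] g_sym[OF c(6,1)] by linarith
qed

text \<open>
  Put \<open>f = g(\<theta>,\<eta>)\<close> and \<open>\<kappa> = [\<eta>,\<theta>]\<close>.  As \<open>g(\<theta>, D\<^sub>\<theta> \<eta>) = 0\<close> by skewness and \<open>D\<^sub>\<eta> \<eta> = 0\<close>, metric compatibility
  gives \<open>g(D\<^sub>\<theta> \<theta>, \<eta>) = \<sharp>\<theta> f\<close> and \<open>g(D\<^sub>\<eta> \<theta>, \<eta>) = \<sharp>\<eta> f\<close>.  The three terms of the curvature thus become
  derivatives of \<open>f\<close>, which cancel by the anchor identity, plus \<open>g(D\<^sub>\<eta> \<theta>, D\<^sub>\<theta> \<eta>) + g(\<theta>, D\<^sub>\<kappa> \<eta>)\<close>.  By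
  skewness the last term is \<open>- g(\<kappa>, D\<^sub>\<theta> \<eta>) = - g(D\<^sub>\<eta> \<theta>, D\<^sub>\<theta> \<eta>) + g(D\<^sub>\<theta> \<eta>, D\<^sub>\<theta> \<eta>)\<close>.
\<close>

lemma curvature_killing:
  assumes kill: "killing_form A P g \<eta>" and geodesic: "D \<eta> \<eta> = form_zero" and \<theta>: "\<theta> \<in> Forms"
  shows "g p (curvature A P D \<eta> \<theta> \<theta> p) (\<eta> p) = g p (D \<theta> \<eta> p) (D \<theta> \<eta> p)"
proof -
  have \<eta>: "\<eta> \<in> Forms" using kill by (simp add: killing_form_def)
  note skew = killing_skew[OF kill]
  define f where "f = (\<lambda>q. g q (\<theta> q) (\<eta> q))"
  have f: "f \<in> Fun" unfolding f_def by (rule g_smooth[OF \<theta> \<eta>])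
  have \<kappa>: "K \<eta> \<theta> \<in> Forms" by (rule K_forms[OF \<eta> \<theta>])
  note d1 = D_forms[OF \<theta> \<theta>] D_forms[OF \<eta> \<theta>] D_forms[OF \<theta> \<eta>] D_forms[OF \<kappa> \<theta>] D_forms[OF \<kappa> \<eta>]
  note d2 = D_forms[OF \<eta> d1(1)] D_forms[OF \<theta> d1(2)]
  have D\<eta>\<eta>: "D \<eta> \<eta> q = (\<lambda>v. 0)" for q by (simp add: geodesic form_zero_def)
  have s1: "S \<theta> q f = g q (D \<theta> \<theta> q) (\<eta> q)" for q
    using compatible[OF \<theta> \<theta> \<eta>, of q] skew[OF \<theta> \<theta>, of q] g_sym[OF forms_cot[OF \<theta>, of q] forms_cot[OF d1(3), of q]]
    unfolding f_def by linarith
  have s2: "S \<eta> q f = g q (D \<eta> \<theta> q) (\<eta> q)" for q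
    using compatible[OF \<eta> \<theta> \<eta>, of q] by (simp add: f_def D\<eta>\<eta> g_zero[OF forms_cot[OF \<theta>]])
  have c1: "S \<eta> p (\<lambda>q. S \<theta> q f) = g p (D \<eta> (D \<theta> \<theta>) p) (\<eta> p)"
    using compatible[OF \<eta> d1(1) \<eta>, of p] by (simp add: s1 D\<eta>\<eta> g_zero[OF forms_cot[OF d1(1)]])
  have c2: "S \<theta> p (\<lambda>q. S \<eta> q f) = g p (D \<theta> (D \<eta> \<theta>) p) (\<eta> p) + g p (D \<eta> \<theta> p) (D \<theta> \<eta> p)"
    using compatible[OF \<theta> d1(2) \<eta>, of p] by (simp add: s2)
  have c3: "S (K \<eta> \<theta>) p f = g p (D (K \<eta> \<theta>) \<theta> p) (\<eta> p) + g p (\<theta> p) (D (K \<eta> \<theta>) \<eta> p)"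
    using compatible[OF \<kappa> \<theta> \<eta>, of p] by (simp add: f_def)
  have "g p (\<theta> p) (D (K \<eta> \<theta>) \<eta> p) = - g p (K \<eta> \<theta> p) (D \<theta> \<eta> p)"
    using skew[OF \<theta> \<kappa>, of p] skew[OF \<kappa> \<theta>, of p]
      g_sym[OF forms_cot[OF d1(5), of p] forms_cot[OF \<theta>, of p]] by linarith
  also have "g p (K \<eta> \<theta> p) (D \<theta> \<eta> p) = g p (D \<eta> \<theta> p) (D \<theta> \<eta> p) - g p (D \<theta> \<eta> p) (D \<theta> \<eta> p)"
    unfolding torsion_free_at[OF \<eta> \<theta>]
    by (subst g_lin[OF forms_cot[OF d1(2)] forms_cot[OF d1(3)] forms_cot[OF d1(3)]]) simp
  finally have c4: "g p (\<theta> p) (D (K \<eta> \<theta>) \<eta> p) = - g p (D \<eta> \<theta> p) (D \<theta> \<eta> p) + g p (D \<theta> \<eta> p) (D \<theta> \<eta> p)"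
    by simp
  have "curvature A P D \<eta> \<theta> \<theta> p
      = (\<lambda>v. 1 * (1 * D \<eta> (D \<theta> \<theta>) p v + (- 1) * D \<theta> (D \<eta> \<theta>) p v) + (- 1) * D (K \<eta> \<theta>) \<theta> p v)"
    by (simp add: curvature_def form_diff_def)
  then have "g p (curvature A P D \<eta> \<theta> \<theta> p) (\<eta> p)
      = g p (D \<eta> (D \<theta> \<theta>) p) (\<eta> p) - g p (D \<theta> (D \<eta> \<theta>) p) (\<eta> p) - g p (D (K \<eta> \<theta>) \<theta> p) (\<eta> p)"
    using g_lin[OF cot_lincomb[OF forms_cot[OF d2(1)] forms_cot[OF d2(2)]] forms_cot[OF d1(4)] forms_cot[OF \<eta>], of p 1 1 "-1" "-1"]
      g_lin[OF forms_cot[OF d2(1)] forms_cot[OF d2(2)] forms_cot[OF \<eta>], of p 1 "-1"] by simp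
  then show ?thesis using c1 c2 c3 c4 anchor_bracket[OF \<eta> \<theta> f, of p] by simp
qed

text \<open>
  The Ricci curvature is a sum of squared norms, so it can be nonpositive only if each of them is
  zero.
\<close>

lemma killing_geodesic_parallel:
  assumes kill: "killing_form A P g \<eta>" and geodesic: "D \<eta> \<eta> = form_zero"
    and ric: "\<And>p. ricci A P g D \<eta> \<eta> p \<le> 0"
  shows "parallel_form A D \<eta>"
  unfolding parallel_form_def
proof (intro ballI ext)
  fix \<alpha> p v assume \<alpha>: "\<alpha> \<in> Forms"
  let ?n = "DIM('e)"
  have \<eta>: "\<eta> \<in> Forms" using kill by (simp add: killing_form_def)
  define \<theta> where "\<theta> = (SOME \<theta>. local_orthonormal_coframe A g p \<theta>)"
  have \<theta>: "local_orthonormal_coframe A g p \<theta>"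
    unfolding \<theta>_def by (rule someI_ex[OF local_orthonormal_coframe_exists])
  then have \<theta>F: "\<theta> i \<in> Forms" if "i < ?n" for i
    using that unfolding local_orthonormal_coframe_def by blast
  note nn = g_nonneg[OF forms_cot[OF D_forms[OF \<theta>F \<eta>]], of _ p]
  have "ricci A P g D \<eta> \<eta> p = (\<Sum>i<?n. g p (curvature A P D \<eta> (\<theta> i) (\<theta> i) p) (\<eta> p))"
    by (simp add: ricci_def Let_def \<theta>_def)
  also have "\<dots> = (\<Sum>i<?n. g p (D (\<theta> i) \<eta> p) (D (\<theta> i) \<eta> p))"
    by (rule sum.cong[OF refl]) (simp add: curvature_killing[OF kill geodesic \<theta>F])
  finally have "(\<Sum>i<?n. g p (D (\<theta> i) \<eta> p) (D (\<theta> i) \<eta> p)) \<le> 0" using ric[of p] by simp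
  then have "(\<Sum>i<?n. g p (D (\<theta> i) \<eta> p) (D (\<theta> i) \<eta> p)) = 0"
    by (intro antisym sum_nonneg) (simp_all add: nn)
  then have "g p (D (\<theta> i) \<eta> p) (D (\<theta> i) \<eta> p) = 0" if "i < ?n" for i
    using that by (subst (asm) sum_nonneg_eq_0_iff) (simp_all add: nn)
  then have "D (\<theta> i) \<eta> p = (\<lambda>v. 0)" if "i < ?n" for i
    by (rule g_definite[OF forms_cot[OF D_forms[OF \<theta>F[OF that] \<eta>]]]) (use that in simp)
  from vanishes_if_vanishes_on_coframe[OF \<theta> \<eta> this \<alpha>]
  show "D \<alpha> \<eta> p v = form_zero p v" by (simp add: form_zero_def)
qed

end

theorem theorem3p10:
  fixes A :: "('m::{t2_space,second_countable_topology}, 'e::euclidean_space) chart set"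
    and h :: "'m metric"
    and P :: "'m cobilinear"
    and D :: "'m form \<Rightarrow> 'm form \<Rightarrow> 'm form"
    and \<eta> :: "'m form"
  assumes "riemannian_poisson_manifold A h P D"
    and "compact (UNIV :: 'm set)"
    and "killing_form A P (cometric A h) \<eta>"
    and "D \<eta> \<eta> = form_zero"
    and "\<forall>p. ricci A P (cometric A h) D \<eta> \<eta> p \<le> 0"
  shows "parallel_form A D \<eta>"
proof -
  interpret riemannian_poisson A P h D
    using assms(1) unfolding riemannian_poisson_manifold_def poisson_tensor_def
    by unfold_locales auto
  show ?thesis using killing_geodesic_parallel assms(3-5) by blast
qed

end
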